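(* Let $\mathcal{L}$ be a first order language and let $i: \mathcal{A} \to \mathcal{L}$ be some fixed 2-translation. Then there is a computable total map $Spec_{i}: \mathcal{T} \to \mathcal{T}$ with the following properties: (1) $\operatorname{image} Spec_{i} \subset \mathcal{T}_{\mathcal{L}}$. (2) Suppose that $T \in \mathcal{T}_{\mathcal{L}}$ and $T^{s} \vdash^{i} Q$, and set $T_{spec} = Spec_{i}(T)$. Then $T'_{spec}$ is speculative (with respect to $i$); moreover, if $T'$ is total then so is $T'_{spec}$. (3) If $T \in \mathcal{T}_{\mathcal{L}}$ then $T_{spec}^{s} \supset T^{s}$. (4) If $T \in \mathcal{T}_{\mathcal{L}}$ and $T^{s}$ is $1$-consistent with respect to $i$, then $T_{spec}^{s}$ is consistent.
   Context: Setting (in ZFC). A map means a partial map unless stated total. $\mathcal{T}$ is the set of Turing machines $\mathbb{N} \to \mathbb{N}$, with a distinguished encoding into $\mathbb{N}$ for which the universal function $U(T,n)=T(n)$ is computable. An encoding of a set $A$ is an injective total map $e_A: A \to \mathbb{N}$ with computable image; a map $f: A \to B$ between encoded sets is computable if some $T \in \mathcal{T}$ satisfies $e_B \circ f = T \circ e_A$ (as partial maps). $\{\pm\}$ is encoded by $-\mapsto 0$, $+\mapsto 1$, and products carry the product encoding $(a,b)\mapsto 2^{e_A(a)}3^{e_B(b)}$. $\mathcal{L}$ carries a standard encoding (with deductive closure of finite lists of sentences computably enumerable). $\mathcal{A}$ is the first order language of arithmetic with non-logical symbols $0,+,\times,s,<$, and $Q$ is Robinson arithmetic. $\mathcal{T}_{\mathcal{L}}$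 is the set of $T \in \mathcal{T}$ for which there is a (necessarily unique) map $T': \mathbb{N} \to \mathcal{L} \times \{\pm\}$ with $e_{\mathcal{L}\times\{\pm\}} \circ T' = T$. For $M: \mathbb{N} \to \mathcal{L} \times \{\pm\}$, a sentence $\alpha$ is $M$-stable if there is $m$ with $M(m) = (\alpha,+)$ and no $n > m$ with $M(n) = (\alpha,-)$; the stabilization $M^{s}$ is the set of $M$-stable sentences, and for $T \in \mathcal{T}_{\mathcal{L}}$ one writes $T^{s} := (T')^{s}$. A translation $i: \mathcal{L}' \to \mathcal{L}$ is a total injective map preserving $\land,\lor,\neg$ such that $S \vdash \alpha$ implies $i(S) \vdash i(\alpha)$. A translation $i:\mathcal{A}\to\mathcal{L}$ is an $n$-translation if its restriction to $\Sigma^0_n$ formulas is computable. For an $\mathcal{L}$-theory $F$ with deductive closure $\overline{F}$, put $F_{i,\mathcal{A}} = i^{-1}(\overline{F})$; $F \vdash^{i} \alpha$ means $F_{i,\mathcal{A}} \vdash \alpha$ (similarly $F \vdash^i F'$ for a theory $F'$), and for $M: \mathbb{N}\to\mathcal{L}\times\{\pm\}$, $M \vdash^{i} \alpha$ means $M^{s} \vdash^{i} \alpha$. $\mathcal{F}_0$ is the set of $\Sigma^0_0$ formulas of arithmetic with one free variable. $F$ is $1$-consistent relative to $i$ if $F \vdash^{i} Q$ and for every $\phi \in \mathcal{F}_0$: if $F \vdash^{i} \exists m\, \phi(m)$ then there is $m$ with $F \nvdash^{i} \neg\phi(m)$. A map $M: \mathbb{N} \to \mathcal{L} \times \{\pm\}$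 is speculative with respect to $i$ if for every $\phi \in \mathcal{F}_0$, writing $\alpha_\phi = \forall m\, \phi(m)$: if $Q \vdash \phi(m)$ for every $m$ then $M \vdash^{i} \alpha_\phi$. *)

theory Defs
  imports "HOL-Library.Nat_Bijection"
begin

section \<open>Turing machines and computable maps\<close>

text \<open>
  Deterministic single-tape machines with a two-way infinite tape and an arbitrary finite
  alphabet. States and tape symbols are numbers: the start state is 0, the blank is 0 and the
  stroke is 1. A machine is a finite table of instructions; an entry \<open>((q, a), (b, d, q'))\<close>
  means: in state \<open>q\<close> scanning \<open>a\<close>, write \<open>b\<close>, move in direction \<open>d\<close>, enter state \<open>q'\<close>.
  If several entries have the same left-hand side, the first one counts. The machine halts
  when no entry applies.
\<close>

datatype dir = Lft | Rgt

type_synonym turing = "((nat \<times> nat) \<times> (nat \<times> dir \<times> nat)) list"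

type_synonym config = "nat \<times> (int \<Rightarrow> nat) \<times> int"

primrec offset :: "dir \<Rightarrow> int" where
  "offset Lft = -1"
| "offset Rgt = 1"

definition halted :: "turing \<Rightarrow> config \<Rightarrow> bool" where
  "halted T c = (case c of (q, tape, h) \<Rightarrow> map_of T (q, tape h) = None)"

definition step :: "turing \<Rightarrow> config \<Rightarrow> config" where
  "step T c = (case c of (q, tape, h) \<Rightarrow>
     (case map_of T (q, tape h) of
        None \<Rightarrow> c
      | Some (b, d, q') \<Rightarrow> (q', tape(h := b), h + offset d)))"

text \<open>The input \<open>n\<close> is a block of \<open>n\<close> strokes, with the head on the leftmost one (for \<open>n = 0\<close> the
  tape is blank). The output is the number of strokes on the tape when the machine has halted.\<close>

definition start :: "nat \<Rightarrow> config" where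
  "start n = (0, (\<lambda>j. if 0 \<le> j \<and> j < int n then 1 else 0), 0)"

definition strokes :: "config \<Rightarrow> nat" where
  "strokes c = (case c of (q, tape, h) \<Rightarrow> card {j. tape j = 1})"

definition tm_fun :: "turing \<Rightarrow> nat \<Rightarrow> nat option" where
  "tm_fun T n =
     (if \<exists>k. halted T ((step T ^^ k) (start n))
      then Some (strokes ((step T ^^ (LEAST k. halted T ((step T ^^ k) (start n)))) (start n)))
      else None)"

primrec code_dir :: "dir \<Rightarrow> nat" where
  "code_dir Lft = 0"
| "code_dir Rgt = 1"

definition code_turing :: "turing \<Rightarrow> nat" where
  "code_turing T = list_encode
     (map (\<lambda>((q, a), (b, d, q')).
        prod_encode (prod_encode (q, a), prod_encode (b, prod_encode (code_dir d, q')))) T)"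

lemma inj_code_turing: "inj code_turing"
proof (rule injI)
  have "inj (\<lambda>((q, a), (b, d, q')).
        prod_encode (prod_encode (q, a), prod_encode (b, prod_encode (code_dir d, q'))))"
  proof -
    have "code_dir d = code_dir d' \<Longrightarrow> d = d'" for d d'
      by (cases d; cases d') auto
    then show ?thesis by (auto simp: inj_def)
  qed
  then show "code_turing S = code_turing T \<Longrightarrow> S = T" for S T
    by (auto simp: code_turing_def list_encode_eq dest: map_injective)
qed

text \<open>Partial maps are option-valued functions. An encoded set is a set together with an
  encoding of it.\<close>

definition computable_set :: "nat set \<Rightarrow> bool" where
  "computable_set X \<longleftrightarrow> (\<exists>T. \<forall>n. tm_fun T n = Some (if n \<in> X then 1 else 0))"

definition is_encoding :: "'a set \<Rightarrow> ('a \<Rightarrow> nat) \<Rightarrow> bool" where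
  "is_encoding A e \<longleftrightarrow> inj_on e A \<and> computable_set (e ` A)"

definition computable_map ::
    "'a set \<Rightarrow> ('a \<Rightarrow> nat) \<Rightarrow> 'b set \<Rightarrow> ('b \<Rightarrow> nat) \<Rightarrow> ('a \<Rightarrow> 'b option) \<Rightarrow> bool" where
  "computable_map A eA B eB f \<longleftrightarrow>
     (\<forall>a\<in>A. \<forall>b. f a = Some b \<longrightarrow> b \<in> B) \<and>
     (\<exists>T. \<forall>a\<in>A. map_option eB (f a) = tm_fun T (eA a))"

definition code_prod :: "('a \<Rightarrow> nat) \<Rightarrow> ('b \<Rightarrow> nat) \<Rightarrow> 'a \<times> 'b \<Rightarrow> nat" where
  "code_prod eA eB p = 2 ^ eA (fst p) * 3 ^ eB (snd p)"

definition code_list :: "('a \<Rightarrow> nat) \<Rightarrow> 'a list \<Rightarrow> nat" where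
  "code_list e xs = list_encode (map e xs)"

datatype sign = Minus | Plus

primrec code_sign :: "sign \<Rightarrow> nat" where
  "code_sign Minus = 0"
| "code_sign Plus = 1"


section \<open>First-order logic with equality\<close>

text \<open>Variables are de Bruijn indices. Implication and equivalence are abbreviations.\<close>

datatype 'f trm = Var nat | Fn 'f "'f trm list"

datatype ('f, 'r) fm =
    Eq "'f trm" "'f trm"
  | Rel 'r "'f trm list"
  | Neg "('f, 'r) fm"
  | And "('f, 'r) fm" "('f, 'r) fm"
  | Or "('f, 'r) fm" "('f, 'r) fm"
  | All "('f, 'r) fm"
  | Ex "('f, 'r) fm"

abbreviation Imp :: "('f, 'r) fm \<Rightarrow> ('f, 'r) fm \<Rightarrow> ('f, 'r) fm" where
  "Imp p q \<equiv> Or (Neg p) q"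

abbreviation Iff :: "('f, 'r) fm \<Rightarrow> ('f, 'r) fm \<Rightarrow> ('f, 'r) fm" where
  "Iff p q \<equiv> And (Imp p q) (Imp q p)"

text \<open>A first-order language is given by the arities of its symbols; symbols that are mapped to
  \<open>None\<close> do not belong to the language, so it may lack function or relation symbols.\<close>

record ('f, 'r) lang =
  fun_arity :: "'f \<Rightarrow> nat option"
  rel_arity :: "'r \<Rightarrow> nat option"

primrec wf_trm :: "('f, 'r) lang \<Rightarrow> 'f trm \<Rightarrow> bool" where
  "wf_trm L (Var n) \<longleftrightarrow> True"
| "wf_trm L (Fn f ts) \<longleftrightarrow> fun_arity L f = Some (length ts) \<and> list_all (wf_trm L) ts"

primrec wf_fm :: "('f, 'r) lang \<Rightarrow> ('f, 'r) fm \<Rightarrow> bool" where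
  "wf_fm L (Eq s t) \<longleftrightarrow> wf_trm L s \<and> wf_trm L t"
| "wf_fm L (Rel r ts) \<longleftrightarrow> rel_arity L r = Some (length ts) \<and> list_all (wf_trm L) ts"
| "wf_fm L (Neg p) \<longleftrightarrow> wf_fm L p"
| "wf_fm L (And p q) \<longleftrightarrow> wf_fm L p \<and> wf_fm L q"
| "wf_fm L (Or p q) \<longleftrightarrow> wf_fm L p \<and> wf_fm L q"
| "wf_fm L (All p) \<longleftrightarrow> wf_fm L p"
| "wf_fm L (Ex p) \<longleftrightarrow> wf_fm L p"

primrec fv_trm :: "'f trm \<Rightarrow> nat set" where
  "fv_trm (Var n) = {n}"
| "fv_trm (Fn f ts) = \<Union> (set (map fv_trm ts))"

primrec fv :: "('f, 'r) fm \<Rightarrow> nat set" where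
  "fv (Eq s t) = fv_trm s \<union> fv_trm t"
| "fv (Rel r ts) = \<Union> (set (map fv_trm ts))"
| "fv (Neg p) = fv p"
| "fv (And p q) = fv p \<union> fv q"
| "fv (Or p q) = fv p \<union> fv q"
| "fv (All p) = {n. Suc n \<in> fv p}"
| "fv (Ex p) = {n. Suc n \<in> fv p}"

definition sentences :: "('f, 'r) lang \<Rightarrow> ('f, 'r) fm set" where
  "sentences L = {p. wf_fm L p \<and> fv p = {}}"

text \<open>\<open>lift k\<close> makes room for a fresh variable of index \<open>k\<close>; \<open>subst k s\<close> replaces the variable of
  index \<open>k\<close> by the term \<open>s\<close> and closes the gap.\<close>

primrec lift_trm :: "nat \<Rightarrow> 'f trm \<Rightarrow> 'f trm" where
  "lift_trm k (Var n) = Var (if n < k then n else Suc n)"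
| "lift_trm k (Fn f ts) = Fn f (map (lift_trm k) ts)"

primrec lift :: "nat \<Rightarrow> ('f, 'r) fm \<Rightarrow> ('f, 'r) fm" where
  "lift k (Eq s t) = Eq (lift_trm k s) (lift_trm k t)"
| "lift k (Rel r ts) = Rel r (map (lift_trm k) ts)"
| "lift k (Neg p) = Neg (lift k p)"
| "lift k (And p q) = And (lift k p) (lift k q)"
| "lift k (Or p q) = Or (lift k p) (lift k q)"
| "lift k (All p) = All (lift (Suc k) p)"
| "lift k (Ex p) = Ex (lift (Suc k) p)"

primrec subst_trm :: "nat \<Rightarrow> 'f trm \<Rightarrow> 'f trm \<Rightarrow> 'f trm" where
  "subst_trm k s (Var n) = (if n < k then Var n else if n = k then s else Var (n - 1))"
| "subst_trm k s (Fn f ts) = Fn f (map (subst_trm k s) ts)"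

primrec subst :: "nat \<Rightarrow> 'f trm \<Rightarrow> ('f, 'r) fm \<Rightarrow> ('f, 'r) fm" where
  "subst k s (Eq t u) = Eq (subst_trm k s t) (subst_trm k s u)"
| "subst k s (Rel r ts) = Rel r (map (subst_trm k s) ts)"
| "subst k s (Neg p) = Neg (subst k s p)"
| "subst k s (And p q) = And (subst k s p) (subst k s q)"
| "subst k s (Or p q) = Or (subst k s p) (subst k s q)"
| "subst k s (All p) = All (subst (Suc k) (lift_trm 0 s) p)"
| "subst k s (Ex p) = Ex (subst (Suc k) (lift_trm 0 s) p)"

text \<open>Classical natural deduction. Only formulas of the language \<open>L\<close> occur in derivations; the
  set of assumptions may be infinite.\<close>

inductive derives :: "('f, 'r) lang \<Rightarrow> ('f, 'r) fm set \<Rightarrow> ('f, 'r) fm \<Rightarrow> bool" for L where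
  Assm: "p \<in> S \<Longrightarrow> wf_fm L p \<Longrightarrow> derives L S p"
| NegI: "wf_fm L p \<Longrightarrow> derives L (insert p S) q \<Longrightarrow> derives L (insert p S) (Neg q)
    \<Longrightarrow> derives L S (Neg p)"
| Classical: "wf_fm L p \<Longrightarrow> derives L (insert (Neg p) S) q \<Longrightarrow> derives L (insert (Neg p) S) (Neg q)
    \<Longrightarrow> derives L S p"
| AndI: "derives L S p \<Longrightarrow> derives L S q \<Longrightarrow> derives L S (And p q)"
| AndE1: "derives L S (And p q) \<Longrightarrow> derives L S p"
| AndE2: "derives L S (And p q) \<Longrightarrow> derives L S q"
| OrI1: "derives L S p \<Longrightarrow> wf_fm L q \<Longrightarrow> derives L S (Or p q)"
| OrI2: "wf_fm L p \<Longrightarrow> derives L S q \<Longrightarrow> derives L S (Or p q)"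
| OrE: "derives L S (Or p q) \<Longrightarrow> derives L (insert p S) r \<Longrightarrow> derives L (insert q S) r
    \<Longrightarrow> derives L S r"
| AllI: "derives L (lift 0 ` S) p \<Longrightarrow> derives L S (All p)"
| AllE: "derives L S (All p) \<Longrightarrow> wf_trm L t \<Longrightarrow> derives L S (subst 0 t p)"
| ExI: "wf_fm L p \<Longrightarrow> wf_trm L t \<Longrightarrow> derives L S (subst 0 t p) \<Longrightarrow> derives L S (Ex p)"
| ExE: "derives L S (Ex p) \<Longrightarrow> derives L (insert p (lift 0 ` S)) (lift 0 q) \<Longrightarrow> derives L S q"
| EqI: "wf_trm L t \<Longrightarrow> derives L S (Eq t t)"
| EqE: "wf_fm L p \<Longrightarrow> derives L S (Eq s t) \<Longrightarrow> derives L S (subst 0 s p)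
    \<Longrightarrow> derives L S (subst 0 t p)"

definition closure :: "('f, 'r) lang \<Rightarrow> ('f, 'r) fm set \<Rightarrow> ('f, 'r) fm set" where
  "closure L F = {p \<in> sentences L. derives L F p}"

definition consistent :: "('f, 'r) lang \<Rightarrow> ('f, 'r) fm set \<Rightarrow> bool" where
  "consistent L F \<longleftrightarrow> \<not> (\<exists>p\<in>sentences L. derives L F p \<and> derives L F (Neg p))"

text \<open>The last condition: the deductive closure of finite lists of sentences is enumerated by a
  computable total map, uniformly in the list.\<close>

definition language_encoding :: "('f, 'r) lang \<Rightarrow> (('f, 'r) fm \<Rightarrow> nat) \<Rightarrow> bool" where
  "language_encoding L e \<longleftrightarrow>
     is_encoding (sentences L) e \<and>
     (\<exists>C. computable_map (lists (sentences L) \<times> UNIV) (code_prod (code_list e) id)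
            (sentences L) e (\<lambda>x. Some (C x)) \<and>
          (\<forall>ps\<in>lists (sentences L). range (\<lambda>n. C (ps, n)) = closure L (set ps)))"


section \<open>Arithmetic\<close>

datatype arith_fun = FZero | FAdd | FMul | FSuc
datatype arith_rel = RLess

type_synonym arith_trm = "arith_fun trm"
type_synonym arith_fm = "(arith_fun, arith_rel) fm"

primrec arith_fun_arity :: "arith_fun \<Rightarrow> nat" where
  "arith_fun_arity FZero = 0"
| "arith_fun_arity FAdd = 2"
| "arith_fun_arity FMul = 2"
| "arith_fun_arity FSuc = 1"

definition Arith :: "(arith_fun, arith_rel) lang" where
  "Arith = \<lparr>fun_arity = (\<lambda>f. Some (arith_fun_arity f)), rel_arity = (\<lambda>r. Some 2)\<rparr>"

abbreviation Zero :: arith_trm where "Zero \<equiv> Fn FZero []"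
abbreviation Succ :: "arith_trm \<Rightarrow> arith_trm" where "Succ t \<equiv> Fn FSuc [t]"
abbreviation Add :: "arith_trm \<Rightarrow> arith_trm \<Rightarrow> arith_trm" where "Add s t \<equiv> Fn FAdd [s, t]"
abbreviation Mul :: "arith_trm \<Rightarrow> arith_trm \<Rightarrow> arith_trm" where "Mul s t \<equiv> Fn FMul [s, t]"
abbreviation Less :: "arith_trm \<Rightarrow> arith_trm \<Rightarrow> arith_fm" where "Less s t \<equiv> Rel RLess [s, t]"

primrec numeral_trm :: "nat \<Rightarrow> arith_trm" where
  "numeral_trm 0 = Zero"
| "numeral_trm (Suc n) = Succ (numeral_trm n)"

text \<open>The last axiom says \<open>x < y \<longleftrightarrow> (\<exists>z. s(z) + x = y)\<close>.\<close>

definition Q :: "arith_fm set" where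
  "Q = {All (Neg (Eq (Succ (Var 0)) Zero)),
        All (All (Imp (Eq (Succ (Var 1)) (Succ (Var 0))) (Eq (Var 1) (Var 0)))),
        All (Imp (Neg (Eq (Var 0) Zero)) (Ex (Eq (Var 1) (Succ (Var 0))))),
        All (Eq (Add (Var 0) Zero) (Var 0)),
        All (All (Eq (Add (Var 1) (Succ (Var 0))) (Succ (Add (Var 1) (Var 0))))),
        All (Eq (Mul (Var 0) Zero) Zero),
        All (All (Eq (Mul (Var 1) (Succ (Var 0))) (Add (Mul (Var 1) (Var 0)) (Var 1)))),
        All (All (Iff (Less (Var 1) (Var 0)) (Ex (Eq (Add (Succ (Var 0)) (Var 2)) (Var 1)))))}"

text \<open>A standard Goedel numbering of formulas of arithmetic.\<close>

primrec code_arith_fun :: "arith_fun \<Rightarrow> nat" where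
  "code_arith_fun FZero = 0"
| "code_arith_fun FAdd = 1"
| "code_arith_fun FMul = 2"
| "code_arith_fun FSuc = 3"

primrec code_arith_rel :: "arith_rel \<Rightarrow> nat" where
  "code_arith_rel RLess = 0"

primrec code_trm :: "arith_trm \<Rightarrow> nat" where
  "code_trm (Var n) = prod_encode (0, n)"
| "code_trm (Fn f ts) = prod_encode (Suc (code_arith_fun f), list_encode (map code_trm ts))"

primrec code_fm :: "arith_fm \<Rightarrow> nat" where
  "code_fm (Eq s t) = prod_encode (0, prod_encode (code_trm s, code_trm t))"
| "code_fm (Rel r ts) =
     prod_encode (1, prod_encode (code_arith_rel r, list_encode (map code_trm ts)))"
| "code_fm (Neg p) = prod_encode (2, code_fm p)"
| "code_fm (And p q) = prod_encode (3, prod_encode (code_fm p, code_fm q))"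
| "code_fm (Or p q) = prod_encode (4, prod_encode (code_fm p, code_fm q))"
| "code_fm (All p) = prod_encode (5, code_fm p)"
| "code_fm (Ex p) = prod_encode (6, code_fm p)"

lemma code_trm_eq: "code_trm s = code_trm t \<Longrightarrow> s = t"
proof (induction s arbitrary: t)
  case (Var n)
  then show ?case by (cases t) auto
next
  case (Fn f ss)
  then obtain g ts where t: "t = Fn g ts" by (cases t) auto
  have "f = g" using Fn.prems t by (cases f; cases g) auto
  moreover have "map code_trm ss = map code_trm ts" using Fn.prems t by (simp add: list_encode_eq)
  then have "ss = ts" using Fn.IH by (metis list.inj_map_strong)
  ultimately show ?case using t by simp
qed

lemma inj_code_fm: "inj code_fm"
proof -
  have "code_fm p = code_fm q \<Longrightarrow> p = q" for p q
  proof (induction p arbitrary: q)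
    case (Rel r ss)
    then obtain r' ts where q: "q = Rel r' ts" by (cases q) auto
    have "r = r'" by (cases r; cases r') simp
    moreover have "map code_trm ss = map code_trm ts" using Rel q by (simp add: list_encode_eq)
    then have "ss = ts" using code_trm_eq by (metis list.inj_map_strong)
    ultimately show ?case using q by simp
  next
    case (Eq s t)
    then show ?case by (cases q) (auto dest: code_trm_eq)
  next
    case (Neg p)
    then show ?case by (cases q) auto
  next
    case (And p1 p2)
    then show ?case by (cases q) auto
  next
    case (Or p1 p2)
    then show ?case by (cases q) auto
  next
    case (All p)
    then show ?case by (cases q) auto
  next
    case (Ex p)
    then show ?case by (cases q) auto
  qed
  then show ?thesis by (auto intro: injI)
qed

text \<open>Bounded formulas. In the bounded quantifiers \<open>\<forall>x < t\<close> and \<open>\<exists>x < t\<close> the variable \<open>x\<close> does not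
  occur in \<open>t\<close>, hence the lifting of \<open>t\<close>.\<close>

inductive bounded_fm :: "arith_fm \<Rightarrow> bool" where
  "wf_trm Arith s \<Longrightarrow> wf_trm Arith t \<Longrightarrow> bounded_fm (Eq s t)"
| "wf_trm Arith s \<Longrightarrow> wf_trm Arith t \<Longrightarrow> bounded_fm (Less s t)"
| "bounded_fm p \<Longrightarrow> bounded_fm (Neg p)"
| "bounded_fm p \<Longrightarrow> bounded_fm q \<Longrightarrow> bounded_fm (And p q)"
| "bounded_fm p \<Longrightarrow> bounded_fm q \<Longrightarrow> bounded_fm (Or p q)"
| "wf_trm Arith t \<Longrightarrow> bounded_fm p \<Longrightarrow> bounded_fm (All (Imp (Less (Var 0) (lift_trm 0 t)) p))"
| "wf_trm Arith t \<Longrightarrow> bounded_fm p \<Longrightarrow> bounded_fm (Ex (And (Less (Var 0) (lift_trm 0 t)) p))"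

text \<open>Each \<open>\<Sigma>\<^sub>n\<^sub>+\<^sub>1\<close> formula is a possibly empty block of existential quantifiers followed by a
  \<open>\<Pi>\<^sub>n\<close> formula, and dually, so both \<open>\<Sigma>\<^sub>n\<close> and \<open>\<Pi>\<^sub>n\<close> are contained in \<open>\<Sigma>\<^sub>n\<^sub>+\<^sub>1\<close>.\<close>

inductive sigma_fm :: "nat \<Rightarrow> arith_fm \<Rightarrow> bool"
  and pi_fm :: "nat \<Rightarrow> arith_fm \<Rightarrow> bool" where
  "bounded_fm p \<Longrightarrow> sigma_fm 0 p"
| "bounded_fm p \<Longrightarrow> pi_fm 0 p"
| "pi_fm n p \<Longrightarrow> sigma_fm (Suc n) p"
| "sigma_fm (Suc n) p \<Longrightarrow> sigma_fm (Suc n) (Ex p)"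
| "sigma_fm n p \<Longrightarrow> pi_fm (Suc n) p"
| "pi_fm (Suc n) p \<Longrightarrow> pi_fm (Suc n) (All p)"

text \<open>The set of \<open>\<Sigma>\<^sub>0\<close> formulas with exactly one free variable. For \<open>\<phi>\<close> in this set, \<open>\<forall>m. \<phi>(m)\<close> is
  \<open>All \<phi>\<close>, \<open>\<exists>m. \<phi>(m)\<close> is \<open>Ex \<phi>\<close>, and \<open>inst \<phi> m\<close> is \<open>\<phi>(m)\<close> for a number \<open>m\<close>.\<close>

definition F0 :: "arith_fm set" where
  "F0 = {\<phi>. sigma_fm 0 \<phi> \<and> fv \<phi> = {0}}"

definition inst :: "arith_fm \<Rightarrow> nat \<Rightarrow> arith_fm" where
  "inst \<phi> m = subst 0 (numeral_trm m) \<phi>"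


section \<open>Translations\<close>

definition translation ::
    "('f, 'r) lang \<Rightarrow> ('g, 's) lang \<Rightarrow> (('f, 'r) fm \<Rightarrow> ('g, 's) fm) \<Rightarrow> bool" where
  "translation L' L i \<longleftrightarrow>
     i ` sentences L' \<subseteq> sentences L \<and>
     inj_on i (sentences L') \<and>
     (\<forall>p\<in>sentences L'. \<forall>q\<in>sentences L'. i (And p q) = And (i p) (i q)) \<and>
     (\<forall>p\<in>sentences L'. \<forall>q\<in>sentences L'. i (Or p q) = Or (i p) (i q)) \<and>
     (\<forall>p\<in>sentences L'. i (Neg p) = Neg (i p)) \<and>
     (\<forall>S p. S \<subseteq> sentences L' \<and> p \<in> sentences L' \<and> derives L' S p \<longrightarrow> derives L (i ` S) (i p))"

definition n_translation ::
    "nat \<Rightarrow> ('f, 'r) lang \<Rightarrow> (('f, 'r) fm \<Rightarrow> nat) \<Rightarrow> (arith_fm \<Rightarrow> ('f, 'r) fm) \<Rightarrow> bool" where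
  "n_translation n L e i \<longleftrightarrow>
     translation Arith L i \<and>
     computable_map {p \<in> sentences Arith. sigma_fm n p} code_fm (sentences L) e (\<lambda>p. Some (i p))"

definition arith_part ::
    "('f, 'r) lang \<Rightarrow> (arith_fm \<Rightarrow> ('f, 'r) fm) \<Rightarrow> ('f, 'r) fm set \<Rightarrow> arith_fm set" where
  "arith_part L i F = {p \<in> sentences Arith. i p \<in> closure L F}"

definition derives_via ::
    "('f, 'r) lang \<Rightarrow> (arith_fm \<Rightarrow> ('f, 'r) fm) \<Rightarrow> ('f, 'r) fm set \<Rightarrow> arith_fm \<Rightarrow> bool" where
  "derives_via L i F p \<longleftrightarrow> derives Arith (arith_part L i F) p"

definition one_consistent ::
    "('f, 'r) lang \<Rightarrow> (arith_fm \<Rightarrow> ('f, 'r) fm) \<Rightarrow> ('f, 'r) fm set \<Rightarrow> bool" where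
  "one_consistent L i F \<longleftrightarrow>
     (\<forall>p\<in>Q. derives_via L i F p) \<and>
     (\<forall>\<phi>\<in>F0. derives_via L i F (Ex \<phi>) \<longrightarrow> (\<exists>m. \<not> derives_via L i F (Neg (inst \<phi> m))))"


section \<open>Machines that output signed sentences\<close>

type_synonym ('f, 'r) signed_map = "nat \<Rightarrow> (('f, 'r) fm \<times> sign) option"

definition stabilization :: "('f, 'r) signed_map \<Rightarrow> ('f, 'r) fm set" where
  "stabilization M =
     {p. \<exists>m. M m = Some (p, Plus) \<and> \<not> (\<exists>n>m. M n = Some (p, Minus))}"

definition speculative ::
    "('f, 'r) lang \<Rightarrow> (arith_fm \<Rightarrow> ('f, 'r) fm) \<Rightarrow> ('f, 'r) signed_map \<Rightarrow> bool" where
  "speculative L i M \<longleftrightarrow>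
     (\<forall>\<phi>\<in>F0. (\<forall>m. derives Arith Q (inst \<phi> m)) \<longrightarrow>
        derives_via L i (stabilization M) (All \<phi>))"

text \<open>\<open>decodes L e T M\<close> says that \<open>M\<close> is the map \<open>T'\<close> from numbers to signed sentences of \<open>L\<close>.\<close>

definition decodes ::
    "('f, 'r) lang \<Rightarrow> (('f, 'r) fm \<Rightarrow> nat) \<Rightarrow> turing \<Rightarrow> ('f, 'r) signed_map \<Rightarrow> bool" where
  "decodes L e T M \<longleftrightarrow>
     (\<forall>n p s. M n = Some (p, s) \<longrightarrow> p \<in> sentences L) \<and>
     (\<forall>n. map_option (code_prod e code_sign) (M n) = tm_fun T n)"

definition machines :: "('f, 'r) lang \<Rightarrow> (('f, 'r) fm \<Rightarrow> nat) \<Rightarrow> turing set" where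
  "machines L e = {T. \<exists>M. decodes L e T M}"

definition decoded ::
    "('f, 'r) lang \<Rightarrow> (('f, 'r) fm \<Rightarrow> nat) \<Rightarrow> turing \<Rightarrow> ('f, 'r) signed_map" where
  "decoded L e T = (THE M. decodes L e T M)"

definition stab ::
    "('f, 'r) lang \<Rightarrow> (('f, 'r) fm \<Rightarrow> nat) \<Rightarrow> turing \<Rightarrow> ('f, 'r) fm set" where
  "stab L e T = stabilization (decoded L e T)"

lemma pow23_eq:
  fixes a b c d :: nat
  assumes "2 ^ a * 3 ^ b = (2 ^ c * 3 ^ d :: nat)"
  shows "a = c \<and> b = d"
  using assms
proof (induction a arbitrary: c)
  case 0
  have "odd (3 ^ b :: nat)" by simp
  moreover have "even (2 ^ c * 3 ^ d :: nat)" if "c \<noteq> 0" using that by simp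
  ultimately have "c = 0" using 0 by (metis mult_1 power_0)
  then show ?case using 0 by simp
next
  case (Suc a)
  have "even (2 ^ c * 3 ^ d :: nat)" using Suc.prems[symmetric] by simp
  then obtain c' where "c = Suc c'" by (cases c) auto
  then show ?case using Suc by simp
qed

lemma decodes_unique:
  assumes "inj_on e (sentences L)" and M: "decodes L e T M" and N: "decodes L e T N"
  shows "M = N"
proof
  fix n
  have eq: "map_option (code_prod e code_sign) (M n) = map_option (code_prod e code_sign) (N n)"
    using M N by (simp add: decodes_def)
  show "M n = N n"
  proof (cases "M n")
    case None
    then show ?thesis using eq by simp
  next
    case (Some x)
    then obtain y where y: "N n = Some y" using eq by (cases "N n") auto
    obtain p s where x: "x = (p, s)" by (cases x)
    obtain q t where y': "y = (q, t)" by (cases y)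
    have pq: "p \<in> sentences L" "q \<in> sentences L"
      using M N Some y x y' unfolding decodes_def by metis+
    have "e p = e q \<and> code_sign s = code_sign t"
      using eq Some y x y' by (auto simp: code_prod_def dest: pow23_eq)
    then have "p = q" and "code_sign s = code_sign t"
      using inj_onD[OF assms(1) _ pq] by auto
    then have "s = t" by (cases s; cases t) simp_all
    with \<open>p = q\<close> show ?thesis using Some y x y' by simp
  qed
qed

lemma decoded_eq: "inj_on e (sentences L) \<Longrightarrow> decodes L e T M \<Longrightarrow> decoded L e T = M"
  unfolding decoded_def by (blast intro: the_equality decodes_unique)

end

theory Submission
  imports Defs
begin

text \<open>
  The machine \<open>Spec T\<close> works in stages. Stage \<open>s = \<langle>j, w\<rangle>\<close> lets \<open>w\<close> try to certify that \<open>j\<close> codes a bounded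
  formula \<open>\<phi>\<close> in one variable, or that some \<open>\<phi>(m)\<close> is false. As long as \<open>\<phi>\<close> is certified and not
  refuted, \<open>i(\<forall>m. \<phi>(m))\<close> is asserted, and retractions of this sentence by \<open>T\<close> are turned into
  assertions. At the first refutation the sentence is retracted once, and everything \<open>T\<close> has said so
  far about it is repeated, so that a sentence that is stable for \<open>T\<close> stays stable. All other output
  of \<open>T\<close> is copied. Hence the stable sentences are those of \<open>T\<close> and the translations of the true
  sentences \<open>\<forall>m. \<phi>(m)\<close>. If adding these made \<open>T\<^sup>s\<close> inconsistent, then finitely many of them, hence a
  single one, would be refuted by \<open>T\<^sup>s\<close>, which would give \<open>\<exists>m. \<not>\<phi>(m)\<close> although \<open>Q\<close> proves every \<open>\<phi>(m)\<close>.

  Soundness of \<open>Q\<close> is not used: \<open>Q\<close> decides bounded sentences, and if \<open>Q\<close> proved a false one, it would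
  be inconsistent, which makes every claim about speculation trivial for \<open>T\<^sup>s \<turnstile> Q\<close>.
\<close>

section \<open>Register programs on Turing machines\<close>

text \<open>\<open>Spec\<close> has to be computable as a map on codes, so it cannot depend on
  \<open>T\<close> in an arbitrary way: one fixed program serves all \<open>T\<close> and reads the
  code of \<open>T\<close> from marks written by a start-up table, and only that table grows with
  the code. The program itself is never written out. Its output relation is shown to be computably
  enumerable and single-valued, and a search for a value together with a witness computes it; a
  value is missing only where \<open>T\<close> fails to give the output to be copied.

  The simulation of \<open>T\<close> and of the machine for \<open>i\<close> is only enumerable, so
  every negative condition must be decidable or be restated positively. This is why stages test
  explicit witnesses, and why the decidable image of the encoding matters: invalid outputs of
  \<open>T\<close> must be recognised. The pairing supplies the time axis: its antidiagonals are the
  stages, each finite but growing, which leaves room to repeat all earlier outputs of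
  \<open>T\<close>. The map \<open>i\<close> is opaque on quantifiers, so the consistency argument
  moves every quantifier step into arithmetic and translates only its outcome.\<close>

datatype com = Inc nat | Dec nat | Seq com com | Loop nat com

inductive exec :: "com \<Rightarrow> (nat \<Rightarrow> nat) \<Rightarrow> (nat \<Rightarrow> nat) \<Rightarrow> bool" where
  exec_Inc: "exec (Inc r) v (v(r := Suc (v r)))"
| exec_Dec: "exec (Dec r) v (v(r := v r - 1))"
| exec_Seq: "exec c v v' \<Longrightarrow> exec d v' v'' \<Longrightarrow> exec (Seq c d) v v''"
| exec_LoopF: "v r = 0 \<Longrightarrow> exec (Loop r c) v v"
| exec_LoopT: "v r \<noteq> 0 \<Longrightarrow> exec c v v' \<Longrightarrow> exec (Loop r c) v' v'' \<Longrightarrow> exec (Loop r c) v v''"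

primrec regs :: "com \<Rightarrow> nat set" where
  "regs (Inc r) = {r}"
| "regs (Dec r) = {r}"
| "regs (Seq c d) = regs c \<union> regs d"
| "regs (Loop r c) = insert r (regs c)"

lemma finite_regs: "finite (regs c)"
  by (induction c) auto

text \<open>The number of states that \<open>tab\<close> spends on a command, so that the tables of
  subcommands can be laid out one after the other.\<close>

primrec width :: "com \<Rightarrow> nat" where
  "width (Inc r) = 2"
| "width (Dec r) = 3"
| "width (Seq c d) = width c + width d"
| "width (Loop r c) = 3 + width c"

definition row :: "nat \<Rightarrow> nat \<Rightarrow> (nat \<Rightarrow> nat \<times> dir \<times> nat) \<Rightarrow> turing" where
  "row K q f = map (\<lambda>a. ((q, a), f a)) [0..<Suc (2 ^ K)]"

definition ret :: "nat \<Rightarrow> nat \<Rightarrow> nat \<Rightarrow> nat \<Rightarrow> nat \<times> dir \<times> nat" where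
  "ret K q x a = (if a = 2 ^ K then (a, Rgt, x) else (a, Lft, q))"

text \<open>The table is entered in state \<open>q\<close> and left in state \<open>x\<close>, both
  times with the head on cell 0; this makes tables composable. A machine moves in every step, so
  even a test in cell 0 has to step onto the marker and come back, which accounts for the return
  states of \<open>Loop\<close>.\<close>

primrec tab :: "nat \<Rightarrow> com \<Rightarrow> nat \<Rightarrow> nat \<Rightarrow> turing" where
  "tab K (Inc r) q x =
     row K q (\<lambda>a. if r \<in> set_decode a then (a, Rgt, q)
                  else (set_encode (insert r (set_decode a)), Lft, q + 1)) @
     row K (q + 1) (ret K (q + 1) x)"
| "tab K (Dec r) q x =
     row K q (\<lambda>a. if r \<in> set_decode a then (a, Rgt, q) else (a, Lft, q + 1)) @
     row K (q + 1) (\<lambda>a. if a = 2 ^ K then (a, Rgt, x)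
                        else (set_encode (set_decode a - {r}), Lft, q + 2)) @
     row K (q + 2) (ret K (q + 2) x)"
| "tab K (Seq c d) q x = tab K c q (q + width c) @ tab K d (q + width c) x"
| "tab K (Loop r c) q x =
     row K q (\<lambda>a. if r \<in> set_decode a then (a, Lft, q + 2) else (a, Lft, q + 1)) @
     row K (q + 1) (ret K (q + 1) x) @
     row K (q + 2) (ret K (q + 2) (q + 3)) @
     tab K c (q + 3) q"

text \<open>Phrased through lookup because only the first matching entry of a table counts;
  inclusion of the entries alone would not determine the behaviour.\<close>

definition contains :: "turing \<Rightarrow> turing \<Rightarrow> bool" where
  "contains T S \<longleftrightarrow> (\<forall>(k, y) \<in> set S. map_of T k = Some y)"

lemma contains_append [simp]: "contains T (R @ S) \<longleftrightarrow> contains T R \<and> contains T S"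
  by (auto simp: contains_def)

lemma contains_Cons [simp]:
  "contains T (x # S) \<longleftrightarrow> map_of T (fst x) = Some (snd x) \<and> contains T S"
  by (cases x) (simp add: contains_def)

lemma contains_row: "contains T (row K q f) \<Longrightarrow> a \<le> 2 ^ K \<Longrightarrow> map_of T (q, a) = Some (f a)"
  by (auto simp: contains_def row_def)

lemma row_lookup:
  "contains T (row K q f) \<Longrightarrow> f a = y \<Longrightarrow> a \<le> 2 ^ K \<Longrightarrow> map_of T (q, a) = Some y"
  using contains_row by blast

lemma contains_self: "distinct (map fst S) \<Longrightarrow> contains S S"
  by (auto simp: contains_def)

text \<open>All registers share one unary track tape: bit \<open>r\<close> of the symbol in cell \<open>j \<ge> 0\<close> says \<open>j < v r\<close>,
  and \<open>2 ^ K\<close> marks the cell \<open>-1\<close> to which the head returns. With one register this is the format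
  of inputs and outputs.\<close>

definition tape :: "nat \<Rightarrow> (nat \<Rightarrow> nat) \<Rightarrow> int \<Rightarrow> nat" where
  "tape K v j = (if j = -1 then 2 ^ K else if j < 0 then 0
                 else set_encode {r. r < K \<and> j < int (v r)})"

lemma set_encode_less: "A \<subseteq> {..<K} \<Longrightarrow> set_encode A < 2 ^ K"
proof -
  assume A: "A \<subseteq> {..<K}"
  have "set_encode A = sum ((^) 2) A" by (simp add: set_encode_def)
  also have "\<dots> \<le> sum ((^) 2) {..<K}" by (rule sum_mono2) (use A in auto)
  also have "\<dots> < (2::nat) ^ K" by (induction K) auto
  finally show ?thesis .
qed

lemma tape_less: "0 \<le> j \<Longrightarrow> tape K v j < 2 ^ K"
  by (auto simp: tape_def intro!: set_encode_less)

lemma tape_le: "-1 \<le> j \<Longrightarrow> tape K v j \<le> 2 ^ K"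
  using tape_less[of j K v] by (cases "j = -1") (auto simp: tape_def)

lemma set_decode_tape: "0 \<le> j \<Longrightarrow> set_decode (tape K v j) = {r. r < K \<and> j < int (v r)}"
  by (simp add: tape_def)

lemma tape_marker [simp]: "tape K v (-1) = 2 ^ K"
  by (simp add: tape_def)

section \<open>Runs of the compiled tables on the track tape\<close>

definition reach :: "turing \<Rightarrow> config \<Rightarrow> config \<Rightarrow> bool" where
  "reach T c d \<longleftrightarrow> (\<exists>n. (step T ^^ n) c = d)"

text \<open>At least one step is made. An endless loop then passes through configurations at
  arbitrarily late times, which the divergence proof needs.\<close>

definition reach1 :: "turing \<Rightarrow> config \<Rightarrow> config \<Rightarrow> bool" where
  "reach1 T c d \<longleftrightarrow> (\<exists>n. (step T ^^ Suc n) c = d)"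

lemma reach_refl [simp]: "reach T c c"
  unfolding reach_def by (rule exI[of _ 0]) simp

lemma reach_trans: "reach T c d \<Longrightarrow> reach T d f \<Longrightarrow> reach T c f"
  unfolding reach_def by (metis comp_apply funpow_add)

lemma reach1_step: "reach T (step T c) d \<Longrightarrow> reach1 T c d"
  unfolding reach_def reach1_def by (metis comp_apply funpow_Suc_right)

lemma reach1_reach: "reach1 T c d \<Longrightarrow> reach T c d"
  unfolding reach_def reach1_def by blast

lemma reach1_trans: "reach1 T c d \<Longrightarrow> reach T d f \<Longrightarrow> reach1 T c f"
  unfolding reach_def reach1_def by (metis add_Suc_right comp_apply funpow_add)

lemma step_Some:
  "map_of T (q, t h) = Some (b, d, q') \<Longrightarrow> step T (q, t, h) = (q', t(h := b), h + offset d)"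
  by (simp add: step_def)

lemma reach1_move:
  "map_of T (q, t h) = Some (b, d, q') \<Longrightarrow> reach T (q', t(h := b), h + offset d) c
    \<Longrightarrow> reach1 T (q, t, h) c"
  by (rule reach1_step) (simp add: step_Some)

lemma reach_move:
  "map_of T (q, t h) = Some (b, d, q') \<Longrightarrow> reach T (q', t(h := b), h + offset d) c
    \<Longrightarrow> reach T (q, t, h) c"
  using reach1_move reach1_reach by blast

text \<open>Induction on the distance \<open>h + 1\<close> to the marker: all cells from 0 on hold
  symbols below \<open>2 ^ K\<close>, so the sweep to the left stops at the marker and nowhere
  else.\<close>

lemma reach_ret:
  assumes T: "contains T (row K q (ret K q x))" and h: "-1 \<le> h"
  shows "reach T (q, tape K v, h) (x, tape K v, 0)"
  using h
proof (induction "nat (h + 1)" arbitrary: h)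
  case 0
  then have h: "h = -1" by simp
  show ?case
    by (rule reach_move[where b = "2 ^ K" and d = Rgt and q' = x])
      (use h contains_row[OF T] in \<open>auto simp: ret_def fun_upd_idem\<close>)
next
  case (Suc n)
  then have h: "0 \<le> h" by simp
  have "map_of T (q, tape K v h) = Some (tape K v h, Lft, q)"
    using contains_row[OF T tape_le, of h v] tape_less[OF h, of K v] h by (simp add: ret_def)
  moreover have "reach T (q, tape K v, h - 1) (x, tape K v, 0)"
    using Suc by auto
  ultimately show ?case
    by - (rule reach_move, assumption, simp)
qed

lemma reach_right:
  assumes T: "contains T (row K q f)" and f: "\<And>a. r \<in> set_decode a \<Longrightarrow> f a = (a, Rgt, q)"
    and r: "r < K" and n: "n \<le> v r"
  shows "reach T (q, tape K v, 0) (q, tape K v, int n)"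
  using n
proof (induction n)
  case (Suc n)
  have "r \<in> set_decode (tape K v (int n))" using Suc.prems r by (simp add: set_decode_tape)
  then have "map_of T (q, tape K v (int n)) = Some (tape K v (int n), Rgt, q)"
    using contains_row[OF T tape_le, of "int n" v] f by simp
  then have "reach T (q, tape K v, int n) (q, tape K v, int (Suc n))"
    by (rule reach_move) (simp add: add.commute)
  then show ?case using Suc reach_trans by auto
qed simp

lemma tape_eqI:
  "(\<And>r. r < K \<Longrightarrow> j < int (v r) \<longleftrightarrow> j < int (w r)) \<Longrightarrow> tape K v j = tape K w j"
  by (simp add: tape_def cong: conj_cong)

text \<open>Cell \<open>v r\<close> is the first one without bit \<open>r\<close>, so setting the
  bit there lengthens the unary block of \<open>r\<close> by one and leaves the other tracks
  alone.\<close>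

lemma tape_upd_Suc:
  assumes r: "r < K"
  shows "(tape K v)(int (v r) := set_encode (insert r (set_decode (tape K v (int (v r))))))
    = tape K (v(r := Suc (v r)))"
proof
  fix j
  have "insert r {s. s < K \<and> v r < v s} = {s. s < K \<and> int (v r) < int ((v(r := Suc (v r))) s)}"
    using r by auto
  then have "set_encode (insert r (set_decode (tape K v (int (v r)))))
      = tape K (v(r := Suc (v r))) (int (v r))"
    unfolding tape_def by simp
  moreover have "tape K v j = tape K (v(r := Suc (v r))) j" if "j \<noteq> int (v r)"
    by (rule tape_eqI) (use that in auto)
  ultimately show "((tape K v)(int (v r) := set_encode (insert r (set_decode (tape K v (int (v r))))))) j
    = tape K (v(r := Suc (v r))) j"
    by simp
qed

lemma tape_upd_pred:
  assumes r: "r < K" "v r \<noteq> 0"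
  shows "(tape K v)(int (v r) - 1 := set_encode (set_decode (tape K v (int (v r) - 1)) - {r}))
    = tape K (v(r := v r - 1))"
proof
  fix j
  have "{s. s < K \<and> int (v r) - 1 < int (v s)} - {r}
      = {s. s < K \<and> int (v r) - 1 < int ((v(r := v r - 1)) s)}"
    using r by auto
  then have "set_encode (set_decode (tape K v (int (v r) - 1)) - {r})
      = tape K (v(r := v r - 1)) (int (v r) - 1)"
    using r set_decode_tape[of "int (v r) - 1" K v] unfolding tape_def by simp
  moreover have "tape K v j = tape K (v(r := v r - 1)) j" if "j \<noteq> int (v r) - 1"
    by (rule tape_eqI) (use that in auto)
  ultimately show "((tape K v)(int (v r) - 1 := set_encode (set_decode (tape K v (int (v r) - 1)) - {r}))) j
    = tape K (v(r := v r - 1)) j"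
    by simp
qed

lemma reach_Inc:
  assumes T: "contains T (tab K (Inc r) q x)" and r: "r < K"
  shows "reach T (q, tape K v, 0) (x, tape K (v(r := Suc (v r))), 0)"
proof -
  have 1: "reach T (q, tape K v, 0) (q, tape K v, int (v r))"
    by (rule reach_right[OF T[unfolded tab.simps contains_append, THEN conjunct1] _ r]) simp_all
  have nr: "r \<notin> set_decode (tape K v (int (v r)))" by (simp add: set_decode_tape)
  have "map_of T (q, tape K v (int (v r))) =
      Some (set_encode (insert r (set_decode (tape K v (int (v r))))), Lft, q + 1)"
    using T nr tape_le[of "int (v r)" K v] by (auto elim!: row_lookup)
  moreover have "reach T (q + 1, tape K (v(r := Suc (v r))), int (v r) - 1)
      (x, tape K (v(r := Suc (v r))), 0)"
    by (rule reach_ret) (use T in auto)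
  ultimately have "reach T (q, tape K v, int (v r)) (x, tape K (v(r := Suc (v r))), 0)"
    by - (rule reach_move, assumption, simp add: tape_upd_Suc[OF r])
  with 1 show ?thesis by (rule reach_trans)
qed

lemma reach_Dec:
  assumes T: "contains T (tab K (Dec r) q x)" and r: "r < K"
  shows "reach T (q, tape K v, 0) (x, tape K (v(r := v r - 1)), 0)"
proof -
  have 1: "reach T (q, tape K v, 0) (q, tape K v, int (v r))"
    by (rule reach_right[OF T[unfolded tab.simps contains_append, THEN conjunct1] _ r]) simp_all
  have nr: "r \<notin> set_decode (tape K v (int (v r)))" by (simp add: set_decode_tape)
  have "map_of T (q, tape K v (int (v r))) = Some (tape K v (int (v r)), Lft, q + 1)"
    using T nr tape_le[of "int (v r)" K v] by (auto elim!: row_lookup)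
  then have 2: "reach T (q, tape K v, int (v r)) (q + 1, tape K v, int (v r) - 1)"
    by (rule reach_move) simp
  have "reach T (q + 1, tape K v, int (v r) - 1) (x, tape K (v(r := v r - 1)), 0)"
  \<comment> \<open>With an empty track the step to the left has already reached the marker, and the
    table exits at once; this realises the truncation \<open>0 - 1 = 0\<close>.\<close>
  proof (cases "v r = 0")
    case True
    have "map_of T (q + 1, tape K v (-1)) = Some (2 ^ K, Rgt, x)"
      using T by (auto elim!: row_lookup)
    with True have "map_of T (q + 1, tape K v (int (v r) - 1)) = Some (2 ^ K, Rgt, x)" by simp
    then show ?thesis by (rule reach_move) (simp add: True fun_upd_idem)
  next
    case False
    let ?j = "int (v r) - 1"
    have "map_of T (q + 1, tape K v ?j) = Some (set_encode (set_decode (tape K v ?j) - {r}), Lft, q + 2)"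
      using T tape_less[of ?j K v] False by (auto elim!: row_lookup)
    moreover have "reach T (q + 2, tape K (v(r := v r - 1)), ?j - 1) (x, tape K (v(r := v r - 1)), 0)"
      by (rule reach_ret) (use T False in auto)
    ultimately show ?thesis
      by - (rule reach_move, assumption, simp add: tape_upd_pred[where v = v, OF r False])
  qed
  with 1 2 show ?thesis by (meson reach_trans)
qed

lemma reach_Loop_exit:
  assumes T: "contains T (tab K (Loop r c) q x)" and r: "r < K" and v: "v r = 0"
  shows "reach T (q, tape K v, 0) (x, tape K v, 0)"
proof -
  have "r \<notin> set_decode (tape K v 0)" using v by (simp add: set_decode_tape)
  then have "map_of T (q, tape K v 0) = Some (tape K v 0, Lft, q + 1)"
    using T tape_le[of 0 K v] by (auto elim!: row_lookup)
  moreover have "reach T (q + 1, tape K v, - 1) (x, tape K v, 0)"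
    by (rule reach_ret) (use T in auto)
  ultimately show ?thesis by - (rule reach_move, assumption, simp)
qed

lemma reach1_Loop_enter:
  assumes T: "contains T (tab K (Loop r c) q x)" and r: "r < K" and v: "v r \<noteq> 0"
  shows "reach1 T (q, tape K v, 0) (q + 3, tape K v, 0)"
proof -
  have "r \<in> set_decode (tape K v 0)" using v r by (simp add: set_decode_tape)
  then have "map_of T (q, tape K v 0) = Some (tape K v 0, Lft, q + 2)"
    using T tape_le[of 0 K v] by (auto elim!: row_lookup)
  moreover have "reach T (q + 2, tape K v, - 1) (q + 3, tape K v, 0)"
    by (rule reach_ret) (use T in auto)
  ultimately show ?thesis by - (rule reach1_move, assumption, simp)
qed

lemma reach_exec:
  assumes "exec c v v'" "contains T (tab K c q x)" "regs c \<subseteq> {..<K}"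
  shows "reach T (q, tape K v, 0) (x, tape K v', 0)"
  using assms
proof (induction arbitrary: q x rule: exec.induct)
  case (exec_Inc r v)
  then show ?case using reach_Inc[of T K r q x v] by (simp add: fun_upd_def)
next
  case (exec_Dec r v)
  then show ?case using reach_Dec[of T K r q x v] by (simp add: fun_upd_def)
next
  case (exec_Seq c v v' d v'')
  then have "reach T (q, tape K v, 0) (q + width c, tape K v', 0)"
    and "reach T (q + width c, tape K v', 0) (x, tape K v'', 0)" by simp_all
  then show ?case by (rule reach_trans)
next
  case (exec_LoopF v r c)
  then show ?case using reach_Loop_exit[of T K r c q x v] by simp
next
  case (exec_LoopT v r c v' v'')
  have "reach T (q, tape K v, 0) (q + 3, tape K v, 0)"
    by (rule reach1_reach, rule reach1_Loop_enter) (use exec_LoopT in auto)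
  moreover have "reach T (q + 3, tape K v, 0) (q, tape K v', 0)"
    using exec_LoopT by auto
  moreover have "reach T (q, tape K v', 0) (x, tape K v'', 0)"
    using exec_LoopT by auto
  ultimately show ?case by (meson reach_trans)
qed

section \<open>Disjoint state ranges and the start-up of a compiled machine\<close>

definition block :: "nat \<Rightarrow> nat \<Rightarrow> turing \<Rightarrow> bool" where
  "block a b S \<longleftrightarrow> a \<le> b \<and> distinct (map fst S) \<and> (\<forall>y\<in>set S. a \<le> fst (fst y) \<and> fst (fst y) < b)"

lemma block_append:
  assumes "block a m S" "block m b R"
  shows "block a b (S @ R)"
proof -
  have "fst x \<noteq> fst y" if "x \<in> set S" "y \<in> set R" for x y
    using assms that unfolding block_def by (metis leD)
  then have "fst ` set S \<inter> fst ` set R = {}" by blast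
  moreover have "\<forall>y\<in>set (S @ R). a \<le> fst (fst y) \<and> fst (fst y) < b"
    using assms unfolding block_def set_append by (meson UnE le_trans less_le_trans)
  ultimately show ?thesis using assms unfolding block_def by simp
qed

lemma block_row: "block q (q + 1) (row K q f)"
proof -
  have "map fst (row K q f) = map (Pair q) [0..<Suc (2 ^ K)]" by (simp add: row_def del: upt_Suc)
  moreover have "distinct (map (Pair q) [0..<Suc (2 ^ K)])"
    unfolding distinct_map by (auto intro: inj_onI simp del: upt_Suc)
  moreover have "fst (fst y) = q" if "y \<in> set (row K q f)" for y
    using that unfolding row_def by (auto simp del: upt_Suc)
  ultimately show ?thesis unfolding block_def by simp
qed

lemma block_tab: "block q (q + width c) (tab K c q x)"
proof (induction c arbitrary: q x)
  case (Inc r)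
  show ?case
    using block_append[OF block_row[of q] block_row[of "q + 1"]] by (simp add: numeral_2_eq_2)
next
  case (Dec r)
  show ?case
    using block_append[OF block_row[of q] block_append[OF block_row[of "q + 1"] block_row[of "q + 1 + 1"]]]
    by (simp add: numeral_2_eq_2 numeral_3_eq_3)
next
  case (Seq c d)
  show ?case
    using block_append[OF Seq.IH(1)[of q] Seq.IH(2)[of "q + width c"]] by (simp add: add.assoc)
next
  case (Loop r c)
  show ?case
    using block_append[OF block_row[of q] block_append[OF block_row[of "q + 1"]
          block_append[OF block_row[of "q + 1 + 1"] Loop.IH[of "q + 1 + 1 + 1"]]]]
    by (simp add: numeral_2_eq_2 numeral_3_eq_3)
qed

text \<open>In state \<open>3 + width P + n\<close> the machine has \<open>n\<close> marks to write on track 1 before \<open>P\<close> starts in state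
  3; the program \<open>P\<close> itself does not depend on \<open>n\<close>.\<close>

primrec prefix :: "nat \<Rightarrow> com \<Rightarrow> nat \<Rightarrow> turing" where
  "prefix K P 0 = [((0, 0), (0, Lft, 1)), ((0, 1), (1, Lft, 1))] @
     tab K P 3 2 @ row K (3 + width P) (ret K (3 + width P) 3)"
| "prefix K P (Suc n) = ((3 + width P + Suc n, 0), (2, Rgt, 3 + width P + n)) #
     ((3 + width P + Suc n, 1), (3, Rgt, 3 + width P + n)) # prefix K P n"

text \<open>State 0 steps to cell -1, state 1 writes the marker there and enters the prefix with
  \<open>c\<close> marks to go, and state 2 has no entry, so it halts.\<close>

definition machine :: "nat \<Rightarrow> com \<Rightarrow> nat \<Rightarrow> turing" where
  "machine K P c = ((1, 0), (2 ^ K, Rgt, 3 + width P + c)) # prefix K P c"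


text \<open>State 1 is kept free for the entry that \<open>machine\<close> puts in front, and state
  2 for halting.\<close>

lemma prefix_keys:
  "distinct (map fst (prefix K P n)) \<and>
   (\<forall>y\<in>set (prefix K P n). fst (fst y) \<noteq> 1 \<and> fst (fst y) \<noteq> 2 \<and> fst (fst y) < 4 + width P + n)"
proof (induction n)
  case 0
  have 1: "block 0 1 [((0::nat, 0::nat), (0::nat, Lft, 1::nat)), ((0, 1), (1, Lft, 1))]"
    by (simp add: block_def)
  have 2: "block 3 (4 + width P) (tab K P 3 2 @ row K (3 + width P) (ret K (3 + width P) 3))"
    using block_append[OF block_tab block_row, of 3 P K 2 K] by simp
  have 3: "block 0 3 [((0::nat, 0::nat), (0::nat, Lft, 1::nat)), ((0, 1), (1, Lft, 1))]"
    by (simp add: block_def)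
  from block_append[OF 3 2] have "block 0 (4 + width P) (prefix K P 0)"
    by simp
  moreover have "fst (fst y) \<noteq> 1 \<and> fst (fst y) \<noteq> 2" if "y \<in> set (prefix K P 0)" for y
  proof -
    have "y \<in> set [((0::nat, 0::nat), (0::nat, Lft, 1::nat)), ((0, 1), (1, Lft, 1))] \<or> 3 \<le> fst (fst y)"
      using that 2 unfolding block_def prefix.simps set_append by blast
    then show ?thesis by auto
  qed
  ultimately show ?case unfolding block_def by simp
next
  case (Suc n)
  have "(a, b) \<notin> fst ` set (prefix K P n)" if "4 + width P + n \<le> a" for a b
    using Suc that by fastforce
  then show ?case using Suc by fastforce
qed

lemma distinct_machine: "distinct (map fst (machine K P c))"
proof -
  have "(1, 0) \<notin> fst ` set (prefix K P c)" using prefix_keys[of K P c] by fastforce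
  then show ?thesis using prefix_keys[of K P c] by (simp add: machine_def)
qed

lemma machine_no_2: "map_of (machine K P c) (2, a) = None"
proof -
  have "(2, a) \<notin> fst ` set (prefix K P c)" using prefix_keys[of K P c] by fastforce
  then show ?thesis by (simp add: machine_def map_of_eq_None_iff)
qed

lemma contains_prefix_0: "contains T (prefix K P c) \<Longrightarrow> contains T (prefix K P 0)"
  by (induction c) simp_all

lemma contains_prefix:
  assumes "contains T (prefix K P c)"
  shows "contains T (tab K P 3 2)" "contains T (row K (3 + width P) (ret K (3 + width P) 3))"
    and "map_of T (0, 0) = Some (0, Lft, 1)" "map_of T (0, 1) = Some (1, Lft, 1)"
  using contains_prefix_0[OF assms] by simp_all

lemma contains_prefix_less:
  assumes "contains T (prefix K P c)" "i < c"
  shows "map_of T (3 + width P + Suc i, 0) = Some (2, Rgt, 3 + width P + i)"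
    and "map_of T (3 + width P + Suc i, 1) = Some (3, Rgt, 3 + width P + i)"
proof -
  have "contains T (prefix K P c) \<Longrightarrow> i < c \<Longrightarrow>
      map_of T (3 + width P + Suc i, 0) = Some (2, Rgt, 3 + width P + i) \<and>
      map_of T (3 + width P + Suc i, 1) = Some (3, Rgt, 3 + width P + i)"
  proof (induction c)
    case (Suc c)
    then show ?case by (cases "i = c") simp_all
  qed simp
  with assms show "map_of T (3 + width P + Suc i, 0) = Some (2, Rgt, 3 + width P + i)"
    and "map_of T (3 + width P + Suc i, 1) = Some (3, Rgt, 3 + width P + i)" by simp_all
qed

definition input :: "nat \<Rightarrow> nat \<Rightarrow> nat \<Rightarrow> nat" where
  "input n i = (\<lambda>_. 0)(0 := n, Suc 0 := i)"

text \<open>As sets of tracks, the symbols 1, 2 and 3 are {0}, {1} and {0, 1}: each prefix state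
  adds track 1 to the cell that it scans, whether or not the input reaches that far.\<close>

lemma reach_prefix:
  assumes T: "contains T (prefix K P c)" and K: "2 \<le> K" and i: "i \<le> c"
  shows "reach T (3 + width P + c, tape K (input n 0), 0)
    (3 + width P + (c - i), tape K (input n i), int i)"
  using i
proof (induction i)
  case (Suc i)
  let ?q = "3 + width P + (c - i)" and ?q' = "3 + width P + (c - Suc i)"
  have ci: "c - i = Suc (c - Suc i)" using Suc.prems by simp
  have m: "map_of T (?q, 0) = Some (2, Rgt, ?q')" "map_of T (?q, 1) = Some (3, Rgt, ?q')"
    using contains_prefix_less[OF T, of "c - Suc i"] Suc.prems unfolding ci by auto
  have s: "{r. r < K \<and> int i < int (input n i r)} = (if i < n then {0} else {})"
    using K by (auto simp: input_def)
  then have t: "tape K (input n i) (int i) = (if i < n then 1 else 0)"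
    by (simp add: tape_def)
  have "{r. r < K \<and> int i < int (input n (Suc i) r)} = (if i < n then {0, Suc 0} else {Suc 0})"
    using K by (auto simp: input_def)
  then have t': "tape K (input n (Suc i)) (int i) = (if i < n then 3 else 2)"
    by (auto simp: tape_def)
  have "(tape K (input n i))(int i := (if i < n then 3 else 2)) = tape K (input n (Suc i))"
  proof
    fix j
    show "((tape K (input n i))(int i := (if i < n then 3 else 2))) j = tape K (input n (Suc i)) j"
    proof (cases "j = int i")
      case True
      then show ?thesis using t' by simp
    next
      case False
      then have "tape K (input n i) j = tape K (input n (Suc i)) j"
        by (intro tape_eqI) (auto simp: input_def)
      then show ?thesis using False by simp
    qed
  qed
  moreover have "map_of T (?q, tape K (input n i) (int i)) = Some (if i < n then 3 else 2, Rgt, ?q')"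
    using m t by simp
  ultimately have "reach T (?q, tape K (input n i), int i) (?q', tape K (input n (Suc i)), int (Suc i))"
    by - (rule reach_move, assumption, simp add: add.commute)
  then show ?case using Suc reach_trans by (meson Suc_leD)
qed simp

lemma reach_start:
  assumes K: "2 \<le> K"
  shows "reach (machine K P c) (start n) (3, tape K (input n c), 0)"
proof -
  let ?T = "machine K P c"
  have T: "contains ?T ?T" by (rule contains_self) (rule distinct_machine)
  then have Tp: "contains ?T (prefix K P c)" unfolding machine_def by simp
  have m1: "map_of ?T (1, 0) = Some (2 ^ K, Rgt, 3 + width P + c)"
    by (simp add: machine_def)
  have m0: "map_of ?T (0, 0) = Some (0, Lft, 1)" "map_of ?T (0, 1) = Some (1, Lft, 1)"
    by (rule contains_prefix[OF Tp])+
  define t where "t = (\<lambda>j. if 0 \<le> j \<and> j < int n then 1 else 0::nat)"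
  have t: "t(-1 := 2 ^ K) = tape K (input n 0)"
  proof
    fix j
    have "{r. r < K \<and> j < int (input n 0 r)} = (if j < int n then {0} else {})" if "0 \<le> j"
      using K that by (auto simp: input_def)
    then show "(t(-1 := 2 ^ K)) j = tape K (input n 0) j" by (auto simp: tape_def t_def)
  qed
  have "map_of ?T (1, t (-1)) = Some (2 ^ K, Rgt, 3 + width P + c)"
    using m1 by (simp add: t_def)
  then have "reach ?T (1, t, -1) (3 + width P + c, tape K (input n 0), 0)"
    by (rule reach_move) (simp add: t)
  moreover have "map_of ?T (0, t 0) = Some (t 0, Lft, 1)"
    using m0 by (simp add: t_def)
  ultimately have "reach ?T (0, t, 0) (3 + width P + c, tape K (input n 0), 0)"
    by - (rule reach_move, assumption, simp)
  then have "reach ?T (start n) (3 + width P + c, tape K (input n 0), 0)"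
    by (simp add: start_def t_def)
  moreover have "reach ?T (3 + width P + c, tape K (input n 0), 0) (3 + width P, tape K (input n c), int c)"
    using reach_prefix[OF Tp K, of c n] by simp
  moreover have "reach ?T (3 + width P, tape K (input n c), int c) (3, tape K (input n c), 0)"
    by (rule reach_ret[OF contains_prefix(2)[OF Tp]]) simp
  ultimately show ?thesis by (meson reach_trans)
qed

lemma contains_machine: "contains (machine K P c) (tab K P 3 2)"
proof -
  have "contains (machine K P c) (machine K P c)" by (rule contains_self) (rule distinct_machine)
  then have "contains (machine K P c) (prefix K P c)" unfolding machine_def by simp
  then show ?thesis by (rule contains_prefix)
qed

section \<open>Halting, output and divergence of compiled programs\<close>

lemma halted_funpow: "halted T c \<Longrightarrow> (step T ^^ k) c = c"
  by (induction k) (auto simp: halted_def step_def split: prod.splits)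

lemma halted_funpow_le: "halted T ((step T ^^ k) c) \<Longrightarrow> k \<le> n \<Longrightarrow> (step T ^^ n) c = (step T ^^ k) c"
  using halted_funpow[of T "(step T ^^ k) c" "n - k"]
  by (metis add.commute comp_apply funpow_add le_add_diff_inverse)

lemma tm_fun_reach:
  assumes "reach T (start n) c" "halted T c"
  shows "tm_fun T n = Some (strokes c)"
proof -
  obtain k where k: "(step T ^^ k) (start n) = c" using assms unfolding reach_def by blast
  let ?P = "\<lambda>k. halted T ((step T ^^ k) (start n))"
  have "?P k" using k assms by simp
  then have "?P (LEAST k. ?P k)" "(LEAST k. ?P k) \<le> k" by (rule LeastI, rule Least_le)
  then have "(step T ^^ (LEAST k. ?P k)) (start n) = c" using halted_funpow_le k by metis
  then show ?thesis unfolding tm_fun_def using \<open>?P k\<close> by auto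
qed

lemma tm_fun_Some_reach:
  assumes "tm_fun T n = Some m"
  obtains c where "reach T (start n) c" "halted T c" "strokes c = m"
proof -
  let ?P = "\<lambda>k. halted T ((step T ^^ k) (start n))"
  have ex: "\<exists>k. ?P k" using assms by (auto simp: tm_fun_def split: if_splits)
  then have "?P (LEAST k. ?P k)" by (rule LeastI_ex)
  moreover have "strokes ((step T ^^ (LEAST k. ?P k)) (start n)) = m"
    using assms ex unfolding tm_fun_def by simp
  ultimately show thesis using that unfolding reach_def by blast
qed

lemma strokes_tape:
  assumes K: "2 \<le> K" and v: "\<And>r. 0 < r \<Longrightarrow> v r = 0"
  shows "strokes (q, tape K v, h) = v 0"
proof -
  have "(tape K v j = 1) = (0 \<le> j \<and> j < int (v 0))" for j
  proof (cases "0 \<le> j")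
    case True
    have "{r. r < K \<and> j < int (v r)} = (if j < int (v 0) then {0} else {})"
    proof -
      have "(r < K \<and> j < int (v r)) = (r \<in> (if j < int (v 0) then {0} else {}))" for r
        using v[of r] True K by (cases "r = 0") simp_all
      then show ?thesis by blast
    qed
    then show ?thesis using True by (simp add: tape_def)
  next
    case False
    \<comment> \<open>The marker on cell -1 must not be counted as a stroke.\<close>
    have "(1::nat) < 2 ^ K" using K by (intro one_less_power) simp_all
    then show ?thesis using False K by (simp add: tape_def)
  qed
  then have "{j. tape K v j = 1} = {j. 0 \<le> j \<and> j < int (v 0)}" by (rule Collect_cong)
  also have "\<dots> = {0..<int (v 0)}" by auto
  finally have "{j. tape K v j = 1} = {0..<int (v 0)}" .
  then show ?thesis by (simp add: strokes_def)
qed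

text \<open>The other registers have to be empty at the end: a cell in which a further track is set
  holds a symbol other than 1 and would not count for the output.\<close>

theorem tm_fun_machine:
  assumes K: "2 \<le> K" "regs P \<subseteq> {..<K}" and e: "exec P (input n c) v" and v: "\<And>r. 0 < r \<Longrightarrow> v r = 0"
  shows "tm_fun (machine K P c) n = Some (v 0)"
proof -
  have "reach (machine K P c) (3, tape K (input n c), 0) (2, tape K v, 0)"
    by (rule reach_exec[OF e contains_machine K(2)])
  with reach_start[OF K(1)] have "reach (machine K P c) (start n) (2, tape K v, 0)"
    by (rule reach_trans)
  moreover have "halted (machine K P c) (2, tape K v, 0)"
    by (simp add: halted_def machine_no_2)
  ultimately have "tm_fun (machine K P c) n = Some (strokes (2, tape K v, 0))" by (rule tm_fun_reach)
  then show ?thesis by (simp add: strokes_tape[OF K(1) v])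
qed

text \<open>The run passes the loop head once per round, each time with an applicable entry. A halt
  at time \<open>k\<close> would freeze the configuration, although the loop head of round
  \<open>k\<close> is reached at time \<open>k\<close> or later and is not halted.\<close>

theorem tm_fun_machine_diverges:
  assumes K: "2 \<le> K" "regs (Seq A (Seq (Loop r B) Z)) \<subseteq> {..<K}"
    and A: "exec A (input n c) (w 0)"
    and w: "\<And>i. w i r \<noteq> 0" and B: "\<And>i. exec B (w i) (w (Suc i))"
  shows "tm_fun (machine K (Seq A (Seq (Loop r B) Z)) c) n = None"
proof -
  let ?P = "Seq A (Seq (Loop r B) Z)"
  let ?T = "machine K ?P c" and ?q = "3 + width A"
  have cA: "contains ?T (tab K A 3 ?q)" and cL: "contains ?T (tab K (Loop r B) ?q (?q + (3 + width B)))"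
    using contains_machine[of K ?P c] by simp_all
  have cB: "contains ?T (tab K B (?q + 3) ?q)" using cL by simp
  define C where "C i = (?q, tape K (w i), 0::int)" for i
  have "reach ?T (3, tape K (input n c), 0) (C 0)"
    unfolding C_def by (rule reach_exec[OF A cA]) (use K in simp)
  with reach_start[OF K(1)] have base: "reach ?T (start n) (C 0)" by (rule reach_trans)
  have S: "reach1 ?T (C i) (C (Suc i))" for i
  proof -
    have "reach1 ?T (C i) (?q + 3, tape K (w i), 0)"
      unfolding C_def by (rule reach1_Loop_enter[OF cL]) (use K w in simp_all)
    moreover have "reach ?T (?q + 3, tape K (w i), 0) (C (Suc i))"
      unfolding C_def by (rule reach_exec[OF B cB]) (use K in simp)
    ultimately show ?thesis by (rule reach1_trans)
  qed
  have steps: "\<exists>k\<ge>i. (step ?T ^^ k) (start n) = C i" for i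
  proof (induction i)
    case 0
    from base show ?case unfolding reach_def by simp
  next
    case (Suc i)
    then obtain k where k: "k \<ge> i" "(step ?T ^^ k) (start n) = C i" by (elim exE conjE)
    obtain l where "(step ?T ^^ Suc l) (C i) = C (Suc i)" using S[of i] unfolding reach1_def by (elim exE)
    then have "(step ?T ^^ (Suc l + k)) (start n) = C (Suc i)" using k by (simp only: funpow_add comp_apply)
    moreover have "Suc i \<le> Suc l + k" using k by simp
    ultimately show ?case by blast
  qed
  have "\<not> halted ?T (C i)" for i
  proof -
    have "map_of ?T (?q, tape K (w i) 0) \<noteq> None"
      using contains_row[OF cL[unfolded tab.simps contains_append, THEN conjunct1] tape_le[of 0 K "w i"]]
      by simp
    then show ?thesis by (auto simp: halted_def C_def)
  qed
  moreover have "\<exists>i. halted ?T (C i)" if "halted ?T ((step ?T ^^ k) (start n))" for k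
  proof -
    obtain l where l: "k \<le> l" "(step ?T ^^ l) (start n) = C k" using steps[of k] by (elim exE conjE)
    then have "C k = (step ?T ^^ k) (start n)" using halted_funpow_le[OF that l(1)] by simp
    then show ?thesis using that by (intro exI[of _ k]) simp
  qed
  ultimately have "\<not> (\<exists>k. halted ?T ((step ?T ^^ k) (start n)))" by blast
  then show ?thesis unfolding tm_fun_def by (simp only: if_False)
qed

section \<open>Primitive recursive functions\<close>

definition pf :: "nat \<Rightarrow> nat" where "pf z = fst (prod_decode z)"
definition ps :: "nat \<Rightarrow> nat" where "ps z = snd (prod_decode z)"
definition pr :: "nat \<Rightarrow> nat \<Rightarrow> nat" where "pr a b = prod_encode (a, b)"

lemma pf_pr [simp]: "pf (pr a b) = a" by (simp add: pf_def pr_def)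
lemma ps_pr [simp]: "ps (pr a b) = b" by (simp add: ps_def pr_def)
lemma pr_pf_ps [simp]: "pr (pf z) (ps z) = z" by (simp add: pf_def ps_def pr_def)
lemma pr_eq [simp]: "pr a b = pr c d \<longleftrightarrow> a = c \<and> b = d" by (simp add: pr_def)
lemma le_pr_1: "a \<le> pr a b" by (simp add: pr_def le_prod_encode_1)
lemma le_pr_2: "b \<le> pr a b" by (simp add: pr_def le_prod_encode_2)

text \<open>Pairing replaces tuples of arguments, so that every function can be computed in place on a
  stack of registers: the program for \<open>f\<close> at \<open>r\<close> uses only registers above \<open>r\<close>.\<close>

inductive prc :: "(nat \<Rightarrow> nat) \<Rightarrow> bool" where
  prc_id: "prc (\<lambda>x. x)"
| prc_zero: "prc (\<lambda>x. 0)"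
| prc_Suc0: "prc Suc"
| prc_pf0: "prc pf"
| prc_ps0: "prc ps"
| prc_comp: "prc f \<Longrightarrow> prc g \<Longrightarrow> prc (\<lambda>x. f (g x))"
| prc_pr: "prc f \<Longrightarrow> prc g \<Longrightarrow> prc (\<lambda>x. pr (f x) (g x))"
| prc_iter0: "prc f \<Longrightarrow> prc (\<lambda>x. (f ^^ pf x) (ps x))"

lemma exec_cong: "exec c v w \<Longrightarrow> w = w' \<Longrightarrow> exec c v w'"
  by simp

inductive_cases exec_SeqE: "exec (Seq c d) v w"

text \<open>\<open>W i\<close> gives the registers after \<open>i\<close> rounds; naming the whole
  sequence takes the place of an invariant and of a termination argument.\<close>

lemma exec_Loop_iter:
  assumes "\<And>i. i < n \<Longrightarrow> W i r \<noteq> 0 \<and> exec c (W i) (W (Suc i))" and "W n r = 0"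
  shows "exec (Loop r c) (W 0) (W n)"
  using assms
proof (induction n arbitrary: W)
  case 0
  then show ?case by (simp add: exec_LoopF)
next
  case (Suc n)
  have "exec (Loop r c) (W (Suc 0)) (W (Suc n))"
    using Suc.IH[of "\<lambda>i. W (Suc i)"] Suc.prems by simp
  then show ?case using Suc.prems(1)[of 0] by (auto intro: exec_LoopT)
qed

section \<open>Register programs for copying, pairing and unpairing\<close>

definition clear :: "nat \<Rightarrow> com" where "clear r = Loop r (Dec r)"
definition move :: "nat \<Rightarrow> nat \<Rightarrow> com" where "move r s = Loop r (Seq (Dec r) (Inc s))"
definition dup :: "nat \<Rightarrow> nat \<Rightarrow> nat \<Rightarrow> com" where
  "dup r s t = Loop r (Seq (Dec r) (Seq (Inc s) (Inc t)))"

lemma exec_clear: "exec (clear r) v (v(r := 0))"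
proof -
  have "exec (Loop r (Dec r)) ((\<lambda>i. v(r := v r - i)) 0) ((\<lambda>i. v(r := v r - i)) (v r))"
  proof (rule exec_Loop_iter)
    fix i
    assume "i < v r"
    moreover have "exec (Dec r) (v(r := v r - i)) (v(r := v r - Suc i))"
      by (rule exec_cong, rule exec_Dec) (simp add: fun_eq_iff)
    ultimately show "(v(r := v r - i)) r \<noteq> 0 \<and> exec (Dec r) (v(r := v r - i)) (v(r := v r - Suc i))"
      by simp
  qed simp
  then show ?thesis by (simp add: clear_def)
qed

lemma exec_move:
  assumes "r \<noteq> s"
  shows "exec (move r s) v (v(r := 0, s := v s + v r))"
proof -
  let ?W = "\<lambda>i. v(r := v r - i, s := v s + i)"
  have "exec (Loop r (Seq (Dec r) (Inc s))) (?W 0) (?W (v r))"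
  proof (rule exec_Loop_iter[where W = ?W and n = "v r"])
    fix i
    assume i: "i < v r"
    have "exec (Seq (Dec r) (Inc s)) (?W i) (?W (Suc i))"
      by (rule exec_cong, rule exec_Seq, rule exec_Dec, rule exec_Inc)
        (use assms in \<open>simp add: fun_eq_iff\<close>)
    then show "?W i r \<noteq> 0 \<and> exec (Seq (Dec r) (Inc s)) (?W i) (?W (Suc i))"
      using i assms by simp
  qed (use assms in simp)
  then show ?thesis by (simp add: move_def)
qed

lemma exec_dup:
  assumes "r \<noteq> s" "r \<noteq> t" "s \<noteq> t"
  shows "exec (dup r s t) v (v(r := 0, s := v s + v r, t := v t + v r))"
proof -
  let ?W = "\<lambda>i. v(r := v r - i, s := v s + i, t := v t + i)"
  have "exec (Loop r (Seq (Dec r) (Seq (Inc s) (Inc t)))) (?W 0) (?W (v r))"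
  proof (rule exec_Loop_iter[where W = ?W and n = "v r"])
    fix i
    assume i: "i < v r"
    have "exec (Seq (Dec r) (Seq (Inc s) (Inc t))) (?W i) (?W (Suc i))"
      by (rule exec_cong, rule exec_Seq, rule exec_Dec, rule exec_Seq, rule exec_Inc, rule exec_Inc)
        (use assms in \<open>simp add: fun_eq_iff\<close>)
    then show "?W i r \<noteq> 0 \<and> exec (Seq (Dec r) (Seq (Inc s) (Inc t))) (?W i) (?W (Suc i))"
      using i assms by simp
  qed (use assms in simp)
  then show ?thesis by (simp add: dup_def)
qed

definition copy :: "nat \<Rightarrow> com" where
  "copy r = Seq (dup r (r + 1) (r + 2)) (move (r + 2) r)"

lemma exec_copy:
  assumes "\<And>s. r < s \<Longrightarrow> v s = 0"
  shows "exec (copy r) v (v(r + 1 := v r))"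
  unfolding copy_def
  by (rule exec_cong, rule exec_Seq, rule exec_dup, simp, simp, simp, rule exec_move, simp)
    (use assms in \<open>simp add: fun_eq_iff\<close>)

definition pairing :: "nat \<Rightarrow> com" where
  "pairing r = Seq (dup r (r + 1) (r + 2)) (Seq (move (r + 2) r)
     (Loop (r + 1) (Seq (dup (r + 1) r (r + 2)) (Seq (move (r + 2) (r + 1)) (Dec (r + 1))))))"

lemma exec_pairing:
  assumes v: "\<And>s. r + 1 < s \<Longrightarrow> v s = 0"
  shows "exec (pairing r) v (v(r := pr (v r) (v (r + 1)), r + 1 := 0))"
proof -
  let ?B = "Seq (dup (r + 1) r (r + 2)) (Seq (move (r + 2) (r + 1)) (Dec (r + 1)))"
  let ?n = "v r + v (r + 1)"
  \<comment> \<open>For arguments \<open>a\<close> and \<open>b\<close>, register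
    \<open>r + 1\<close> counts down from \<open>a + b\<close>; adding its value to register
    \<open>r\<close> in every round turns \<open>a\<close> into \<open>a + triangle (a + b)\<close>,
    which is \<open>prod_encode (a, b)\<close>.\<close>
  let ?W = "\<lambda>i. v(r := v r + (triangle ?n - triangle (?n - i)), r + 1 := ?n - i)"
  have "exec (Loop (r + 1) ?B) (?W 0) (?W ?n)"
  proof (rule exec_Loop_iter[where W = ?W and n = ?n])
    fix i
    assume i: "i < ?n"
    define k where "k = ?n - Suc i"
    have k: "?n - i = Suc k" "?n - Suc i = k" using i unfolding k_def by simp_all
    have mono: "triangle a \<le> triangle (a + b)" for a b by (induction b) auto
    have "Suc k + i = ?n" using k i by linarith
    with mono[of "Suc k" i] have "triangle (Suc k) \<le> triangle ?n" by (simp only:)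
    then have t: "triangle ?n - triangle (Suc k) + Suc k = triangle ?n - triangle k" by simp
    have "exec ?B (?W i) (?W (Suc i))"
      unfolding k
      by (rule exec_cong, rule exec_Seq, rule exec_dup, simp, simp, simp, rule exec_Seq,
          rule exec_move, simp, rule exec_Dec)
        (use v t in \<open>simp add: fun_eq_iff del: triangle_Suc\<close>)
    then show "?W i (r + 1) \<noteq> 0 \<and> exec ?B (?W i) (?W (Suc i))" using i by simp
  qed simp
  then have L: "exec (Loop (r + 1) ?B) (v(r + 1 := ?n)) (v(r := v r + triangle ?n, r + 1 := 0))"
    by (simp add: fun_upd_twist)
  have M: "exec (Seq (dup r (r + 1) (r + 2)) (move (r + 2) r)) v (v(r + 1 := ?n))"
    by (rule exec_cong, rule exec_Seq, rule exec_dup, simp, simp, simp, rule exec_move, simp)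
      (use v in \<open>simp add: fun_eq_iff\<close>)
  from M obtain u where "exec (dup r (r + 1) (r + 2)) v u" "exec (move (r + 2) r) u (v(r + 1 := ?n))"
    by (rule exec_SeqE)
  with L have "exec (pairing r) v (v(r := v r + triangle ?n, r + 1 := 0))"
    unfolding pairing_def by (blast intro: exec_Seq)
  then show ?thesis by (simp add: pr_def prod_encode_def add.commute)
qed

text \<open>Unpairing counts up: one step moves the pair in \<open>r\<close> and
  \<open>r + 1\<close> to its successor on the antidiagonal, while \<open>r + 2\<close> counts the
  steps. Register \<open>r + 3\<close> is a flag that survives only if the second component is 0,
  when the next antidiagonal begins; \<open>r + 4\<close> buffers that component.\<close>

definition unpair_step :: "nat \<Rightarrow> com" where
  "unpair_step r = Seq (Dec (r + 2)) (Seq (Inc (r + 3)) (Seq (move (r + 1) (r + 4))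
     (Seq (Loop (r + 4) (Seq (Dec (r + 4)) (Seq (Dec (r + 3)) (Seq (Inc r) (move (r + 4) (r + 1))))))
          (Loop (r + 3) (Seq (Dec (r + 3)) (Seq (move r (r + 1)) (Inc (r + 1))))))))"

definition unpair :: "nat \<Rightarrow> com" where
  "unpair r = Seq (move r (r + 2)) (Loop (r + 2) (unpair_step r))"

lemma pr_Suc: "Suc (pr a (Suc b)) = pr (Suc a) b" "Suc (pr a 0) = pr 0 (Suc a)"
  by (simp_all add: pr_def prod_encode_def)

lemma pf_Suc: "pf (Suc z) = (if ps z = 0 then 0 else Suc (pf z))"
  and ps_Suc: "ps (Suc z) = (if ps z = 0 then Suc (pf z) else ps z - 1)"
proof -
  have "Suc z = (if ps z = 0 then pr 0 (Suc (pf z)) else pr (Suc (pf z)) (ps z - 1))"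
    using pr_Suc[of "pf z"] pr_pf_ps[of z] by (cases "ps z") (metis diff_Suc_1 nat.simps(3))+
  then show "pf (Suc z) = (if ps z = 0 then 0 else Suc (pf z))"
    and "ps (Suc z) = (if ps z = 0 then Suc (pf z) else ps z - 1)" by (simp_all split: if_splits)
qed

lemma exec_unpair_step:
  assumes v: "\<And>s. r + 2 < s \<Longrightarrow> v s = 0"
  shows "exec (unpair_step r) v (v(r + 2 := v (r + 2) - 1,
     r := (if v (r + 1) = 0 then 0 else Suc (v r)),
     r + 1 := (if v (r + 1) = 0 then Suc (v r) else v (r + 1) - 1)))"
proof (cases "v (r + 1) = 0")
  case True
  show ?thesis unfolding unpair_step_def
    by (rule exec_cong, rule exec_Seq, rule exec_Dec, rule exec_Seq, rule exec_Inc, rule exec_Seq,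
        rule exec_move, simp, rule exec_Seq, rule exec_LoopF, use True v in simp,
        rule exec_LoopT, simp, rule exec_Seq, rule exec_Dec, rule exec_Seq, rule exec_move, simp,
        rule exec_Inc, rule exec_LoopF, use v in simp)
      (use True v in \<open>simp add: fun_eq_iff\<close>)
next
  case False
  show ?thesis unfolding unpair_step_def
    by (rule exec_cong, rule exec_Seq, rule exec_Dec, rule exec_Seq, rule exec_Inc, rule exec_Seq,
        rule exec_move, simp, rule exec_Seq, rule exec_LoopT, use False in simp,
        rule exec_Seq, rule exec_Dec, rule exec_Seq, rule exec_Dec, rule exec_Seq, rule exec_Inc,
        rule exec_move, simp, rule exec_LoopF, simp, rule exec_LoopF, use v in simp)
      (use False v in \<open>simp add: fun_eq_iff\<close>)
qed

lemma exec_unpair: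
  assumes v: "\<And>s. r < s \<Longrightarrow> v s = 0"
  shows "exec (unpair r) v (v(r := pf (v r), r + 1 := ps (v r)))"
proof -
  let ?W = "\<lambda>i. v(r := pf i, r + 1 := ps i, r + 2 := v r - i)"
  have "exec (Loop (r + 2) (unpair_step r)) (?W 0) (?W (v r))"
  proof (rule exec_Loop_iter[where W = ?W and n = "v r"])
    fix i
    assume i: "i < v r"
    have "exec (unpair_step r) (?W i) (?W (Suc i))"
      by (rule exec_cong, rule exec_unpair_step)
        (use v in \<open>simp_all add: fun_eq_iff pf_Suc ps_Suc\<close>)
    then show "?W i (r + 2) \<noteq> 0 \<and> exec (unpair_step r) (?W i) (?W (Suc i))" using i by simp
  qed simp
  moreover have "exec (move r (r + 2)) v (?W 0)"
    by (rule exec_cong, rule exec_move) (use v in \<open>simp_all add: fun_eq_iff pf_def ps_def prod_decode_def prod_decode_aux.simps\<close>)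
  ultimately have "exec (unpair r) v (?W (v r))" unfolding unpair_def by (blast intro: exec_Seq)
  then show ?thesis by (rule exec_cong) (use v in \<open>simp add: fun_eq_iff\<close>)
qed

text \<open>The registers above \<open>r\<close> are scratch space, empty on entry and again on
  exit, so that programs can be nested by shifting \<open>r\<close>.\<close>

definition computes :: "(nat \<Rightarrow> com) \<Rightarrow> (nat \<Rightarrow> nat) \<Rightarrow> bool" where
  "computes c f \<longleftrightarrow> (\<forall>r v. (\<forall>s>r. v s = 0) \<longrightarrow> exec (c r) v (v(r := f (v r))))"

lemma computesD: "computes c f \<Longrightarrow> (\<And>s. r < s \<Longrightarrow> v s = 0) \<Longrightarrow> exec (c r) v (v(r := f (v r)))"
  unfolding computes_def by blast

text \<open>\<open>f\<close> runs on the copy in \<open>r + 1\<close>. Then argument and value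
  change places, because \<open>g\<close> has to run at \<open>r + 1\<close> with nothing but empty
  registers above it.\<close>

lemma computes_pr:
  assumes c: "computes c f" and d: "computes d g"
  shows "computes (\<lambda>r. Seq (copy r) (Seq (c (r + 1)) (Seq (move r (r + 2)) (Seq (move (r + 1) r)
     (Seq (move (r + 2) (r + 1)) (Seq (d (r + 1)) (pairing r))))))) (\<lambda>x. pr (f x) (g x))"
  unfolding computes_def
proof (intro allI impI)
  fix r and v :: "nat \<Rightarrow> nat"
  assume v: "\<forall>s>r. v s = 0"
  show "exec (Seq (copy r) (Seq (c (r + 1)) (Seq (move r (r + 2)) (Seq (move (r + 1) r)
     (Seq (move (r + 2) (r + 1)) (Seq (d (r + 1)) (pairing r))))))) v (v(r := pr (f (v r)) (g (v r))))"
    by (rule exec_cong, rule exec_Seq, rule exec_copy, use v in simp, rule exec_Seq,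
        rule computesD[OF c], use v in simp, rule exec_Seq, rule exec_move, simp, rule exec_Seq,
        rule exec_move, simp, rule exec_Seq, rule exec_move, simp, rule exec_Seq,
        rule computesD[OF d], use v in simp, rule exec_pairing, use v in simp)
      (use v in \<open>simp add: fun_eq_iff\<close>)
qed

lemma computes_iter:
  assumes c: "computes c f"
  shows "computes (\<lambda>r. Seq (unpair r) (Seq (Loop r (Seq (Dec r) (c (r + 1)))) (move (r + 1) r)))
     (\<lambda>x. (f ^^ pf x) (ps x))"
  unfolding computes_def
proof (intro allI impI)
  fix r and v :: "nat \<Rightarrow> nat"
  assume v: "\<forall>s>r. v s = 0"
  let ?W = "\<lambda>i. v(r := pf (v r) - i, r + 1 := (f ^^ i) (ps (v r)))"
  have L: "exec (Loop r (Seq (Dec r) (c (r + 1)))) (?W 0) (?W (pf (v r)))"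
  proof (rule exec_Loop_iter[where W = ?W and n = "pf (v r)"])
    fix i
    assume i: "i < pf (v r)"
    have "exec (Seq (Dec r) (c (r + 1))) (?W i) (?W (Suc i))"
      by (rule exec_cong, rule exec_Seq, rule exec_Dec, rule computesD[OF c])
        (use v in \<open>simp_all add: fun_eq_iff\<close>)
    then show "?W i r \<noteq> 0 \<and> exec (Seq (Dec r) (c (r + 1))) (?W i) (?W (Suc i))" using i by simp
  qed simp
  have "exec (unpair r) v (?W 0)"
    by (rule exec_cong, rule exec_unpair) (use v in simp_all)
  moreover have "exec (move (r + 1) r) (?W (pf (v r))) (v(r := (f ^^ pf (v r)) (ps (v r))))"
    by (rule exec_cong, rule exec_move) (use v in \<open>simp_all add: fun_eq_iff\<close>)
  ultimately show "exec (Seq (unpair r) (Seq (Loop r (Seq (Dec r) (c (r + 1)))) (move (r + 1) r))) v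
     (v(r := (f ^^ pf (v r)) (ps (v r))))"
    using L by (blast intro: exec_Seq)
qed

lemma prc_computes: "prc f \<Longrightarrow> \<exists>c. computes c f"
proof (induction rule: prc.induct)
  case prc_id
  have "computes (\<lambda>r. Seq (Inc r) (Dec r)) (\<lambda>x. x)" unfolding computes_def
    by (intro allI impI, rule exec_cong, rule exec_Seq, rule exec_Inc, rule exec_Dec) simp
  then show ?case by blast
next
  case prc_zero
  have "computes clear (\<lambda>x. 0)" unfolding computes_def by (simp add: exec_clear)
  then show ?case by blast
next
  case prc_Suc0
  have "computes Inc Suc" unfolding computes_def by (simp add: exec_Inc)
  then show ?case by blast
next
  case prc_pf0
  have "computes (\<lambda>r. Seq (unpair r) (clear (r + 1))) pf" unfolding computes_def
    by (intro allI impI, rule exec_cong, rule exec_Seq, rule exec_unpair, simp, rule exec_clear)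
      (simp add: fun_eq_iff)
  then show ?case by blast
next
  case prc_ps0
  have "computes (\<lambda>r. Seq (unpair r) (Seq (clear r) (move (r + 1) r))) ps" unfolding computes_def
    by (intro allI impI, rule exec_cong, rule exec_Seq, rule exec_unpair, simp, rule exec_Seq,
        rule exec_clear, rule exec_move) (simp_all add: fun_eq_iff)
  then show ?case by blast
next
  case (prc_comp f g)
  then obtain c d where c: "computes c f" and d: "computes d g" by blast
  have "computes (\<lambda>r. Seq (d r) (c r)) (\<lambda>x. f (g x))" unfolding computes_def
    by (intro allI impI, rule exec_cong, rule exec_Seq, rule computesD[OF d], simp,
        rule computesD[OF c]) simp_all
  then show ?case by blast
next
  case (prc_pr f g)
  then show ?case using computes_pr by blast
next
  case (prc_iter0 f)
  then show ?case using computes_iter by blast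
qed

lemma regs_bound: "\<exists>K\<ge>2. regs P \<subseteq> {..<K}"
proof -
  obtain n where "\<forall>x\<in>regs P. x \<le> n" using finite_regs finite_nat_set_iff_bounded_le by blast
  then have "regs P \<subseteq> {..<n + 2}" by auto
  then show ?thesis by (intro exI[of _ "n + 2"]) simp
qed

theorem prc_tm:
  assumes "prc f"
  shows "\<exists>T. \<forall>n. tm_fun T n = Some (f n)"
proof -
  obtain c where c: "computes c f" using prc_computes[OF assms] by blast
  obtain K where K: "2 \<le> K" "regs (c 0) \<subseteq> {..<K}" using regs_bound by blast
  have "tm_fun (machine K (c 0) 0) n = Some (f n)" for n
  proof -
    have "exec (c 0) (input n 0) ((input n 0)(0 := f (input n 0 0)))"
      by (rule computesD[OF c]) (simp add: input_def)
    from tm_fun_machine[OF K this] show ?thesis by (simp add: input_def)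
  qed
  then show ?thesis by blast
qed

text \<open>Register 0 holds the parameters paired with the candidate \<open>w\<close>, and register
  1 the value of \<open>D\<close>, which controls the loop. \<open>K\<close> and \<open>P\<close>
  are chosen before \<open>c\<close>, so the program is uniform in the parameter.\<close>

theorem prc_search_tm:
  assumes D: "prc D" and out: "prc out"
  shows "\<exists>K P. \<forall>c n. tm_fun (machine K P c) n =
    (if \<exists>w. D (pr (pr n c) w) = 0 then Some (out (pr (pr n c) (LEAST w. D (pr (pr n c) w) = 0))) else None)"
proof -
  have "prc (\<lambda>x. pr x 0)" "prc (\<lambda>x. pr (pf x) (Suc (ps x)))"
    by (intro prc_pr prc_id prc_zero prc_pf0 prc_comp[OF prc_Suc0 prc_ps0])+
  then obtain ci cn where ci: "computes ci (\<lambda>x. pr x 0)"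
    and cn: "computes cn (\<lambda>x. pr (pf x) (Suc (ps x)))" using prc_computes by metis
  obtain cd co where cd: "computes cd D" and co: "computes co out" using prc_computes assms by metis
  define chk where "chk = Seq (copy 0) (cd 1)"
  define A where "A = Seq (pairing 0) (Seq (ci 0) chk)"
  define B where "B = Seq (clear 1) (Seq (cn 0) chk)"
  obtain K where K: "2 \<le> K" "regs (Seq A (Seq (Loop 1 B) (co 0))) \<subseteq> {..<K}"
    using regs_bound by blast
  have "tm_fun (machine K (Seq A (Seq (Loop 1 B) (co 0))) c) n =
    (if \<exists>w. D (pr (pr n c) w) = 0 then Some (out (pr (pr n c) (LEAST w. D (pr (pr n c) w) = 0))) else None)"
    for c n
  proof -
    define x where "x = pr n c"
    define W where "W i = input (pr x i) (D (pr x i))" for i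
    have chk: "exec chk (input z 0) (input z (D z))" for z unfolding chk_def
      by (rule exec_cong, rule exec_Seq, rule exec_copy, simp add: input_def, rule computesD[OF cd])
        (simp_all add: input_def fun_eq_iff)
    have "exec (pairing 0) (input n c) (input x 0)"
      by (rule exec_cong, rule exec_pairing) (simp_all add: input_def x_def fun_eq_iff)
    moreover have "exec (ci 0) (input x 0) (input (pr x 0) 0)"
      by (rule exec_cong, rule computesD[OF ci]) (simp_all add: input_def fun_eq_iff)
    ultimately have A: "exec A (input n c) (W 0)" unfolding A_def W_def
      by (blast intro: exec_Seq chk)
    have B: "exec B (W i) (W (Suc i))" for i
    proof -
      have "exec (clear 1) (W i) (input (pr x i) 0)"
        by (rule exec_cong, rule exec_clear) (simp add: W_def input_def fun_eq_iff)
      moreover have "exec (cn 0) (input (pr x i) 0) (input (pr x (Suc i)) 0)"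
        by (rule exec_cong, rule computesD[OF cn]) (simp_all add: input_def fun_eq_iff)
      ultimately show ?thesis unfolding B_def W_def by (blast intro: exec_Seq chk)
    qed
    show ?thesis
    proof (cases "\<exists>w. D (pr x w) = 0")
      case True
      define w where "w = (LEAST w. D (pr x w) = 0)"
      have w: "D (pr x w) = 0" unfolding w_def by (rule LeastI_ex) (rule True)
      have nw: "D (pr x i) \<noteq> 0" if "i < w" for i using not_less_Least that unfolding w_def by blast
      have "exec (Loop 1 B) (W 0) (W w)"
        by (rule exec_Loop_iter[where W = W and n = w]) (use w nw B in \<open>simp_all add: W_def input_def\<close>)
      moreover have "exec (co 0) (W w) (input (out (pr x w)) 0)"
        by (rule exec_cong, rule computesD[OF co]) (use w in \<open>simp_all add: W_def input_def fun_eq_iff\<close>)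
      ultimately have "exec (Seq A (Seq (Loop 1 B) (co 0))) (input n c) (input (out (pr x w)) 0)"
        using A by (blast intro: exec_Seq)
      from tm_fun_machine[OF K this] True show ?thesis by (simp add: x_def w_def input_def)
    next
      case False
      have "tm_fun (machine K (Seq A (Seq (Loop 1 B) (co 0))) c) n = None"
        by (rule tm_fun_machine_diverges[OF K A _ B]) (use False in \<open>simp add: W_def input_def\<close>)
      then show ?thesis using False by (simp add: x_def)
    qed
  qed
  then show ?thesis by blast
qed

section \<open>Computably enumerable relations\<close>

named_theorems prc_intros
named_theorems decp_intros
named_theorems ce_intros

lemma prc_const: "prc (\<lambda>x. c)"
  by (induction c) (auto intro: prc_zero prc_comp[OF prc_Suc0])

lemmas prc_Suc = prc_comp[OF prc_Suc0]
lemmas prc_pf = prc_comp[OF prc_pf0]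
lemmas prc_ps = prc_comp[OF prc_ps0]

lemmas [prc_intros] = prc_id prc_const prc_Suc prc_pf prc_ps prc_pr

text \<open>The parameter \<open>x\<close> is carried along in the iterated pair, since
  \<open>prc_iter0\<close> iterates a function of one number.\<close>

lemma prc_iter [prc_intros]:
  assumes h: "prc (\<lambda>z. h (pf z) (ps z))" and n: "prc n" and a: "prc a"
  shows "prc (\<lambda>x. (h x ^^ n x) (a x))"
proof -
  define F where "F = (\<lambda>z. pr (pf z) (h (pf z) (ps z)))"
  have F: "prc F" unfolding F_def by (intro prc_intros h)
  have it: "(F ^^ m) (pr x y) = pr x ((h x ^^ m) y)" for m x y
    by (induction m) (simp_all add: F_def)
  have "prc (\<lambda>x. ps ((F ^^ pf (pr (n x) (pr x (a x)))) (ps (pr (n x) (pr x (a x))))))"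
    by (intro prc_ps prc_comp[OF prc_iter0[OF F]] prc_pr prc_id n a)
  then show ?thesis by (simp add: it)
qed

text \<open>The iterated state is the pair of the counter and the value so far.\<close>

lemma prc_rec [prc_intros]:
  assumes h: "prc (\<lambda>z. h (pf z) (pf (ps z)) (ps (ps z)))" and n: "prc n" and a: "prc a"
  shows "prc (\<lambda>x. rec_nat (a x) (h x) (n x))"
proof -
  define G where "G = (\<lambda>x z. pr (Suc (pf z)) (h x (pf z) (ps z)))"
  have it: "(G x ^^ m) (pr 0 y) = pr m (rec_nat y (h x) m)" for m x y
    by (induction m) (simp_all add: G_def)
  have "prc (\<lambda>z. G (pf z) (ps z))" unfolding G_def by (intro prc_intros h)
  then have "prc (\<lambda>x. ps ((G x ^^ n x) (pr 0 (a x))))" by (intro prc_intros n a)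
  then show ?thesis by (simp add: it)
qed

lemma prc_add [prc_intros]: "prc f \<Longrightarrow> prc g \<Longrightarrow> prc (\<lambda>x. f x + g x)"
proof -
  assume f: "prc f" and g: "prc g"
  have "(Suc ^^ m) n = m + n" for m n by (induction m) auto
  moreover have "prc (\<lambda>x. ((\<lambda>y. Suc y) ^^ f x) (g x))" by (intro prc_intros f g)
  ultimately show ?thesis by simp
qed

lemma prc_mult [prc_intros]: "prc f \<Longrightarrow> prc g \<Longrightarrow> prc (\<lambda>x. f x * g x)"
proof -
  assume f: "prc f" and g: "prc g"
  have e: "rec_nat 0 (\<lambda>_ y. y + k) m = m * k" for m k :: nat by (induction m) auto
  have "prc (\<lambda>z. g (pf z))" by (intro prc_comp[OF g] prc_intros)
  then have "prc (\<lambda>x. rec_nat 0 (\<lambda>_ y. y + g x) (f x))" by (intro prc_intros f)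
  then show ?thesis by (simp add: e)
qed

lemma prc_power [prc_intros]: "prc f \<Longrightarrow> prc g \<Longrightarrow> prc (\<lambda>x. f x ^ g x)"
proof -
  assume f: "prc f" and g: "prc g"
  have e: "rec_nat (Suc 0) (\<lambda>_ y. y * k) m = k ^ m" for m k :: nat by (induction m) auto
  have "prc (\<lambda>z. f (pf z))" by (intro prc_comp[OF f] prc_intros)
  then have "prc (\<lambda>x. rec_nat 1 (\<lambda>_ y. y * f x) (g x))" by (intro prc_intros g)
  then show ?thesis by (simp add: e)
qed

lemma prc_diff [prc_intros]: "prc f \<Longrightarrow> prc g \<Longrightarrow> prc (\<lambda>x. f x - g x)"
proof -
  assume f: "prc f" and g: "prc g"
  have p: "rec_nat 0 (\<lambda>i _. i) m = m - 1" for m :: nat by (cases m) auto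
  have e: "((\<lambda>y. y - 1) ^^ m) k = k - m" for m k :: nat by (induction m) auto
  have "prc (\<lambda>x. ((\<lambda>y. rec_nat 0 (\<lambda>i _. i) y) ^^ g x) (f x))" by (intro prc_intros f g)
  then show ?thesis unfolding p e .
qed

definition decp :: "(nat \<Rightarrow> bool) \<Rightarrow> bool" where
  "decp P \<longleftrightarrow> prc (\<lambda>x. if P x then 1 else 0)"

lemma prc_if [prc_intros]:
  assumes P: "decp P" and f: "prc f" and g: "prc g"
  shows "prc (\<lambda>x. if P x then f x else g x)"
proof -
  have "prc (\<lambda>z. f (pf z))" by (intro prc_comp[OF f] prc_intros)
  then have "prc (\<lambda>x. rec_nat (g x) (\<lambda>_ _. f x) (if P x then 1 else 0))"
    by (intro prc_intros g P[unfolded decp_def])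
  moreover have "rec_nat (g x) (\<lambda>_ _. f x) (if P x then 1 else 0) = (if P x then f x else g x)" for x
    by simp
  ultimately show ?thesis by simp
qed

lemma decp_cong:
  assumes "prc f" "\<And>x. f x = (if P x then 1 else 0)"
  shows "decp P"
proof -
  have "f = (\<lambda>x. if P x then 1 else 0)" by (rule ext) (rule assms(2))
  with assms(1) show ?thesis by (simp add: decp_def)
qed

lemma decp_le [decp_intros]:
  assumes "prc f" "prc g"
  shows "decp (\<lambda>x. f x \<le> g x)"
proof (rule decp_cong)
  show "prc (\<lambda>x. 1 - (f x - g x))" by (intro prc_intros assms)
qed auto

lemma decp_not [decp_intros]:
  assumes "decp P"
  shows "decp (\<lambda>x. \<not> P x)"
proof (rule decp_cong)
  show "prc (\<lambda>x. if P x then 0 else 1)" by (intro prc_intros assms)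
qed simp

lemma decp_conj [decp_intros]:
  assumes "decp P" "decp P'"
  shows "decp (\<lambda>x. P x \<and> P' x)"
proof (rule decp_cong)
  show "prc (\<lambda>x. if P x then (if P' x then 1 else 0) else 0)" by (intro prc_intros assms)
qed simp

lemma decp_disj [decp_intros]:
  assumes "decp P" "decp P'"
  shows "decp (\<lambda>x. P x \<or> P' x)"
proof (rule decp_cong)
  show "prc (\<lambda>x. if P x then 1 else if P' x then 1 else 0)" by (intro prc_intros assms)
qed simp

lemma decp_imp [decp_intros]:
  assumes "decp P" "decp P'"
  shows "decp (\<lambda>x. P x \<longrightarrow> P' x)"
proof (rule decp_cong)
  show "prc (\<lambda>x. if P x then (if P' x then 1 else 0) else 1)" by (intro prc_intros assms)
qed simp

lemma decp_eq [decp_intros]: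
  assumes "prc f" "prc g"
  shows "decp (\<lambda>x. f x = g x)"
proof -
  have "decp (\<lambda>x. f x \<le> g x \<and> g x \<le> f x)" by (intro decp_intros assms)
  then show ?thesis by (simp add: eq_iff)
qed

lemma decp_less [decp_intros]:
  assumes "prc f" "prc g"
  shows "decp (\<lambda>x. f x < g x)"
proof -
  have "decp (\<lambda>x. \<not> g x \<le> f x)" by (intro decp_intros assms)
  then show ?thesis by (simp add: not_le)
qed

lemma decp_comp: "decp P \<Longrightarrow> prc f \<Longrightarrow> decp (\<lambda>x. P (f x))"
  unfolding decp_def by (rule prc_comp)

lemma decp_ball [decp_intros]:
  assumes P: "decp (\<lambda>z. P (pf z) (ps z))" and n: "prc n"
  shows "decp (\<lambda>x. \<forall>y<n x. P x y)"
proof (rule decp_cong)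
  have "decp (\<lambda>z. P (pf z) (pf (ps z)))"
    using decp_comp[OF P, of "\<lambda>z. pr (pf z) (pf (ps z))"] prc_intros by simp
  then show "prc (\<lambda>x. rec_nat 1 (\<lambda>i a. if P x i then a else 0) (n x))"
    by (intro prc_intros n)
  fix x
  have "rec_nat 1 (\<lambda>i a. if P x i then a else 0) m = (if \<forall>y<m. P x y then 1 else 0)" for m
    by (induction m) (auto simp: less_Suc_eq)
  then show "rec_nat 1 (\<lambda>i a. if P x i then a else 0) (n x) = (if \<forall>y<n x. P x y then 1 else 0)" .
qed

lemma decp_bex [decp_intros]:
  assumes P: "decp (\<lambda>z. P (pf z) (ps z))" and n: "prc n"
  shows "decp (\<lambda>x. \<exists>y<n x. P x y)"
proof -
  have "decp (\<lambda>x. \<not> (\<forall>y<n x. \<not> P x y))" by (intro decp_intros P n)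
  then show ?thesis by simp
qed

lemma decp_ball_le [decp_intros]:
  "decp (\<lambda>z. P (pf z) (ps z)) \<Longrightarrow> prc n \<Longrightarrow> decp (\<lambda>x. \<forall>y\<le>n x. P x y)"
  using decp_ball[of P "\<lambda>x. Suc (n x)"] by (simp add: less_Suc_eq_le prc_Suc)

lemma decp_bex_le [decp_intros]:
  "decp (\<lambda>z. P (pf z) (ps z)) \<Longrightarrow> prc n \<Longrightarrow> decp (\<lambda>x. \<exists>y\<le>n x. P x y)"
  using decp_bex[of P "\<lambda>x. Suc (n x)"] by (simp add: less_Suc_eq_le prc_Suc)

text \<open>Projections of primitive recursive predicates; a single number is the witness, so
  several witnesses have to be paired.\<close>

definition ce :: "(nat \<Rightarrow> bool) \<Rightarrow> bool" where
  "ce P \<longleftrightarrow> (\<exists>D. decp D \<and> (\<forall>x. P x \<longleftrightarrow> (\<exists>w. D (pr x w))))"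

lemma ceI: "decp D \<Longrightarrow> (\<And>x. P x \<longleftrightarrow> (\<exists>w. D (pr x w))) \<Longrightarrow> ce P"
  unfolding ce_def by blast

lemma ceD: "ce P \<Longrightarrow> \<exists>D. decp (\<lambda>z. D (pf z) (ps z)) \<and> (\<forall>x. P x \<longleftrightarrow> (\<exists>w. D x w))"
proof -
  assume "ce P"
  then obtain D where D: "decp D" "\<And>x. P x \<longleftrightarrow> (\<exists>w. D (pr x w))" unfolding ce_def by blast
  show ?thesis by (rule exI[of _ "\<lambda>x w. D (pr x w)"]) (simp add: D)
qed

lemma decp_comp2:
  "decp (\<lambda>z. D (pf z) (ps z)) \<Longrightarrow> prc f \<Longrightarrow> prc g \<Longrightarrow> decp (\<lambda>x. D (f x) (g x))"
  using decp_comp[of "\<lambda>z. D (pf z) (ps z)" "\<lambda>x. pr (f x) (g x)"] by (simp add: prc_pr)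

lemma ce_dec: "decp P \<Longrightarrow> ce P"
  by (rule ceI[of "\<lambda>z. P (pf z)"], erule decp_comp, rule prc_pf0, simp)

text \<open>Negation enters through decidable predicates only.\<close>

lemmas [ce_intros] = ce_dec[OF decp_eq] ce_dec[OF decp_le] ce_dec[OF decp_less] ce_dec[OF decp_not]

lemma ce_comp: "ce P \<Longrightarrow> prc f \<Longrightarrow> ce (\<lambda>x. P (f x))"
proof -
  assume P: "ce P" and f: "prc f"
  obtain D where D0: "decp (\<lambda>z. D (pf z) (ps z)) \<and> (\<forall>x. P x \<longleftrightarrow> (\<exists>w. D x w))"
    using ceD[OF P] by (rule exE)
  note D = conjunct1[OF D0] spec[OF conjunct2[OF D0]]
  have "prc (\<lambda>z. f (pf z))" by (intro prc_comp[OF f] prc_intros)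
  then have "decp (\<lambda>z. D (f (pf z)) (ps z))" by (intro decp_comp2[OF D(1)] prc_intros)
  then show ?thesis by (rule ceI) (simp add: D(2))
qed

lemma ce_comp3:
  "ce (\<lambda>z. P (pf z) (pf (ps z)) (ps (ps z))) \<Longrightarrow> prc f \<Longrightarrow> prc g \<Longrightarrow> prc h \<Longrightarrow> ce (\<lambda>x. P (f x) (g x) (h x))"
  using ce_comp[of "\<lambda>z. P (pf z) (pf (ps z)) (ps (ps z))" "\<lambda>x. pr (f x) (pr (g x) (h x))"]
  by (simp add: prc_pr)

lemma ce_conj [ce_intros]:
  assumes "ce P" "ce P'"
  shows "ce (\<lambda>x. P x \<and> P' x)"
proof -
  obtain D where D0: "decp (\<lambda>z. D (pf z) (ps z)) \<and> (\<forall>x. P x \<longleftrightarrow> (\<exists>w. D x w))"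
    using ceD[OF assms(1)] by (rule exE)
  note D = conjunct1[OF D0] spec[OF conjunct2[OF D0]]
  obtain E where E0: "decp (\<lambda>z. E (pf z) (ps z)) \<and> (\<forall>x. P' x \<longleftrightarrow> (\<exists>w. E x w))"
    using ceD[OF assms(2)] by (rule exE)
  note E = conjunct1[OF E0] spec[OF conjunct2[OF E0]]
  have "decp (\<lambda>z. D (pf z) (pf (ps z)) \<and> E (pf z) (ps (ps z)))"
    by (intro decp_intros decp_comp2[OF D(1)] decp_comp2[OF E(1)] prc_intros)
  then show ?thesis
  proof (rule ceI)
    show "(P x \<and> P' x) = (\<exists>w. D (pf (pr x w)) (pf (ps (pr x w))) \<and> E (pf (pr x w)) (ps (ps (pr x w))))" for x
      unfolding D(2) E(2) by simp (metis pf_pr ps_pr)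
  qed
qed

lemma ce_disj [ce_intros]:
  assumes "ce P" "ce P'"
  shows "ce (\<lambda>x. P x \<or> P' x)"
proof -
  obtain D where D0: "decp (\<lambda>z. D (pf z) (ps z)) \<and> (\<forall>x. P x \<longleftrightarrow> (\<exists>w. D x w))"
    using ceD[OF assms(1)] by (rule exE)
  note D = conjunct1[OF D0] spec[OF conjunct2[OF D0]]
  obtain E where E0: "decp (\<lambda>z. E (pf z) (ps z)) \<and> (\<forall>x. P' x \<longleftrightarrow> (\<exists>w. E x w))"
    using ceD[OF assms(2)] by (rule exE)
  note E = conjunct1[OF E0] spec[OF conjunct2[OF E0]]
  have "decp (\<lambda>z. D (pf z) (ps z) \<or> E (pf z) (ps z))"
    by (intro decp_intros D(1) E(1))
  then show ?thesis by (rule ceI) (auto simp: D(2) E(2))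
qed

lemma ce_ex [ce_intros]:
  assumes "ce (\<lambda>z. P (pf z) (ps z))"
  shows "ce (\<lambda>x. \<exists>y. P x y)"
proof -
  obtain D where D0: "decp (\<lambda>z. D (pf z) (ps z)) \<and> (\<forall>z. P (pf z) (ps z) \<longleftrightarrow> (\<exists>w. D z w))"
    using ceD[OF assms] by (rule exE)
  note D = conjunct1[OF D0] spec[OF conjunct2[OF D0]]
  have "decp (\<lambda>z. D (pr (pf z) (pf (ps z))) (ps (ps z)))"
    by (intro decp_comp2[OF D(1)] prc_intros)
  then show ?thesis
  proof (rule ceI)
    fix x
    have "P x y \<longleftrightarrow> (\<exists>w. D (pr x y) w)" for y using D(2)[of "pr x y"] by simp
    then show "(\<exists>y. P x y) = (\<exists>w. D (pr (pf (pr x w)) (pf (ps (pr x w)))) (ps (ps (pr x w))))"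
      by simp (metis pf_pr ps_pr)
  qed
qed

text \<open>Collection: finitely many witnesses have a common bound, and that bound is the witness
  for the bounded quantifier.\<close>

lemma ce_ball [ce_intros]:
  assumes "ce (\<lambda>z. P (pf z) (ps z))" and n: "prc n"
  shows "ce (\<lambda>x. \<forall>y<n x. P x y)"
proof -
  obtain D where D0: "decp (\<lambda>z. D (pf z) (ps z)) \<and> (\<forall>z. P (pf z) (ps z) \<longleftrightarrow> (\<exists>w. D z w))"
    using ceD[OF assms(1)] by (rule exE)
  note D = conjunct1[OF D0] spec[OF conjunct2[OF D0]]
  have n': "prc (\<lambda>z. n (pf z))" by (intro prc_comp[OF n] prc_intros)
  have "decp (\<lambda>z. \<forall>y<n (pf z). \<exists>w<ps z. D (pr (pf z) y) w)"
    by (intro decp_intros decp_comp2[OF D(1)] prc_intros n')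
  then show ?thesis
  proof (rule ceI)
    fix x
    have P: "P x y \<longleftrightarrow> (\<exists>w. D (pr x y) w)" for y using D(2)[of "pr x y"] by simp
    have "(\<forall>y<m. \<exists>w. D (pr x y) w) \<Longrightarrow> \<exists>b. \<forall>y<m. \<exists>w<b. D (pr x y) w" for m
    proof (induction m)
      case (Suc m)
      then obtain b w where b: "\<forall>y<m. \<exists>w<b. D (pr x y) w" and w: "D (pr x m) w" by auto
      have "\<exists>w'<b + Suc w. D (pr x y) w'" if "y < Suc m" for y
      proof (cases "y = m")
        case True
        then show ?thesis using w by (intro exI[of _ w]) simp
      next
        case False
        then have "y < m" using that by simp
        with b obtain w' where "w' < b" "D (pr x y) w'" by blast
        then show ?thesis by (intro exI[of _ w']) simp
      qed
      then show ?case by blast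
    qed simp
    then show "(\<forall>y<n x. P x y) = (\<exists>w. \<forall>y<n (pf (pr x w)). \<exists>w'<ps (pr x w). D (pr (pf (pr x w)) y) w')"
      unfolding P by simp blast
  qed
qed

lemma ce_ball_le [ce_intros]:
  "ce (\<lambda>z. P (pf z) (ps z)) \<Longrightarrow> prc n \<Longrightarrow> ce (\<lambda>x. \<forall>y\<le>n x. P x y)"
  using ce_ball[of P "\<lambda>x. Suc (n x)"] by (simp add: less_Suc_eq_le prc_Suc)

section \<open>Coded lists and certificates for inductively generated sets\<close>

definition drp :: "nat \<Rightarrow> nat \<Rightarrow> nat" where
  "drp c n = ((\<lambda>c. ps (c - 1)) ^^ n) c"

text \<open>The empty list is 0, and with truncated subtraction both its tail and its head come out
  as 0; reading beyond the end therefore yields 0.\<close>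

definition lnth :: "nat \<Rightarrow> nat \<Rightarrow> nat" where
  "lnth c n = pf (drp c n - 1)"

definition cns :: "nat \<Rightarrow> nat \<Rightarrow> nat" where
  "cns x c = Suc (pr x c)"

lemma prc_drp [prc_intros]: "prc f \<Longrightarrow> prc g \<Longrightarrow> prc (\<lambda>x. drp (f x) (g x))"
  unfolding drp_def by (intro prc_intros)

lemma prc_lnth [prc_intros]: "prc f \<Longrightarrow> prc g \<Longrightarrow> prc (\<lambda>x. lnth (f x) (g x))"
  unfolding lnth_def by (intro prc_intros)

lemma prc_cns [prc_intros]: "prc f \<Longrightarrow> prc g \<Longrightarrow> prc (\<lambda>x. cns (f x) (g x))"
  unfolding cns_def by (intro prc_intros)

lemma list_encode_Cons: "list_encode (x # xs) = cns x (list_encode xs)"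
  by (simp add: cns_def pr_def)

declare list_encode.simps(2) [simp del]

lemma cns_eq [simp]: "cns x c = cns y d \<longleftrightarrow> x = y \<and> c = d"
  by (simp add: cns_def)

lemma cns_neq_0 [simp]: "cns x c \<noteq> 0" "0 \<noteq> cns x c"
  by (simp_all add: cns_def)

lemma list_encode_eq_0 [simp]: "list_encode xs = 0 \<longleftrightarrow> xs = []"
  by (cases xs) (simp_all add: list_encode_Cons)

lemma drp_encode: "drp (list_encode xs) n = list_encode (drop n xs)"
proof -
  have *: "ps (list_encode xs - Suc 0) = list_encode (tl xs)" for xs
    by (cases xs) (simp_all add: list_encode_Cons cns_def, simp add: ps_def prod_decode_def prod_decode_aux.simps)
  show ?thesis unfolding drp_def
    by (induction n) (simp_all add: * drop_Suc tl_drop)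
qed

lemma drp_neq_0 [simp]: "drp (list_encode xs) n \<noteq> 0 \<longleftrightarrow> n < length xs"
  by (auto simp: drp_encode)

lemma lnth_encode: "n < length xs \<Longrightarrow> lnth (list_encode xs) n = xs ! n"
  by (cases "drop n xs") (auto simp: lnth_def drp_encode list_encode_Cons cns_def nth_via_drop)

lemma length_le_encode: "length xs \<le> list_encode xs"
proof (induction xs)
  case (Cons x xs)
  then show ?case using le_pr_2[of "list_encode xs" x] by (simp add: list_encode_Cons cns_def)
qed simp

text \<open>A rule has exactly two premises; a rule that needs only one is used with the same
  premise twice.\<close>

inductive der :: "(nat \<Rightarrow> bool) \<Rightarrow> (nat \<Rightarrow> nat \<Rightarrow> nat \<Rightarrow> bool) \<Rightarrow> nat \<Rightarrow> bool" for A R where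
  der_ax: "A x \<Longrightarrow> der A R x"
| der_step: "der A R y \<Longrightarrow> der A R z \<Longrightarrow> R x y z \<Longrightarrow> der A R x"

text \<open>In a certificate, an entry \<open>\<langle>x, w\<rangle>\<close> derives \<open>x\<close> from conclusions of entries further down the list;
  \<open>w\<close> witnesses the side condition of the rule.\<close>

primrec okcert :: "(nat \<Rightarrow> nat \<Rightarrow> bool) \<Rightarrow> (nat \<Rightarrow> nat \<Rightarrow> bool) \<Rightarrow> nat list \<Rightarrow> bool" where
  "okcert A R [] \<longleftrightarrow> True"
| "okcert A R (e # es) \<longleftrightarrow> okcert A R es \<and> (A (pf e) (ps e) \<or>
     (\<exists>a\<in>set es. \<exists>b\<in>set es. R (pr (pf e) (pr (pf a) (pf b))) (ps e)))"

lemma okcert_append: "okcert A R xs \<Longrightarrow> okcert A R ys \<Longrightarrow> okcert A R (xs @ ys)"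
  by (induction xs) auto

lemma okcert_nth:
  "okcert A R xs \<longleftrightarrow> (\<forall>i<length xs. A (pf (xs ! i)) (ps (xs ! i)) \<or>
     (\<exists>j<length xs. \<exists>k<length xs. i < j \<and> i < k \<and>
        R (pr (pf (xs ! i)) (pr (pf (xs ! j)) (pf (xs ! k)))) (ps (xs ! i))))"
proof (induction xs)
  case (Cons e es)
  show ?case
    by (simp only: okcert.simps Cons.IH length_Cons All_less_Suc2 Ex_less_Suc2 nth_Cons_0 nth_Cons_Suc
        Suc_less_eq not_less_zero zero_less_Suc simp_thms Bex_def in_set_conv_nth) blast
qed simp

lemma ex_list_encode: "(\<exists>l. P l) \<longleftrightarrow> (\<exists>xs. P (list_encode xs))"
  by (metis list_decode_inverse)

text \<open>Being derivable means having a certificate, which is one number. Checking it is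
  decidable: all positions are bounded by the code of the list, which is at least its length, and
  the side conditions carry their witnesses with them.\<close>

lemma ce_der:
  assumes "ce A" and "ce (\<lambda>z. R (pf z) (pf (ps z)) (ps (ps z)))"
  shows "ce (der A R)"
proof -
  obtain D where D0: "decp (\<lambda>z. D (pf z) (ps z)) \<and> (\<forall>x. A x \<longleftrightarrow> (\<exists>w. D x w))"
    using ceD[OF assms(1)] by (rule exE)
  note D = conjunct1[OF D0] spec[OF conjunct2[OF D0]]
  obtain E where E0: "decp (\<lambda>z. E (pf z) (ps z)) \<and> (\<forall>z. R (pf z) (pf (ps z)) (ps (ps z)) \<longleftrightarrow> (\<exists>w. E z w))"
    using ceD[OF assms(2)] by (rule exE)
  note E = conjunct1[OF E0] spec[OF conjunct2[OF E0]]
  note E' = E(2)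
  have R: "R x y z \<longleftrightarrow> (\<exists>w. E (pr x (pr y z)) w)" for x y z
    using E'[of "pr x (pr y z)"] by simp
  let ?ok = "\<lambda>l. \<forall>i<l. drp l i \<noteq> 0 \<longrightarrow> D (pf (lnth l i)) (ps (lnth l i)) \<or>
      (\<exists>j<l. \<exists>k<l. drp l j \<noteq> 0 \<and> drp l k \<noteq> 0 \<and> i < j \<and> i < k \<and>
        E (pr (pf (lnth l i)) (pr (pf (lnth l j)) (pf (lnth l k)))) (ps (lnth l i)))"
  have ok: "?ok (list_encode xs) \<longleftrightarrow> okcert D E xs" for xs
  proof -
    have b: "i < length xs \<Longrightarrow> i < list_encode xs" for i using length_le_encode[of xs] by simp
    show ?thesis unfolding okcert_nth drp_neq_0
      by (auto simp: lnth_encode dest: b) (metis b lnth_encode)+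
  qed
  have sound: "okcert D E xs \<Longrightarrow> \<forall>e\<in>set xs. der A R (pf e)" for xs
  proof (induction xs)
    case (Cons e es)
    then have IH: "\<forall>e\<in>set es. der A R (pf e)" by simp
    have "D (pf e) (ps e) \<or> (\<exists>a\<in>set es. \<exists>b\<in>set es. E (pr (pf e) (pr (pf a) (pf b))) (ps e))"
      using Cons.prems by simp
    then have "der A R (pf e)"
    proof
      assume "D (pf e) (ps e)"
      then show ?thesis using D(2) der_ax by blast
    next
      assume "\<exists>a\<in>set es. \<exists>b\<in>set es. E (pr (pf e) (pr (pf a) (pf b))) (ps e)"
      then show ?thesis using R IH der_step by blast
    qed
    then show ?case using IH by simp
  qed simp
  have complete: "\<exists>e es. pf e = x \<and> okcert D E (e # es)" if "der A R x" for x
    using that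
  proof induction
    case (der_ax x)
    then obtain w where "D x w" using D(2) by blast
    then have "okcert D E [pr x w]" by simp
    then show ?case using pf_pr by blast
  next
    case (der_step y z x)
    then obtain a as b bs where *: "pf a = y" "okcert D E (a # as)" "pf b = z" "okcert D E (b # bs)"
      by blast
    obtain w where "E (pr x (pr y z)) w" using der_step R by blast
    then have "okcert D E (pr x w # (a # as) @ (b # bs))"
      using okcert_append[OF *(2,4)] *(1,3) by auto
    then show ?case using pf_pr by blast
  qed
  \<comment> \<open>Premises stand further down the list, so the judgement to be certified is the
    conclusion of the first entry.\<close>
  have "decp (\<lambda>z. ps z \<noteq> 0 \<and> pf (lnth (ps z) 0) = pf z \<and> ?ok (ps z))"
    by (intro decp_intros prc_intros decp_comp2[OF D(1)] decp_comp2[OF E(1)])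
  then show ?thesis
  proof (rule ceI)
    fix x
    have "(\<exists>l. l \<noteq> 0 \<and> pf (lnth l 0) = x \<and> ?ok l) \<longleftrightarrow>
        (\<exists>xs. list_encode xs \<noteq> 0 \<and> pf (lnth (list_encode xs) 0) = x \<and> ?ok (list_encode xs))"
      by (rule ex_list_encode)
    also have "\<dots> \<longleftrightarrow> (\<exists>xs. xs \<noteq> [] \<and> pf (hd xs) = x \<and> okcert D E xs)"
      unfolding ok list_encode_eq_0 by (metis hd_conv_nth length_greater_0_conv lnth_encode)
    also have "\<dots> \<longleftrightarrow> der A R x"
      using sound complete by (metis list.sel(1) list.set_sel(1) list.distinct(1))
    finally show "der A R x = (\<exists>w. ps (pr x w) \<noteq> 0 \<and> pf (lnth (ps (pr x w)) 0) = pf (pr x w) \<and> ?ok (ps (pr x w)))"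
      by simp
  qed
qed

text \<open>The search runs over pairs of a value and a witness and outputs the value.
  Single-valuedness is asked at the given \<open>n\<close> and \<open>c\<close> only, because the
  graph used later is shown to be single-valued just for those \<open>c\<close> that are codes of
  machines.\<close>

theorem ce_function_tm:
  assumes "ce (\<lambda>z. G (pf z) (ps z))"
  shows "\<exists>K P. \<forall>c n. (\<forall>y y'. G (pr n c) y \<longrightarrow> G (pr n c) y' \<longrightarrow> y = y') \<longrightarrow>
    (\<forall>y. tm_fun (machine K P c) n = Some y \<longleftrightarrow> G (pr n c) y)"
proof -
  obtain D where D0: "decp (\<lambda>z. D (pf z) (ps z)) \<and> (\<forall>z. G (pf z) (ps z) \<longleftrightarrow> (\<exists>w. D z w))"
    using ceD[OF assms(1)] by (rule exE)
  note D = conjunct1[OF D0] spec[OF conjunct2[OF D0]]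
  have G: "G x y \<longleftrightarrow> (\<exists>w. D (pr x y) w)" for x y using D(2)[of "pr x y"] by simp
  define C where "C z = (if D (pr (pf z) (pf (ps z))) (ps (ps z)) then 0 else 1::nat)" for z
  have "prc C" unfolding C_def by (intro prc_intros decp_comp2[OF D(1)])
  moreover have "prc (\<lambda>z. pf (ps z))" by (intro prc_intros)
  ultimately obtain K P where KP: "tm_fun (machine K P c) n =
    (if \<exists>w. C (pr (pr n c) w) = 0
     then Some (pf (ps (pr (pr n c) (LEAST w. C (pr (pr n c) w) = 0)))) else None)" for c n
    using prc_search_tm[of C "\<lambda>z. pf (ps z)"] by blast
  have "tm_fun (machine K P c) n = Some y \<longleftrightarrow> G (pr n c) y"
    if fn: "\<forall>y y'. G (pr n c) y \<longrightarrow> G (pr n c) y' \<longrightarrow> y = y'" for c n y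
  proof -
    let ?x = "pr n c"
    have C: "C (pr ?x w) = 0 \<longleftrightarrow> D (pr ?x (pf w)) (ps w)" for w by (simp add: C_def)
    show ?thesis
    proof (cases "\<exists>w. C (pr ?x w) = 0")
      case True
      define w where "w = (LEAST w. C (pr ?x w) = 0)"
      have "C (pr ?x w) = 0" unfolding w_def by (rule LeastI_ex) (rule True)
      then have "G ?x (pf w)" using C G by blast
      moreover have "tm_fun (machine K P c) n = Some (pf w)" using KP True by (simp add: w_def)
      ultimately show ?thesis using fn by auto
    next
      case False
      then have "tm_fun (machine K P c) n = None" using KP by simp
      moreover have "\<not> G ?x y"
      proof
        assume "G ?x y"
        then obtain w where "D (pr ?x y) w" using G by blast
        then have "C (pr ?x (pr y w)) = 0" using C by simp
        with False show False by blast
      qed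
      ultimately show ?thesis by simp
    qed
  qed
  then show ?thesis by blast
qed

section \<open>A universal machine\<close>

text \<open>Lookup in a coded table; the condition on the earlier positions is the first-match rule
  of \<open>map_of\<close>.\<close>

definition lk :: "nat \<Rightarrow> nat \<Rightarrow> nat \<Rightarrow> bool" where
  "lk c k y \<longleftrightarrow> (\<exists>i<c. drp c i \<noteq> 0 \<and> pf (lnth c i) = k \<and> ps (lnth c i) = y \<and>
     (\<forall>j<i. pf (lnth c j) \<noteq> k))"

definition nolk :: "nat \<Rightarrow> nat \<Rightarrow> bool" where
  "nolk c k \<longleftrightarrow> (\<forall>i<c. drp c i \<noteq> 0 \<longrightarrow> pf (lnth c i) \<noteq> k)"

lemma decp_lk [decp_intros]:
  assumes "prc f" "prc g" "prc h"
  shows "decp (\<lambda>x. lk (f x) (g x) (h x))"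
proof -
  have a: "prc (\<lambda>z. f (pf z))" "prc (\<lambda>z. g (pf z))" "prc (\<lambda>z. h (pf z))"
    "prc (\<lambda>z. f (pf (pf z)))" "prc (\<lambda>z. g (pf (pf z)))"
    by (intro prc_comp[OF assms(1)] prc_comp[OF assms(2)] prc_comp[OF assms(3)] prc_intros)+
  show ?thesis unfolding lk_def by (intro decp_intros prc_intros assms a)
qed

lemma decp_nolk [decp_intros]:
  assumes "prc f" "prc g"
  shows "decp (\<lambda>x. nolk (f x) (g x))"
proof -
  have a: "prc (\<lambda>z. f (pf z))" "prc (\<lambda>z. g (pf z))"
    by (intro prc_comp[OF assms(1)] prc_comp[OF assms(2)] prc_intros)+
  show ?thesis unfolding nolk_def by (intro decp_intros prc_intros assms a)
qed

definition code_act :: "nat \<times> dir \<times> nat \<Rightarrow> nat" where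
  "code_act y = (case y of (b, d, q) \<Rightarrow> pr b (pr (code_dir d) q))"

lemma code_turing_alt:
  "code_turing T = list_encode (map (\<lambda>y. pr (pr (fst (fst y)) (snd (fst y))) (code_act (snd y))) T)"
  unfolding code_turing_def
  by (intro arg_cong[of _ _ list_encode] map_cong) (auto simp: pr_def code_act_def split: prod.splits)

lemma lk_encode:
  "lk (list_encode xs) k y \<longleftrightarrow>
     (\<exists>i<length xs. pf (xs ! i) = k \<and> ps (xs ! i) = y \<and> (\<forall>j<i. pf (xs ! j) \<noteq> k))"
proof -
  have "i < list_encode xs \<and> drp (list_encode xs) i \<noteq> 0 \<longleftrightarrow> i < length xs" for i
    unfolding drp_neq_0 using length_le_encode[of xs] by auto
  then have "lk (list_encode xs) k y \<longleftrightarrow> (\<exists>i<length xs. pf (lnth (list_encode xs) i) = k \<and>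
      ps (lnth (list_encode xs) i) = y \<and> (\<forall>j<i. pf (lnth (list_encode xs) j) \<noteq> k))"
    unfolding lk_def by blast
  then show ?thesis by (simp add: lnth_encode cong: conj_cong)
qed

lemma nolk_encode:
  "nolk (list_encode xs) k \<longleftrightarrow> (\<forall>x\<in>set xs. pf x \<noteq> k)"
proof -
  have "i < list_encode xs \<and> drp (list_encode xs) i \<noteq> 0 \<longleftrightarrow> i < length xs" for i
    unfolding drp_neq_0 using length_le_encode[of xs] by auto
  then have "nolk (list_encode xs) k \<longleftrightarrow> (\<forall>i<length xs. pf (lnth (list_encode xs) i) \<noteq> k)"
    unfolding nolk_def by blast
  then show ?thesis by (simp add: lnth_encode all_set_conv_all_nth)
qed

lemma nolk_code: "nolk (code_turing T) (pr q a) \<longleftrightarrow> map_of T (q, a) = None"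
  unfolding code_turing_alt nolk_encode map_of_eq_None_iff by (auto simp: image_iff)

lemma lk_Cons:
  "lk (list_encode (x # xs)) k y \<longleftrightarrow> (if pf x = k then ps x = y else lk (list_encode xs) k y)"
  unfolding lk_encode by (simp add: Ex_less_Suc2 All_less_Suc2)

lemma lk_code: "lk (code_turing T) (pr q a) y \<longleftrightarrow> (\<exists>u. map_of T (q, a) = Some u \<and> y = code_act u)"
  unfolding code_turing_alt
proof (induction T)
  case Nil
  show ?case by (simp add: lk_def)
next
  case (Cons e T)
  obtain p b u where e: "e = ((p, b), u)" by (metis surj_pair)
  show ?case
  proof (cases "p = q \<and> b = a")
    case True
    then show ?thesis by (auto simp: e lk_Cons simp del: split_paired_Ex)
  next
    case False
    then show ?thesis using Cons.IH by (auto simp: e lk_Cons simp del: split_paired_Ex)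
  qed
qed

text \<open>A judgement \<open>pr c (pr n (pr q (pr l r)))\<close> says that the machine with code
  \<open>c\<close> on input \<open>n\<close> gets into state \<open>q\<close>, where
  \<open>r\<close> lists the tape from the scanned cell to the right and \<open>l\<close> the tape
  from the cell before it to the left. The axioms are the start configurations.\<close>

definition reached_ax :: "nat \<Rightarrow> bool" where
  "reached_ax x \<longleftrightarrow> (\<exists>c n. x = pr c (pr n (pr 0 (pr 0 (((\<lambda>r. cns 1 r) ^^ n) 0)))))"

text \<open>A move to the right (tag 1) pushes the written symbol on \<open>l\<close>; a move to the
  left (tag 0) puts it back on \<open>r\<close> and then the first symbol of \<open>l\<close> on
  top. The second premise is left open.\<close>

definition reached_step :: "nat \<Rightarrow> nat \<Rightarrow> nat \<Rightarrow> bool" where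
  "reached_step x y z \<longleftrightarrow> (\<exists>c n q l r b q'. y = pr c (pr n (pr q (pr l r))) \<and>
     (lk c (pr q (pf (r - 1))) (pr b (pr 1 q')) \<and> x = pr c (pr n (pr q' (pr (cns b l) (ps (r - 1))))) \<or>
      lk c (pr q (pf (r - 1))) (pr b (pr 0 q')) \<and>
        x = pr c (pr n (pr q' (pr (ps (l - 1)) (cns (pf (l - 1)) (cns b (ps (r - 1)))))))))"

definition reached :: "nat \<Rightarrow> nat \<Rightarrow> nat \<Rightarrow> bool" where
  "reached c n z \<longleftrightarrow> der reached_ax reached_step (pr c (pr n z))"

lemma ce_reached: "prc f \<Longrightarrow> prc g \<Longrightarrow> prc h \<Longrightarrow> ce (\<lambda>x. reached (f x) (g x) (h x))"
proof -
  have "ce reached_ax" unfolding reached_ax_def by (intro ce_intros prc_intros)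
  moreover have "ce (\<lambda>z. reached_step (pf z) (pf (ps z)) (ps (ps z)))"
    unfolding reached_step_def by (intro ce_intros ce_dec[OF decp_lk] prc_intros)
  ultimately have "ce (der reached_ax reached_step)" by (rule ce_der)
  then show "prc f \<Longrightarrow> prc g \<Longrightarrow> prc h \<Longrightarrow> ce (\<lambda>x. reached (f x) (g x) (h x))"
    unfolding reached_def by (elim ce_comp) (intro prc_pr)
qed

text \<open>A half tape is a list code; reading beyond its end yields 0, the blank.\<close>

definition rep :: "nat \<Rightarrow> config \<Rightarrow> bool" where
  "rep z cf \<longleftrightarrow> (case cf of (q, t, h) \<Rightarrow> \<exists>l r. z = pr q (pr l r) \<and>
     (\<forall>i. t (h + int i) = lnth r i) \<and> (\<forall>i. t (h - 1 - int i) = lnth l i))"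

lemma drp_0 [simp]: "drp r 0 = r"
  by (simp add: drp_def)

lemma pf_0 [simp]: "pf 0 = 0" and ps_0 [simp]: "ps 0 = 0"
  by (simp_all add: pf_def ps_def prod_decode_def prod_decode_aux.simps)

lemma drp_Suc: "drp r (Suc i) = drp (ps (r - 1)) i"
  unfolding drp_def funpow_Suc_right comp_apply ..

lemma lnth_0: "lnth r 0 = pf (r - 1)"
  by (simp add: lnth_def)

lemma lnth_tail: "lnth (ps (r - 1)) i = lnth r (Suc i)"
  by (simp add: lnth_def drp_Suc)

lemma lnth_cns_0 [simp]: "lnth (cns b r) 0 = b"
  by (simp add: lnth_0 cns_def)

lemma lnth_cns_Suc [simp]: "lnth (cns b r) (Suc i) = lnth r i"
  using lnth_tail[of "cns b r" i] by (simp add: cns_def)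

lemma lnth_ones: "lnth (((\<lambda>r. cns 1 r) ^^ n) 0) i = (if i < n then 1 else 0)"
proof (induction n arbitrary: i)
  case 0
  have "drp 0 i = 0" by (induction i) (simp_all add: drp_def)
  then show ?case by (simp add: lnth_def)
next
  case (Suc n)
  then show ?case by (cases i) simp_all
qed

lemma rep_start: "rep (pr 0 (pr 0 (((\<lambda>r. cns 1 r) ^^ n) 0))) (start n)"
proof -
  have "lnth 0 i = 0" for i using lnth_ones[of 0 i] by simp
  then show ?thesis unfolding rep_def start_def by (simp add: lnth_ones[simplified])
qed

lemma rep_right:
  assumes "rep (pr q (pr l r)) (q, t, h)"
  shows "rep (pr q' (pr (cns b l) (ps (r - 1)))) (q', t(h := b), h + 1)"
proof -
  have r: "t (h + int i) = lnth r i" and l: "t (h - 1 - int i) = lnth l i" for i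
    using assms unfolding rep_def by simp_all
  have "(t(h := b)) (h + 1 + int i) = lnth (ps (r - 1)) i" for i
    using r[of "Suc i"] unfolding lnth_tail by (simp add: algebra_simps)
  moreover have "(t(h := b)) (h + 1 - 1 - int i) = lnth (cns b l) i" for i
    using l[of "i - 1"] by (cases i) (simp_all add: algebra_simps)
  ultimately show ?thesis unfolding rep_def by (simp del: fun_upd_apply)
qed

lemma rep_left:
  assumes "rep (pr q (pr l r)) (q, t, h)"
  shows "rep (pr q' (pr (ps (l - 1)) (cns (pf (l - 1)) (cns b (ps (r - 1)))))) (q', t(h := b), h - 1)"
proof -
  have r: "t (h + int i) = lnth r i" and l: "t (h - 1 - int i) = lnth l i" for i
    using assms unfolding rep_def by simp_all
  have "(t(h := b)) (h - 1 + int i) = lnth (cns (pf (l - 1)) (cns b (ps (r - 1)))) i" for i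
  proof (cases i)
    case 0
    then show ?thesis using l[of 0, unfolded lnth_0] by simp
  next
    case (Suc j)
    then show ?thesis using r[of j] by (cases j) (simp_all add: lnth_tail[of r, simplified] algebra_simps)
  qed
  moreover have "(t(h := b)) (h - 1 - 1 - int i) = lnth (ps (l - 1)) i" for i
    using l[of "Suc i"] unfolding lnth_tail by (simp add: algebra_simps)
  ultimately show ?thesis unfolding rep_def by (simp del: fun_upd_apply)
qed

lemma rep_scan: "rep (pr q (pr l r)) (q', t, h) \<Longrightarrow> q' = q \<and> t h = pf (r - 1)"
  unfolding rep_def by (auto simp: lnth_0 dest: spec[of _ "0::nat"])

lemma rep_step:
  assumes z: "rep z (q, t, h)" and m: "map_of T (q, t h) = Some (b, d, q')"
  shows "\<exists>z'. reached_step (pr (code_turing T) (pr n z')) (pr (code_turing T) (pr n z)) y \<and>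
    rep z' (step T (q, t, h))"
proof -
  obtain l r where zz: "z = pr q (pr l r)" using z unfolding rep_def by auto
  have a: "t h = pf (r - 1)" using rep_scan z zz by blast
  have k: "lk (code_turing T) (pr q (pf (r - 1))) (pr b (pr (code_dir d) q'))"
    using m a unfolding lk_code by (auto simp: code_act_def)
  have s: "step T (q, t, h) = (q', t(h := b), h + offset d)" using m by (rule step_Some)
  show ?thesis
  proof (cases d)
    case Lft
    then show ?thesis using rep_left[OF z[unfolded zz], of q' b] k s
      unfolding reached_step_def zz by (intro exI conjI) (auto intro!: exI)
  next
    case Rgt
    then show ?thesis using rep_right[OF z[unfolded zz], of q' b] k s
      unfolding reached_step_def zz by (intro exI conjI) (auto intro!: exI)
  qed
qed

lemma reached_complete: "\<exists>z. rep z ((step T ^^ k) (start n)) \<and> reached (code_turing T) n z"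
proof (induction k)
  case 0
  have "reached (code_turing T) n (pr 0 (pr 0 (((\<lambda>r. cns 1 r) ^^ n) 0)))"
    unfolding reached_def by (rule der_ax) (auto simp: reached_ax_def)
  then show ?case using rep_start by auto
next
  case (Suc k)
  then obtain z where z: "rep z ((step T ^^ k) (start n))" "reached (code_turing T) n z" by blast
  obtain q t h where c: "(step T ^^ k) (start n) = (q, t, h)" by (metis surj_pair)
  show ?case
  proof (cases "map_of T (q, t h)")
    case None
    then have "(step T ^^ Suc k) (start n) = (step T ^^ k) (start n)" using c by (simp add: step_def)
    then show ?thesis using z by metis
  next
    case (Some u)
    obtain b d q' where u: "u = (b, d, q')" by (metis surj_pair)
    obtain z' where "reached_step (pr (code_turing T) (pr n z')) (pr (code_turing T) (pr n z)) (pr (code_turing T) (pr n z))"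
      "rep z' (step T (q, t, h))" using rep_step[OF z(1)[unfolded c] Some[unfolded u]] by blast
    then have "reached (code_turing T) n z'" "rep z' ((step T ^^ Suc k) (start n))"
      using z(2) c unfolding reached_def by (auto intro: der_step)
    then show ?thesis by blast
  qed
qed

lemma reached_sound:
  assumes "reached (code_turing T) n z"
  shows "\<exists>c. rep z c \<and> reach T (start n) c"
proof -
  have "der reached_ax reached_step x \<Longrightarrow> x = pr (code_turing T) (pr n z) \<Longrightarrow>
      \<exists>c. rep z c \<and> reach T (start n) c" for x
  proof (induction arbitrary: z rule: der.induct)
    case (der_ax x)
    then have "z = pr 0 (pr 0 (((\<lambda>r. cns 1 r) ^^ n) 0))" by (auto simp: reached_ax_def)
    then show ?case using rep_start reach_refl by blast
  next
    case (der_step y y' x)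
    obtain c' n' q l r b q' where y': "y = pr c' (pr n' (pr q (pr l r)))"
      and x': "lk c' (pr q (pf (r - 1))) (pr b (pr 1 q')) \<and> x = pr c' (pr n' (pr q' (pr (cns b l) (ps (r - 1))))) \<or>
        lk c' (pr q (pf (r - 1))) (pr b (pr 0 q')) \<and>
          x = pr c' (pr n' (pr q' (pr (ps (l - 1)) (cns (pf (l - 1)) (cns b (ps (r - 1)))))))"
      using der_step.hyps(3) unfolding reached_step_def by (elim exE conjE)
    have c': "c' = code_turing T" "n' = n" using x' der_step.prems by auto
    have y: "y = pr (code_turing T) (pr n (pr q (pr l r)))" using y' c' by simp
    have x: "lk (code_turing T) (pr q (pf (r - 1))) (pr b (pr 1 q')) \<and> z = pr q' (pr (cns b l) (ps (r - 1))) \<or>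
        lk (code_turing T) (pr q (pf (r - 1))) (pr b (pr 0 q')) \<and>
          z = pr q' (pr (ps (l - 1)) (cns (pf (l - 1)) (cns b (ps (r - 1)))))"
      using x' unfolding c' der_step.prems pr_eq by blast
    obtain c where c: "rep (pr q (pr l r)) c" "reach T (start n) c" using der_step.IH(1)[OF y] by blast
    obtain t h where c': "c = (q, t, h)" and th: "t h = pf (r - 1)"
      using c(1) rep_scan by (metis surj_pair)
    have st: "reach T (start n) (step T c)"
      using c(2) unfolding reach_def by (metis comp_apply funpow.simps(2))
    from x show ?case
    proof
      assume *: "lk (code_turing T) (pr q (pf (r - 1))) (pr b (pr 1 q')) \<and> z = pr q' (pr (cns b l) (ps (r - 1)))"
      then obtain d where "map_of T (q, t h) = Some (b, d, q')" "code_dir d = 1"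
        unfolding lk_code th by (auto simp: code_act_def)
      then have "step T c = (q', t(h := b), h + 1)" unfolding c' by (cases d) (simp_all add: step_Some)
      then show ?thesis using rep_right[OF c(1)[unfolded c'], of q' b] * st by auto
    next
      assume *: "lk (code_turing T) (pr q (pf (r - 1))) (pr b (pr 0 q')) \<and>
          z = pr q' (pr (ps (l - 1)) (cns (pf (l - 1)) (cns b (ps (r - 1)))))"
      then obtain d where "map_of T (q, t h) = Some (b, d, q')" "code_dir d = 0"
        unfolding lk_code th by (auto simp: code_act_def)
      then have "step T c = (q', t(h := b), h - 1)" unfolding c' by (cases d) (simp_all add: step_Some)
      then show ?thesis using rep_left[OF c(1)[unfolded c'], of q' b] * st by auto
    qed
  qed
  then show ?thesis using assms unfolding reached_def by blast
qed

text \<open>The code \<open>l\<close> bounds the positions that can hold a 1, because a list is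
  never longer than its code.\<close>

definition cnt :: "nat \<Rightarrow> nat" where
  "cnt l = rec_nat 0 (\<lambda>i m. if lnth l i = 1 then Suc m else m) l"

lemma prc_cnt [prc_intros]: "prc f \<Longrightarrow> prc (\<lambda>x. cnt (f x))"
proof -
  have "prc cnt" unfolding cnt_def by (intro prc_intros decp_intros)
  then show "prc f \<Longrightarrow> prc (\<lambda>x. cnt (f x))" by (rule prc_comp)
qed

lemma lnth_bound: "lnth l i \<noteq> 0 \<Longrightarrow> i < l"
proof -
  assume *: "lnth l i \<noteq> 0"
  obtain xs where l: "l = list_encode xs" by (metis list_decode_inverse)
  have "i < length xs"
  proof (rule ccontr)
    assume "\<not> i < length xs"
    then have "drp l i = 0" using drp_neq_0[of xs i] by (simp add: l)
    with * show False by (simp add: lnth_def)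
  qed
  then show ?thesis using length_le_encode[of xs] l by simp
qed

lemma cnt_card: "finite {i. lnth l i = 1} \<and> cnt l = card {i. lnth l i = 1}"
proof -
  have "rec_nat 0 (\<lambda>i m. if lnth l i = 1 then Suc m else m) n = card {i. i < n \<and> lnth l i = 1}" for n
  proof (induction n)
    case (Suc n)
    have "{i. i < Suc n \<and> lnth l i = 1} =
        (if lnth l n = 1 then insert n {i. i < n \<and> lnth l i = 1} else {i. i < n \<and> lnth l i = 1})"
      by (auto simp: less_Suc_eq)
    then show ?case using Suc by simp
  qed simp
  moreover have "{i. i < l \<and> lnth l i = 1} = {i. lnth l i = 1}"
    using lnth_bound[of l] by auto
  moreover have "finite {i. i < l \<and> lnth l i = 1}" by simp
  ultimately show ?thesis unfolding cnt_def by metis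
qed

lemma rep_strokes:
  assumes "rep (pr q (pr l r)) (q, t, h)"
  shows "strokes (q, t, h) = cnt l + cnt r"
proof -
  have r: "t (h + int i) = lnth r i" and l: "t (h - 1 - int i) = lnth l i" for i
    using assms unfolding rep_def by simp_all
  let ?f = "\<lambda>i. h + int i" and ?g = "\<lambda>i. h - 1 - int i"
  have "{j. t j = 1} = ?g ` {i. lnth l i = 1} \<union> ?f ` {i. lnth r i = 1}" (is "?A = ?B")
  proof
    show "?B \<subseteq> ?A" using l r by auto
    show "?A \<subseteq> ?B"
    proof
      fix j
      assume j: "j \<in> ?A"
      show "j \<in> ?B"
      proof (cases "j < h")
        case True
        then have jj: "j = ?g (nat (h - 1 - j))" by simp
        then have "lnth l (nat (h - 1 - j)) = 1" using l[of "nat (h - 1 - j)"] j by simp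
        then show ?thesis using jj by blast
      next
        case False
        then have jj: "j = ?f (nat (j - h))" by simp
        then have "lnth r (nat (j - h)) = 1" using r[of "nat (j - h)"] j by simp
        then show ?thesis using jj by blast
      qed
    qed
  qed
  moreover have "?g ` {i. lnth l i = 1} \<inter> ?f ` {i. lnth r i = 1} = {}" by auto
  moreover have "card (?g ` {i. lnth l i = 1}) = cnt l"
    using cnt_card[of l] by (simp add: card_image inj_on_def)
  moreover have "card (?f ` {i. lnth r i = 1}) = cnt r"
    using cnt_card[of r] by (simp add: card_image inj_on_def)
  moreover have "finite (?g ` {i. lnth l i = 1})" "finite (?f ` {i. lnth r i = 1})"
    using cnt_card by blast+
  ultimately show ?thesis unfolding strokes_def by (simp add: card_Un_disjoint)
qed

text \<open>Halting is the absence of an entry, which is decidable from the code; so the relation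
  stays enumerable although it says that nothing applies.\<close>

definition run :: "nat \<Rightarrow> nat \<Rightarrow> nat \<Rightarrow> bool" where
  "run c n m \<longleftrightarrow> (\<exists>q l r. reached c n (pr q (pr l r)) \<and> nolk c (pr q (pf (r - 1))) \<and> m = cnt l + cnt r)"

lemma ce_run [ce_intros]: "prc f \<Longrightarrow> prc g \<Longrightarrow> prc h \<Longrightarrow> ce (\<lambda>x. run (f x) (g x) (h x))"
proof (rule ce_comp3[where P = run])
  show "ce (\<lambda>z. run (pf z) (pf (ps z)) (ps (ps z)))"
    unfolding run_def by (intro ce_intros ce_reached ce_dec[OF decp_nolk] prc_intros)
qed

theorem run_code: "run (code_turing T) n m \<longleftrightarrow> tm_fun T n = Some m"
proof
  assume "run (code_turing T) n m"
  then obtain q l r where *: "reached (code_turing T) n (pr q (pr l r))"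
    "nolk (code_turing T) (pr q (pf (r - 1)))" "m = cnt l + cnt r" unfolding run_def by blast
  obtain q' t h where c: "rep (pr q (pr l r)) (q', t, h)" "reach T (start n) (q', t, h)"
    using reached_sound[OF *(1)] by (metis surj_pair)
  have q': "q' = q" "t h = pf (r - 1)" using rep_scan[OF c(1)] by simp_all
  have "halted T (q', t, h)" using *(2) q' unfolding nolk_code halted_def by simp
  then show "tm_fun T n = Some m"
    using tm_fun_reach[OF c(2)] rep_strokes c(1) q' *(3) by simp
next
  assume "tm_fun T n = Some m"
  then obtain c where c: "reach T (start n) c" "halted T c" "strokes c = m" by (rule tm_fun_Some_reach)
  then obtain k where k: "(step T ^^ k) (start n) = c" unfolding reach_def by blast
  obtain z where z: "rep z c" "reached (code_turing T) n z" using reached_complete[where T = T and k = k and n = n] k by blast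
  obtain q t h where cc: "c = (q, t, h)" by (metis surj_pair)
  obtain l r where zz: "z = pr q (pr l r)" using z(1) unfolding rep_def cc by auto
  have "t h = pf (r - 1)" using rep_scan z(1) zz cc by blast
  then have "nolk (code_turing T) (pr q (pf (r - 1)))"
    using c(2) unfolding nolk_code halted_def cc by simp
  moreover have "m = cnt l + cnt r" using rep_strokes z(1) c(3) unfolding zz cc by metis
  ultimately show "run (code_turing T) n m" using z(2) unfolding run_def zz by blast
qed

section \<open>Evaluation of bounded formulas\<close>

definition apf :: "arith_fun \<Rightarrow> nat list \<Rightarrow> nat" where
  "apf f vs = (case f of FZero \<Rightarrow> 0 | FAdd \<Rightarrow> vs ! 0 + vs ! 1 | FMul \<Rightarrow> vs ! 0 * vs ! 1
     | FSuc \<Rightarrow> Suc (vs ! 0))"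

primrec evt :: "(nat \<Rightarrow> nat) \<Rightarrow> arith_trm \<Rightarrow> nat" where
  "evt e (Var n) = e n"
| "evt e (Fn f ts) = apf f (map (evt e) ts)"

primrec sat :: "(nat \<Rightarrow> nat) \<Rightarrow> arith_fm \<Rightarrow> bool" where
  "sat e (Eq s t) \<longleftrightarrow> evt e s = evt e t"
| "sat e (Rel r ts) \<longleftrightarrow> evt e (ts ! 0) < evt e (ts ! 1)"
| "sat e (Neg p) \<longleftrightarrow> \<not> sat e p"
| "sat e (And p q) \<longleftrightarrow> sat e p \<and> sat e q"
| "sat e (Or p q) \<longleftrightarrow> sat e p \<or> sat e q"
| "sat e (All p) \<longleftrightarrow> (\<forall>x. sat (case_nat x e) p)"
| "sat e (Ex p) \<longleftrightarrow> (\<exists>x. sat (case_nat x e) p)"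

lemma sat_Less: "sat e (Less s t) \<longleftrightarrow> evt e s < evt e t"
  by simp

lemma wf_Fn_cases:
  assumes "wf_trm Arith (Fn f ts)"
  obtains "f = FZero" "ts = []"
  | a b where "f = FAdd" "ts = [a, b]" "wf_trm Arith a" "wf_trm Arith b"
  | a b where "f = FMul" "ts = [a, b]" "wf_trm Arith a" "wf_trm Arith b"
  | a where "f = FSuc" "ts = [a]" "wf_trm Arith a"
proof -
  have l: "length ts = arith_fun_arity f" and w: "list_all (wf_trm Arith) ts"
    using assms by (simp_all add: Arith_def)
  show thesis
  proof (cases f)
    case FZero
    then show thesis using l that(1) by simp
  next
    case FAdd
    then obtain a b where "ts = [a, b]" using l by (auto simp: numeral_2_eq_2 length_Suc_conv)
    then show thesis using w FAdd that(2) by simp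
  next
    case FMul
    then obtain a b where "ts = [a, b]" using l by (auto simp: numeral_2_eq_2 length_Suc_conv)
    then show thesis using w FMul that(3) by simp
  next
    case FSuc
    then obtain a where "ts = [a]" using l by (auto simp: length_Suc_conv)
    then show thesis using w FSuc that(4) by simp
  qed
qed

lemma wf_Zero: "wf_trm Arith Zero"
  and wf_Succ: "wf_trm Arith (Succ t) \<longleftrightarrow> wf_trm Arith t"
  and wf_Add: "wf_trm Arith (Add s t) \<longleftrightarrow> wf_trm Arith s \<and> wf_trm Arith t"
  and wf_Mul: "wf_trm Arith (Mul s t) \<longleftrightarrow> wf_trm Arith s \<and> wf_trm Arith t"
  and wf_Less: "wf_fm Arith (Less s t) \<longleftrightarrow> wf_trm Arith s \<and> wf_trm Arith t"
  by (simp_all add: Arith_def)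

lemmas wf_simps [simp] = wf_Zero wf_Succ wf_Add wf_Mul wf_Less

lemma evt_lift: "evt (case_nat x e) (lift_trm 0 t) = evt e t"
proof (induction t)
  case (Fn f ts)
  then have "map (evt (case_nat x e)) (map (lift_trm 0) ts) = map (evt e) ts" by simp
  then show ?case by (simp only: evt.simps lift_trm.simps)
qed simp

lemma wf_lift_trm [simp]: "wf_trm L (lift_trm k t) = wf_trm L t"
  by (induction t) (auto simp: list_all_iff)

lemma unlift_trm: "0 \<notin> fv_trm t \<Longrightarrow> \<exists>s. t = lift_trm 0 s"
proof (induction t)
  case (Var n)
  then obtain m where "n = Suc m" by (cases n) auto
  then show ?case by (intro exI[of _ "Var m"]) simp
next
  case (Fn f ts)
  then have "\<forall>t\<in>set ts. \<exists>s. t = lift_trm 0 s" by simp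
  then obtain g where "\<forall>t\<in>set ts. t = lift_trm 0 (g t)" by metis
  then have "ts = map (lift_trm 0) (map g ts)" by (simp add: map_idI)
  then show ?case by (intro exI[of _ "Fn f (map g ts)"]) simp
qed

lemma fv_lift_trm: "fv_trm (lift_trm k t) = (\<lambda>n. if n < k then n else Suc n) ` fv_trm t"
  by (induction t) auto

text \<open>Judgements of the evaluator on codes, in an environment coded by \<open>e\<close>: a
  term has the value \<open>v\<close>, a formula has the truth value \<open>b\<close>, and for
  \<open>UJ\<close> the number \<open>b\<close> tells whether the formula holds for all values below
  \<open>v\<close> of its variable 0. The last kind unrolls bounded quantifiers step by
  step.\<close>

abbreviation TJ :: "nat \<Rightarrow> nat \<Rightarrow> nat \<Rightarrow> nat" where "TJ c e v \<equiv> pr 0 (pr c (pr e v))"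
abbreviation FJ :: "nat \<Rightarrow> nat \<Rightarrow> nat \<Rightarrow> nat" where "FJ c e b \<equiv> pr 1 (pr c (pr e b))"
abbreviation UJ :: "nat \<Rightarrow> nat \<Rightarrow> nat \<Rightarrow> nat \<Rightarrow> nat" where "UJ c e v b \<equiv> pr 2 (pr c (pr e (pr v b)))"
abbreviation code_less :: "nat \<Rightarrow> nat \<Rightarrow> nat" where
  "code_less s t \<equiv> pr 1 (pr 0 (cns s (cns t 0)))"

text \<open>An environment stores the value \<open>v\<close> as \<open>Suc v\<close>, and 0 is a hole whose variable must not occur. The
  bound of a bounded quantifier is evaluated with a hole for the quantified variable, which checks
  that it is a lifted term; the body is evaluated at 0 even if the bound is 0, so that evaluation
  succeeds for well-formed bounded formulas only.\<close>

definition ev_ax :: "nat \<Rightarrow> bool" where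
  "ev_ax x \<longleftrightarrow> (\<exists>n e v. x = TJ (pr 0 n) e v \<and> lnth e n = Suc v) \<or> (\<exists>e. x = TJ (pr 1 0) e 0)"

text \<open>Tags are those of \<open>code_trm\<close> and \<open>code_fm\<close>; for terms 0 marks
  a variable, so 2, 3 and 4 are addition, multiplication and successor. Truth values are numbers:
  conjunction is a product, negation is \<open>1 - v\<close>, and the bounded existential quantifier
  goes through \<open>UJ\<close> for the negated body.\<close>

definition ev_step :: "nat \<Rightarrow> nat \<Rightarrow> nat \<Rightarrow> bool" where
  "ev_step x y z \<longleftrightarrow>
     (\<exists>c d e v w. y = TJ c e v \<and> z = TJ d e w \<and>
       (x = TJ (pr 4 (cns c 0)) e (Suc v) \<or>
        x = TJ (pr 2 (cns c (cns d 0))) e (v + w) \<or>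
        x = TJ (pr 3 (cns c (cns d 0))) e (v * w) \<or>
        x = FJ (pr 0 (pr c d)) e (if v = w then 1 else 0) \<or>
        x = FJ (code_less c d) e (if v < w then 1 else 0))) \<or>
     (\<exists>c d e v w. y = FJ c e v \<and> z = FJ d e w \<and>
       (x = FJ (pr 2 c) e (1 - v) \<or>
        x = FJ (pr 3 (pr c d)) e (v * w) \<or>
        x = FJ (pr 4 (pr c d)) e (if v = 0 \<and> w = 0 then 0 else 1))) \<or>
     (\<exists>c e b. y = FJ c (cns 1 e) b \<and> x = UJ c e 0 1) \<or>
     (\<exists>c e v b w. y = UJ c e v b \<and> z = FJ c (cns (Suc v) e) w \<and> x = UJ c e (Suc v) (b * w)) \<or>
     (\<exists>t c e v b. y = TJ t (cns 0 e) v \<and> z = UJ c e v b \<and>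
        x = FJ (pr 5 (pr 4 (pr (pr 2 (code_less (pr 0 0) t)) c))) e b) \<or>
     (\<exists>t c e v b. y = TJ t (cns 0 e) v \<and> z = UJ (pr 2 c) e v b \<and>
        x = FJ (pr 6 (pr 3 (pr (code_less (pr 0 0) t) c))) e (1 - b))"

definition ev :: "nat \<Rightarrow> bool" where "ev = der ev_ax ev_step"

lemma ce_ev: "ce ev"
proof -
  have "ce ev_ax" unfolding ev_ax_def by (intro ce_intros decp_intros prc_intros)
  moreover have "ce (\<lambda>z. ev_step (pf z) (pf (ps z)) (ps (ps z)))"
    unfolding ev_step_def by (intro ce_intros decp_intros prc_intros)
  ultimately show ?thesis unfolding ev_def by (rule ce_der)
qed

definition env :: "nat \<Rightarrow> nat \<Rightarrow> nat" where "env e n = lnth e n - 1"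

lemma env_cns: "env (cns (Suc x) e) = case_nat x (env e)" "env (cns 0 e) = case_nat 0 (env e)"
  by (rule ext, simp add: env_def split: nat.split)+

lemma code_pr:
  "code_trm (Var n) = pr 0 n"
  "code_trm Zero = pr 1 0"
  "code_trm (Succ s) = pr 4 (cns (code_trm s) 0)"
  "code_trm (Add s t) = pr 2 (cns (code_trm s) (cns (code_trm t) 0))"
  "code_trm (Mul s t) = pr 3 (cns (code_trm s) (cns (code_trm t) 0))"
  "code_fm (Eq s t) = pr 0 (pr (code_trm s) (code_trm t))"
  "code_fm (Less s t) = code_less (code_trm s) (code_trm t)"
  "code_fm (Neg p) = pr 2 (code_fm p)"
  "code_fm (And p q) = pr 3 (pr (code_fm p) (code_fm q))"
  "code_fm (Or p q) = pr 4 (pr (code_fm p) (code_fm q))"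
  "code_fm (All p) = pr 5 (code_fm p)"
  "code_fm (Ex p) = pr 6 (code_fm p)"
  by (simp_all add: pr_def list_encode_Cons)

definition good_trm :: "arith_trm \<Rightarrow> nat \<Rightarrow> bool" where
  "good_trm t e \<longleftrightarrow> wf_trm Arith t \<and> (\<forall>n\<in>fv_trm t. lnth e n \<noteq> 0)"

definition good_fm :: "arith_fm \<Rightarrow> nat \<Rightarrow> bool" where
  "good_fm p e \<longleftrightarrow> bounded_fm p \<and> (\<forall>n\<in>fv p. lnth e n \<noteq> 0)"

lemma ev_stepI: "ev y \<Longrightarrow> ev z \<Longrightarrow> ev_step x y z \<Longrightarrow> ev x"
  unfolding ev_def by (rule der_step)

lemma evs:
  "ev (TJ c e v) \<Longrightarrow> ev (TJ (pr 4 (cns c 0)) e (Suc v))"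
  "ev (TJ c e v) \<Longrightarrow> ev (TJ d e w) \<Longrightarrow> ev (TJ (pr 2 (cns c (cns d 0))) e (v + w))"
  "ev (TJ c e v) \<Longrightarrow> ev (TJ d e w) \<Longrightarrow> ev (TJ (pr 3 (cns c (cns d 0))) e (v * w))"
  "ev (TJ c e v) \<Longrightarrow> ev (TJ d e w) \<Longrightarrow> ev (FJ (pr 0 (pr c d)) e (if v = w then 1 else 0))"
  "ev (TJ c e v) \<Longrightarrow> ev (TJ d e w) \<Longrightarrow> ev (FJ (code_less c d) e (if v < w then 1 else 0))"
  "ev (FJ c e v) \<Longrightarrow> ev (FJ (pr 2 c) e (1 - v))"
  "ev (FJ c e v) \<Longrightarrow> ev (FJ d e w) \<Longrightarrow> ev (FJ (pr 3 (pr c d)) e (v * w))"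
  "ev (FJ c e v) \<Longrightarrow> ev (FJ d e w) \<Longrightarrow> ev (FJ (pr 4 (pr c d)) e (if v = 0 \<and> w = 0 then 0 else 1))"
  "ev (FJ c (cns 1 e) v) \<Longrightarrow> ev (UJ c e 0 1)"
  "ev (UJ c e v w) \<Longrightarrow> ev (FJ c (cns (Suc v) e) w') \<Longrightarrow> ev (UJ c e (Suc v) (w * w'))"
  "ev (TJ d (cns 0 e) v) \<Longrightarrow> ev (UJ c e v w) \<Longrightarrow>
     ev (FJ (pr 5 (pr 4 (pr (pr 2 (code_less (pr 0 0) d)) c))) e w)"
  "ev (TJ d (cns 0 e) v) \<Longrightarrow> ev (UJ (pr 2 c) e v w) \<Longrightarrow>
     ev (FJ (pr 6 (pr 3 (pr (code_less (pr 0 0) d) c))) e (1 - w))"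
  by (rule ev_stepI, assumption, assumption, simp add: ev_step_def; fail)+

lemma ev_trm: "good_trm t e \<Longrightarrow> ev (TJ (code_trm t) e (evt (env e) t))"
proof (induction t)
  case (Var n)
  then have "ev_ax (TJ (pr 0 n) e (env e n))" unfolding ev_ax_def good_trm_def env_def
    by (intro disjI1 exI[of _ n] exI[of _ e] exI[of _ "lnth e n - 1"]) simp
  then show ?case unfolding ev_def by (auto simp: code_pr simp del: code_trm.simps intro: der_ax)
next
  case (Fn f ts)
  have g: "good_trm t e" if "t \<in> set ts" for t
    using Fn.prems that by (auto simp: good_trm_def list_all_iff)
  from Fn.prems have "wf_trm Arith (Fn f ts)" by (simp add: good_trm_def)
  then show ?case
  proof (cases rule: wf_Fn_cases)
    case 1
    have "ev_ax (TJ (pr 1 0) e 0)" unfolding ev_ax_def by blast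
    then show ?thesis unfolding ev_def 1 code_pr by (simp add: apf_def der_ax)
  next
    case (2 a b)
    then show ?thesis using evs(2)[OF Fn.IH[of a] Fn.IH[of b]] g
      by (simp add: code_pr apf_def del: code_trm.simps)
  next
    case (3 a b)
    then show ?thesis using evs(3)[OF Fn.IH[of a] Fn.IH[of b]] g
      by (simp add: code_pr apf_def del: code_trm.simps)
  next
    case (4 a)
    then show ?thesis using evs(1)[OF Fn.IH[of a]] g
      by (simp add: code_pr apf_def del: code_trm.simps)
  qed
qed

definition tv :: "bool \<Rightarrow> nat" where "tv b = (if b then 1 else 0)"

lemma tv_simps [simp]: "tv True = 1" "tv False = 0" "tv b = 0 \<longleftrightarrow> \<not> b" "tv b = tv c \<longleftrightarrow> b = c"
  "1 - tv b = tv (\<not> b)" "Suc 0 - tv b = tv (\<not> b)" "tv b * tv c = tv (b \<and> c)"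
  by (auto simp: tv_def)

lemma tv_if: "(if b then 1 else 0) = tv b"
  by (simp add: tv_def)

lemma tv_or: "(if tv b = 0 \<and> tv c = 0 then 0 else 1) = tv (b \<or> c)"
  by (simp add: tv_def)

lemma ev_all_below:
  assumes "\<And>x. ev (FJ c (cns (Suc x) e) (tv (P x)))"
  shows "ev (UJ c e v (tv (\<forall>x<v. P x)))"
proof (induction v)
  case 0
  have "ev (FJ c (cns 1 e) (tv (P 0)))" using assms[of 0] by simp
  then show ?case using evs(9) by simp
next
  case (Suc v)
  have "ev (UJ c e (Suc v) (tv (\<forall>x<v. P x) * tv (P v)))" by (rule evs(10)[OF Suc assms])
  moreover have "((\<forall>x<v. P x) \<and> P v) = (\<forall>x<Suc v. P x)" by (auto simp: less_Suc_eq)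
  ultimately show ?case by simp
qed

lemma good_lift: "good_trm t e \<Longrightarrow> good_trm (lift_trm 0 t) (cns 0 e)"
  by (auto simp: good_trm_def fv_lift_trm)

lemma fv_bounded_all: "fv (All (Imp (Less (Var 0) (lift_trm 0 t)) p)) = fv_trm t \<union> {n. Suc n \<in> fv p}"
  and fv_bounded_ex: "fv (Ex (And (Less (Var 0) (lift_trm 0 t)) p)) = fv_trm t \<union> {n. Suc n \<in> fv p}"
  by (auto simp: fv_lift_trm)

lemma good_bounded:
  assumes "\<forall>n\<in>fv_trm t \<union> {n. Suc n \<in> fv p}. lnth e n \<noteq> 0" "wf_trm Arith t" "bounded_fm p"
  shows "good_trm t e" "good_fm p (cns (Suc x) e)"
proof -
  show "good_trm t e" using assms by (simp add: good_trm_def)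
  have "lnth (cns (Suc x) e) n \<noteq> 0" if "n \<in> fv p" for n using assms that by (cases n) auto
  then show "good_fm p (cns (Suc x) e)" using assms by (simp add: good_fm_def)
qed

lemma sat_bounded_all:
  "sat e (All (Imp (Less (Var 0) (lift_trm 0 t)) p)) \<longleftrightarrow> (\<forall>x<evt e t. sat (case_nat x e) p)"
  by (auto simp: evt_lift)

lemma sat_bounded_ex:
  "sat e (Ex (And (Less (Var 0) (lift_trm 0 t)) p)) \<longleftrightarrow> (\<exists>x<evt e t. sat (case_nat x e) p)"
  by (auto simp: evt_lift)

lemma ev_fm: "bounded_fm p \<Longrightarrow> good_fm p e \<Longrightarrow> ev (FJ (code_fm p) e (tv (sat (env e) p)))"
proof (induction p arbitrary: e rule: bounded_fm.induct)
  case (1 s t)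
  have "good_trm s e" "good_trm t e" using 1 by (simp_all add: good_fm_def good_trm_def)
  from evs(4)[OF this[THEN ev_trm]] show ?case
    unfolding code_pr sat.simps by (simp only: tv_if)
next
  case (2 s t)
  have "good_trm s e" "good_trm t e" using 2 by (simp_all add: good_fm_def good_trm_def)
  from evs(5)[OF this[THEN ev_trm]] show ?case
    unfolding code_pr sat_Less by (simp only: tv_if)
next
  case (3 p)
  have "good_fm p e" using 3(1,3) by (simp add: good_fm_def)
  from evs(6)[OF 3(2)[OF this]] show ?case unfolding code_pr sat.simps by (simp only: tv_simps)
next
  case (4 p q)
  have "good_fm p e" "good_fm q e" using 4(1,2,5) by (simp_all add: good_fm_def)
  from evs(7)[OF 4(3)[OF this(1)] 4(4)[OF this(2)]] show ?case
    unfolding code_pr sat.simps by (simp only: tv_simps)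
next
  case (5 p q)
  have "good_fm p e" "good_fm q e" using 5(1,2,5) by (simp_all add: good_fm_def)
  from evs(8)[OF 5(3)[OF this(1)] 5(4)[OF this(2)]] show ?case
    unfolding code_pr sat.simps by (simp only: tv_or)
next
  case (6 t p)
  have f: "\<forall>n\<in>fv_trm t \<union> {n. Suc n \<in> fv p}. lnth e n \<noteq> 0"
    using 6(4) unfolding good_fm_def fv_bounded_all by (rule conjunct2)
  note g = good_bounded[OF f 6(1,2)]
  have "ev (FJ (code_fm p) (cns (Suc x) e) (tv (sat (case_nat x (env e)) p)))" for x
    using 6(3)[OF g(2)[of x]] by (simp only: env_cns)
  note u = ev_all_below[OF this, of "evt (env e) t"]
  have t: "ev (TJ (code_trm (lift_trm 0 t)) (cns 0 e) (evt (env e) t))"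
    using ev_trm[OF good_lift[OF g(1)]] by (simp only: env_cns evt_lift)
  show ?case using evs(11)[OF t u] unfolding sat_bounded_all code_pr .
next
  case (7 t p)
  have f: "\<forall>n\<in>fv_trm t \<union> {n. Suc n \<in> fv p}. lnth e n \<noteq> 0"
    using 7(4) unfolding good_fm_def fv_bounded_ex by (rule conjunct2)
  note g = good_bounded[OF f 7(1,2)]
  have "ev (FJ (pr 2 (code_fm p)) (cns (Suc x) e) (tv (\<not> sat (case_nat x (env e)) p)))" for x
    using evs(6)[OF 7(3)[OF g(2)[of x]]] by (simp only: env_cns tv_simps)
  note u = ev_all_below[OF this, of "evt (env e) t"]
  have t: "ev (TJ (code_trm (lift_trm 0 t)) (cns 0 e) (evt (env e) t))"
    using ev_trm[OF good_lift[OF g(1)]] by (simp only: env_cns evt_lift)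
  have "(\<not> (\<forall>x<evt (env e) t. \<not> sat (case_nat x (env e)) p)) = (\<exists>x<evt (env e) t. sat (case_nat x (env e)) p)"
    by blast
  then show ?case using evs(12)[OF t u] unfolding sat_bounded_ex code_pr tv_simps(5) by (simp only:)
qed

text \<open>The soundness invariant. It includes that the code belongs to a well-formed term or
  bounded formula, because \<open>phiB\<close> has to reject every other number. In the third case
  \<open>cns 1 e\<close> only expresses that variable 0 is not a hole.\<close>

definition meant :: "nat \<Rightarrow> bool" where
  "meant x \<longleftrightarrow>
     (\<exists>t e. x = TJ (code_trm t) e (evt (env e) t) \<and> good_trm t e) \<or>
     (\<exists>p e. x = FJ (code_fm p) e (tv (sat (env e) p)) \<and> good_fm p e) \<or>
     (\<exists>p e v. x = UJ (code_fm p) e v (tv (\<forall>x<v. sat (case_nat x (env e)) p)) \<and> good_fm p (cns 1 e))"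

lemma meantT: "meant (TJ c e v) \<longleftrightarrow> (\<exists>t. c = code_trm t \<and> v = evt (env e) t \<and> good_trm t e)"
  unfolding meant_def by auto

lemma meantF: "meant (FJ c e v) \<longleftrightarrow> (\<exists>p. c = code_fm p \<and> v = tv (sat (env e) p) \<and> good_fm p e)"
  unfolding meant_def by auto

lemma meantU: "meant (UJ c e v b) \<longleftrightarrow>
    (\<exists>p. c = code_fm p \<and> b = tv (\<forall>x<v. sat (case_nat x (env e)) p) \<and> good_fm p (cns 1 e))"
  unfolding meant_def by auto

lemma good_unlift:
  assumes "good_trm t (cns 0 e)"
  obtains s where "t = lift_trm 0 s" "good_trm s e"
proof -
  have "0 \<notin> fv_trm t" using assms by (auto simp: good_trm_def)
  then obtain s where s: "t = lift_trm 0 s" using unlift_trm by blast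
  have "good_trm s e" using assms unfolding s good_trm_def fv_lift_trm by auto
  with s show thesis by (rule that)
qed

lemma good_quant:
  assumes "good_trm t e" "good_fm p (cns 1 e)"
  shows "good_fm (All (Imp (Less (Var 0) (lift_trm 0 t)) p)) e"
    and "good_fm (Ex (And (Less (Var 0) (lift_trm 0 t)) p)) e"
proof -
  have f: "\<forall>n\<in>fv_trm t \<union> {n. Suc n \<in> fv p}. lnth e n \<noteq> 0"
    using assms by (auto simp: good_trm_def good_fm_def)
  have b: "wf_trm Arith t" "bounded_fm p" using assms by (simp_all add: good_trm_def good_fm_def)
  show "good_fm (All (Imp (Less (Var 0) (lift_trm 0 t)) p)) e"
    unfolding good_fm_def fv_bounded_all using f bounded_fm.intros(6)[OF b] by blast
  show "good_fm (Ex (And (Less (Var 0) (lift_trm 0 t)) p)) e"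
    unfolding good_fm_def fv_bounded_ex using f bounded_fm.intros(7)[OF b] by blast
qed

lemma code_fm_Neg: "code_fm p = pr 2 c \<Longrightarrow> \<exists>q. p = Neg q \<and> c = code_fm q"
  by (cases p) (simp_all add: pr_def)

lemma meantTI: "good_trm t e \<Longrightarrow> evt (env e) t = v \<Longrightarrow> meant (TJ (code_trm t) e v)"
  unfolding meantT by blast

lemma meantFI: "good_fm p e \<Longrightarrow> tv (sat (env e) p) = b \<Longrightarrow> meant (FJ (code_fm p) e b)"
  unfolding meantF by blast

lemma good_sub:
  "good_trm (Succ s) e \<longleftrightarrow> good_trm s e"
  "good_trm (Add s t) e \<longleftrightarrow> good_trm s e \<and> good_trm t e"
  "good_trm (Mul s t) e \<longleftrightarrow> good_trm s e \<and> good_trm t e"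
  "good_trm s e \<Longrightarrow> good_trm t e \<Longrightarrow> good_fm (Eq s t) e"
  "good_trm s e \<Longrightarrow> good_trm t e \<Longrightarrow> good_fm (Less s t) e"
  "good_fm p e \<Longrightarrow> good_fm (Neg p) e"
  "good_fm p e \<Longrightarrow> good_fm q e \<Longrightarrow> good_fm (And p q) e"
  "good_fm p e \<Longrightarrow> good_fm q e \<Longrightarrow> good_fm (Or p q) e"
  by (auto simp: good_trm_def good_fm_def intro: bounded_fm.intros simp del: wf_trm.simps)

lemma meant_TT:
  assumes "meant (TJ c e v)" "meant (TJ d e w)"
  shows "meant (TJ (pr 4 (cns c 0)) e (Suc v))"
    and "meant (TJ (pr 2 (cns c (cns d 0))) e (v + w))"
    and "meant (TJ (pr 3 (cns c (cns d 0))) e (v * w))"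
    and "meant (FJ (pr 0 (pr c d)) e (if v = w then 1 else 0))"
    and "meant (FJ (code_less c d) e (if v < w then 1 else 0))"
proof -
  obtain s t where st: "c = code_trm s" "v = evt (env e) s" "good_trm s e"
    "d = code_trm t" "w = evt (env e) t" "good_trm t e"
    using assms unfolding meantT by blast
  show "meant (TJ (pr 4 (cns c 0)) e (Suc v))"
    unfolding st(1) code_pr(3)[symmetric] by (rule meantTI) (simp_all add: good_sub st apf_def)
  show "meant (TJ (pr 2 (cns c (cns d 0))) e (v + w))"
    unfolding st(1,4) code_pr(4)[symmetric] by (rule meantTI) (simp_all add: good_sub st apf_def)
  show "meant (TJ (pr 3 (cns c (cns d 0))) e (v * w))"
    unfolding st(1,4) code_pr(5)[symmetric] by (rule meantTI) (simp_all add: good_sub st apf_def)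
  show "meant (FJ (pr 0 (pr c d)) e (if v = w then 1 else 0))"
    unfolding st(1,4) code_pr(6)[symmetric] by (rule meantFI) (simp_all add: good_sub st tv_def)
  show "meant (FJ (code_less c d) e (if v < w then 1 else 0))"
    unfolding st(1,4) code_pr(7)[symmetric] by (rule meantFI) (simp_all add: good_sub st tv_def)
qed

lemma meant_FF:
  assumes "meant (FJ c e v)" "meant (FJ d e w)"
  shows "meant (FJ (pr 2 c) e (1 - v))"
    and "meant (FJ (pr 3 (pr c d)) e (v * w))"
    and "meant (FJ (pr 4 (pr c d)) e (if v = 0 \<and> w = 0 then 0 else 1))"
proof -
  obtain p q where pq: "c = code_fm p" "v = tv (sat (env e) p)" "good_fm p e"
    "d = code_fm q" "w = tv (sat (env e) q)" "good_fm q e"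
    using assms unfolding meantF by blast
  show "meant (FJ (pr 2 c) e (1 - v))"
    unfolding pq(1) code_pr(8)[symmetric] by (rule meantFI) (simp_all add: good_sub pq)
  show "meant (FJ (pr 3 (pr c d)) e (v * w))"
    unfolding pq(1,4) code_pr(9)[symmetric] by (rule meantFI) (simp_all add: good_sub pq)
  show "meant (FJ (pr 4 (pr c d)) e (if v = 0 \<and> w = 0 then 0 else 1))"
    unfolding pq(1,4) code_pr(10)[symmetric] by (rule meantFI) (simp_all add: good_sub pq)
qed

lemma meant_U0: "meant (FJ c (cns 1 e) v) \<Longrightarrow> meant (UJ c e 0 1)"
  unfolding meantF meantU by auto

lemma meant_U1:
  assumes "meant (UJ c e v b)" "meant (FJ c (cns (Suc v) e) w)"
  shows "meant (UJ c e (Suc v) (b * w))"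
proof -
  obtain p where p: "c = code_fm p" "b = tv (\<forall>x<v. sat (case_nat x (env e)) p)" "good_fm p (cns 1 e)"
    using assms(1) unfolding meantU by blast
  obtain q where q: "c = code_fm q" "w = tv (sat (env (cns (Suc v) e)) q)"
    using assms(2) unfolding meantF by blast
  \<comment> \<open>The two premises share a code, and injectivity of the coding makes them speak of
    the same formula.\<close>
  have "p = q" using p(1) q(1) inj_code_fm by (metis injD)
  then have "b * w = tv (\<forall>x<Suc v. sat (case_nat x (env e)) p)"
    unfolding p(2) q(2) env_cns by (simp add: less_Suc_eq) (metis (full_types))
  with p show ?thesis unfolding meantU by blast
qed

lemma meant_quant:
  assumes "meant (TJ d (cns 0 e) v)"
  shows "meant (UJ c e v b) \<Longrightarrow> meant (FJ (pr 5 (pr 4 (pr (pr 2 (code_less (pr 0 0) d)) c))) e b)"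
    and "meant (UJ (pr 2 c) e v b) \<Longrightarrow> meant (FJ (pr 6 (pr 3 (pr (code_less (pr 0 0) d) c))) e (1 - b))"
proof -
  obtain t' where t': "d = code_trm t'" "v = evt (env (cns 0 e)) t'" "good_trm t' (cns 0 e)"
    using assms unfolding meantT by blast
  obtain t where t: "t' = lift_trm 0 t" "good_trm t e" using good_unlift[OF t'(3)] .
  have v: "v = evt (env e) t" using t'(2) unfolding t(1) env_cns evt_lift .
  {
    assume "meant (UJ c e v b)"
    then obtain p where p: "c = code_fm p" "b = tv (\<forall>x<v. sat (case_nat x (env e)) p)" "good_fm p (cns 1 e)"
      unfolding meantU by blast
    have "pr 5 (pr 4 (pr (pr 2 (code_less (pr 0 0) d)) c)) =
        code_fm (All (Imp (Less (Var 0) (lift_trm 0 t)) p))"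
      unfolding code_pr t' t p ..
    then show "meant (FJ (pr 5 (pr 4 (pr (pr 2 (code_less (pr 0 0) d)) c))) e b)"
      using meantFI[OF good_quant(1)[OF t(2) p(3)] refl] unfolding sat_bounded_all p(2) v by simp
  next
    assume "meant (UJ (pr 2 c) e v b)"
    then obtain p' where p': "pr 2 c = code_fm p'" "b = tv (\<forall>x<v. sat (case_nat x (env e)) p')"
        "good_fm p' (cns 1 e)"
      unfolding meantU by blast
    \<comment> \<open>The tag 2 shows that the universal judgement is about a negation, whose body
      becomes the body of the existential formula.\<close>
    obtain p where p: "p' = Neg p" "c = code_fm p" using code_fm_Neg[OF p'(1)[symmetric]] by blast
    have "bounded_fm p" using p'(3) unfolding p good_fm_def by (auto elim: bounded_fm.cases)
    then have g: "good_fm p (cns 1 e)" using p'(3) unfolding p good_fm_def by simp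
    have b: "1 - b = tv (\<exists>x<v. sat (case_nat x (env e)) p)" unfolding p'(2) p by simp
    have "pr 6 (pr 3 (pr (code_less (pr 0 0) d) c)) =
        code_fm (Ex (And (Less (Var 0) (lift_trm 0 t)) p))"
      unfolding code_pr t' t p ..
    then show "meant (FJ (pr 6 (pr 3 (pr (code_less (pr 0 0) d) c))) e (1 - b))"
      using meantFI[OF good_quant(2)[OF t(2) g] refl] unfolding sat_bounded_ex b v by simp
  }
qed

lemma meant_step: "meant y \<Longrightarrow> meant z \<Longrightarrow> ev_step x y z \<Longrightarrow> meant x"
  unfolding ev_step_def
  by (elim disjE exE conjE; hypsubst+;
      ((rule meant_TT meant_FF meant_U1 meant_quant; assumption) | (erule meant_U0)))

lemma ev_meant: "ev x \<Longrightarrow> meant x"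
  unfolding ev_def
proof (induction rule: der.induct)
  case (der_ax x)
  then show ?case unfolding ev_ax_def
  proof
    assume "\<exists>n e v. x = TJ (pr 0 n) e v \<and> lnth e n = Suc v"
    then obtain n e v where "x = TJ (code_trm (Var n)) e v" "lnth e n = Suc v"
      unfolding code_pr by blast
    then show ?thesis unfolding meantT by (auto simp: meantT good_trm_def env_def intro!: exI[of _ "Var n"])
  next
    assume "\<exists>e. x = TJ (pr 1 0) e 0"
    then obtain e where "x = TJ (code_trm Zero) e 0" unfolding code_pr by blast
    moreover have "good_trm Zero e" "evt (env e) Zero = 0"
      unfolding good_trm_def using wf_Zero by (auto simp: apf_def)
    ultimately show ?thesis using meantTI[of Zero e 0] by (simp only:)
  qed
next
  case (der_step y z x)
  then show ?case by (blast intro: meant_step)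
qed

text \<open>The environment \<open>cns 1 0\<close> gives variable 0 the value 0 and has holes
  elsewhere, so evaluation succeeds only if no other variable is free. The argument 0 serves as a
  test of well-formedness; which truth value results is left open.\<close>

definition phiB :: "nat \<Rightarrow> bool" where "phiB j \<longleftrightarrow> (\<exists>b. ev (FJ j (cns 1 0) b))"
definition phiF :: "nat \<Rightarrow> bool" where "phiF j \<longleftrightarrow> (\<exists>t. ev (FJ j (cns (Suc t) 0) 0))"

lemma ce_phiB: "ce phiB"
  unfolding phiB_def by (intro ce_intros ce_comp[OF ce_ev] prc_intros)

lemma ce_phiF: "ce phiF"
  unfolding phiF_def by (intro ce_intros ce_comp[OF ce_ev] prc_intros)

lemma good_fm_1: "good_fm p (cns (Suc t) 0) \<longleftrightarrow> bounded_fm p \<and> fv p \<subseteq> {0}"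
proof -
  have "lnth (cns (Suc t) 0) n \<noteq> 0 \<longleftrightarrow> n = 0" for n
    using lnth_ones[of 0] by (cases n) simp_all
  then show ?thesis unfolding good_fm_def by auto
qed

lemma env_1: "env (cns (Suc t) 0) = case_nat t (\<lambda>_. 0)"
proof -
  have "env 0 = (\<lambda>_. 0)" using lnth_ones[of 0] by (simp add: env_def fun_eq_iff)
  then show ?thesis by (simp add: env_cns)
qed

lemma phiB_code: "phiB (code_fm p) \<longleftrightarrow> bounded_fm p \<and> fv p \<subseteq> {0}"
proof
  assume "phiB (code_fm p)"
  then obtain b where "meant (FJ (code_fm p) (cns (Suc 0) 0) b)"
    unfolding phiB_def One_nat_def by (auto dest: ev_meant)
  then obtain q where "code_fm p = code_fm q" "good_fm q (cns (Suc 0) 0)"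
    using meantF[of "code_fm p" "cns (Suc 0) 0" b] by auto
  then show "bounded_fm p \<and> fv p \<subseteq> {0}" using inj_code_fm good_fm_1 by (metis injD)
next
  assume "bounded_fm p \<and> fv p \<subseteq> {0}"
  then have "good_fm p (cns (Suc 0) 0)" "bounded_fm p" by (simp_all add: good_fm_1)
  then show "phiB (code_fm p)" unfolding phiB_def One_nat_def using ev_fm[unfolded One_nat_def] by blast
qed

lemma phiB_ex: "phiB j \<Longrightarrow> \<exists>p. j = code_fm p"
  unfolding phiB_def using ev_meant meantF by blast

lemma phiF_phiB: "phiF j \<Longrightarrow> phiB j"
proof -
  assume "phiF j"
  then obtain t where "meant (FJ j (cns (Suc t) 0) 0)" unfolding phiF_def by (auto dest: ev_meant)
  then obtain p where "j = code_fm p" "good_fm p (cns (Suc t) 0)" using meantF by blast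
  then show "phiB j" using phiB_code good_fm_1 by blast
qed

lemma phiF_code:
  assumes "bounded_fm p" "fv p \<subseteq> {0}"
  shows "phiF (code_fm p) \<longleftrightarrow> (\<exists>t. \<not> sat (case_nat t (\<lambda>_. 0)) p)"
proof
  assume "phiF (code_fm p)"
  then obtain t where "meant (FJ (code_fm p) (cns (Suc t) 0) 0)" unfolding phiF_def by (auto dest: ev_meant)
  then obtain q where "code_fm p = code_fm q" "0 = tv (sat (env (cns (Suc t) 0)) q)" using meantF by blast
  moreover from this have "p = q" using inj_code_fm by (metis injD)
  ultimately show "\<exists>t. \<not> sat (case_nat t (\<lambda>_. 0)) p" unfolding env_1 by (metis tv_simps(3))
next
  assume "\<exists>t. \<not> sat (case_nat t (\<lambda>_. 0)) p"
  then obtain t where t: "\<not> sat (env (cns (Suc t) 0)) p" unfolding env_1 by blast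
  have "good_fm p (cns (Suc t) 0)" using assms by (simp add: good_fm_1)
  from ev_fm[OF assms(1) this] t show "phiF (code_fm p)" unfolding phiF_def by auto
qed

section \<open>Derivations and Robinson arithmetic\<close>

lemma wf_subst_trm: "wf_trm L s \<Longrightarrow> wf_trm L t \<Longrightarrow> wf_trm L (subst_trm k s t)"
  by (induction t) (auto simp: list_all_iff)

lemma wf_subst: "wf_trm L s \<Longrightarrow> wf_fm L p \<Longrightarrow> wf_fm L (subst k s p)"
  by (induction p arbitrary: k s) (auto simp: list_all_iff wf_subst_trm)

lemma wf_lift [simp]: "wf_fm L (lift k p) = wf_fm L p"
  by (induction p arbitrary: k) (auto simp: list_all_iff)

lemma derives_wf: "derives L S p \<Longrightarrow> wf_fm L p"
  by (induction rule: derives.induct) (simp_all add: wf_subst)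

lemma derives_mono: "derives L S p \<Longrightarrow> S \<subseteq> S' \<Longrightarrow> derives L S' p"
proof (induction arbitrary: S' rule: derives.induct)
  case (NegI p S q)
  then show ?case by (meson derives.NegI insert_mono)
next
  case (Classical p S q)
  then show ?case by (meson derives.Classical insert_mono)
next
  case (OrE S p q r)
  then show ?case by (meson derives.OrE insert_mono)
next
  case (AllI S p)
  then show ?case by (meson derives.AllI image_mono)
next
  case (ExE S p q)
  then show ?case by (meson derives.ExE image_mono insert_mono)
next
  case (EqE p S s t)
  show ?case by (rule derives.EqE[OF EqE(1) EqE.IH(1)[OF EqE.prems] EqE.IH(2)[OF EqE.prems]])
qed (auto intro: derives.intros)

lemma derives_insert: "derives L S p \<Longrightarrow> derives L (insert q S) p"
  by (erule derives_mono) (rule subset_insertI)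

lemma derives_self: "wf_fm L p \<Longrightarrow> derives L (insert p S) p"
  by (rule derives.Assm) simp_all

text \<open>Cut is not among the rules; eliminating \<open>Or q q\<close> with the same case twice
  supplies it.\<close>

lemma derives_cut: "derives L S q \<Longrightarrow> derives L (insert q S) p \<Longrightarrow> derives L S p"
  by (rule derives.OrE[of L S q q]) (auto intro: derives.OrI1 derives_wf)

lemma derives_cut_finite:
  assumes "finite R" "\<And>q. q \<in> R \<Longrightarrow> derives L S q" "derives L (R \<union> S) p"
  shows "derives L S p"
  using assms
proof (induction R)
  case (insert q R)
  have "derives L (R \<union> S) q" using insert.prems(1)[of q] by (auto intro: derives_mono)
  moreover have "derives L (insert q (R \<union> S)) p" using insert.prems(2) by simp
  ultimately have "derives L (R \<union> S) p" by (rule derives_cut)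
  then show ?case using insert by simp
qed simp

text \<open>Discharged assumptions are removed from the finite set and put back by
  \<open>insert\<close>. For the quantifier rules, a finite set of lifted assumptions is the lift of
  a finite set of assumptions.\<close>

lemma derives_compact: "derives L S p \<Longrightarrow> \<exists>R. finite R \<and> R \<subseteq> S \<and> derives L R p"
proof (induction rule: derives.induct)
  case (Assm p S)
  then show ?case by (intro exI[of _ "{p}"]) (auto intro: derives.Assm)
next
  case (NegI p S q)
  then obtain A B where A: "finite A" "A \<subseteq> insert p S" "derives L A q"
    and B: "finite B" "B \<subseteq> insert p S" "derives L B (Neg q)" by blast
  have "derives L (insert p ((A \<union> B) - {p})) q" "derives L (insert p ((A \<union> B) - {p})) (Neg q)"
    by (rule derives_mono[OF A(3)], blast, rule derives_mono[OF B(3)], blast)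
  then have "derives L ((A \<union> B) - {p}) (Neg p)" using NegI(1) by (blast intro: derives.NegI)
  then show ?case using A B by (intro exI[of _ "(A \<union> B) - {p}"]) auto
next
  case (Classical p S q)
  then obtain A B where A: "finite A" "A \<subseteq> insert (Neg p) S" "derives L A q"
    and B: "finite B" "B \<subseteq> insert (Neg p) S" "derives L B (Neg q)" by blast
  let ?C = "(A \<union> B) - {Neg p}"
  have "derives L (insert (Neg p) ?C) q" "derives L (insert (Neg p) ?C) (Neg q)"
    by (rule derives_mono[OF A(3)], blast, rule derives_mono[OF B(3)], blast)
  then have "derives L ?C p" using Classical(1) by (blast intro: derives.Classical)
  then show ?case using A B by (intro exI[of _ ?C]) auto
next
  case (AndI S p q)
  then obtain A B where A: "finite A" "A \<subseteq> S" "derives L A p"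
    and B: "finite B" "B \<subseteq> S" "derives L B q" by blast
  have "derives L (A \<union> B) (And p q)"
    by (rule derives.AndI; rule derives_mono, (rule A B)+, blast)
  then show ?case using A B by (intro exI[of _ "A \<union> B"]) auto
next
  case (OrE S p q r)
  then obtain A B C where A: "finite A" "A \<subseteq> S" "derives L A (Or p q)"
    and B: "finite B" "B \<subseteq> insert p S" "derives L B r"
    and C: "finite C" "C \<subseteq> insert q S" "derives L C r" by metis
  let ?D = "A \<union> (B - {p}) \<union> (C - {q})"
  have "derives L ?D (Or p q)" by (rule derives_mono[OF A(3)]) blast
  moreover have "derives L (insert p ?D) r" by (rule derives_mono[OF B(3)]) blast
  moreover have "derives L (insert q ?D) r" by (rule derives_mono[OF C(3)]) blast
  ultimately have "derives L ?D r" by (rule derives.OrE)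
  then show ?case using A B C by (intro exI[of _ ?D]) auto
next
  case (AllI S p)
  then obtain A where A: "finite A" "A \<subseteq> lift 0 ` S" "derives L A p" by blast
  then obtain B where "B \<subseteq> S" "finite B" "A = lift 0 ` B" by (meson finite_subset_image)
  then show ?case using A derives.AllI by blast
next
  case (ExE S p q)
  then obtain A B where A: "finite A" "A \<subseteq> S" "derives L A (Ex p)"
    and B: "finite B" "B \<subseteq> insert p (lift 0 ` S)" "derives L B (lift 0 q)" by blast
  have "finite (B - {p})" "B - {p} \<subseteq> lift 0 ` S" using B by auto
  then obtain C where C: "C \<subseteq> S" "finite C" "B - {p} = lift 0 ` C" by (meson finite_subset_image)
  have "derives L (A \<union> C) (Ex p)" by (rule derives_mono[OF A(3)]) blast
  moreover have "derives L (insert p (lift 0 ` (A \<union> C))) (lift 0 q)"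
    by (rule derives_mono[OF B(3)]) (use C in blast)
  ultimately have "derives L (A \<union> C) q" by (rule derives.ExE)
  then show ?case using A C by (intro exI[of _ "A \<union> C"]) auto
next
  case (EqE p S s t)
  then obtain A B where A: "finite A" "A \<subseteq> S" "derives L A (Eq s t)"
    and B: "finite B" "B \<subseteq> S" "derives L B (subst 0 s p)" by blast
  have "derives L (A \<union> B) (Eq s t)" by (rule derives_mono[OF A(3)]) blast
  moreover have "derives L (A \<union> B) (subst 0 s p)" by (rule derives_mono[OF B(3)]) blast
  ultimately have "derives L (A \<union> B) (subst 0 t p)" by (rule derives.EqE[OF EqE(1)])
  then show ?case using A B by (intro exI[of _ "A \<union> B"]) auto
next
  case (EqI t S)
  then show ?case by (intro exI[of _ "{}"]) (auto intro: derives.EqI)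
qed (meson derives.intros)+

text \<open>Compactness reduces an arbitrary \<open>R\<close> to a finite one, for which the cuts
  are made one by one.\<close>

lemma derives_cut_set:
  assumes "\<And>q. q \<in> R \<Longrightarrow> derives L S q" "derives L R p"
  shows "derives L S p"
proof -
  obtain A where A: "finite A" "A \<subseteq> R" "derives L A p" using derives_compact[OF assms(2)] by blast
  have "derives L (A \<union> S) p" by (rule derives_mono[OF A(3)]) blast
  then show ?thesis using derives_cut_finite[OF A(1)] assms(1) A(2) by blast
qed

lemma derives_exfalso:
  "derives L S p \<Longrightarrow> derives L S (Neg p) \<Longrightarrow> wf_fm L q \<Longrightarrow> derives L S q"
  by (rule derives.Classical[of L q S p]) (auto intro: derives_insert)

lemma derives_mp: "derives L S (Imp p q) \<Longrightarrow> derives L S p \<Longrightarrow> derives L S q"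
proof (rule derives.OrE)
  assume *: "derives L S (Imp p q)" and p: "derives L S p"
  have wf: "wf_fm L p" "wf_fm L q" using derives_wf[OF *] by simp_all
  show "derives L (insert (Neg p) S) q"
    by (rule derives_exfalso[OF derives_insert[OF p] derives_self]) (use wf in simp_all)
  show "derives L (insert q S) q" using wf by (intro derives_self)
qed

lemma derives_em:
  assumes "wf_fm L p"
  shows "derives L S (Or p (Neg p))"
proof -
  let ?e = "Or p (Neg p)"
  have "derives L (insert p (insert (Neg ?e) S)) ?e"
    by (rule derives.OrI1[OF derives_self]) (use assms in simp_all)
  moreover have "derives L (insert p (insert (Neg ?e) S)) (Neg ?e)"
    by (rule derives.Assm) (use assms in simp_all)
  ultimately have "derives L (insert (Neg ?e) S) (Neg p)" by (rule derives.NegI[OF assms])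
  then have "derives L (insert (Neg ?e) S) ?e" by (rule derives.OrI2[OF assms])
  moreover have "derives L (insert (Neg ?e) S) (Neg ?e)" by (rule derives_self) (use assms in simp)
  ultimately show ?thesis by (rule derives.Classical[rotated]) (use assms in simp)
qed

lemma derives_cases:
  "wf_fm L p \<Longrightarrow> derives L (insert p S) q \<Longrightarrow> derives L (insert (Neg p) S) q \<Longrightarrow> derives L S q"
  by (rule derives.OrE[OF derives_em])

lemma derives_ImpI: "wf_fm L p \<Longrightarrow> derives L (insert p S) q \<Longrightarrow> derives L S (Imp p q)"
proof (rule derives_cases[of L p])
  assume p: "wf_fm L p" and q: "derives L (insert p S) q"
  show "derives L (insert p S) (Imp p q)" by (rule derives.OrI2[OF _ q]) (simp add: p)
  show "derives L (insert (Neg p) S) (Imp p q)"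
    by (rule derives.OrI1[OF derives_self derives_wf[OF q]]) (simp add: p)
qed

lemma lift_trm_closed: "fv_trm t \<subseteq> {..<k} \<Longrightarrow> lift_trm k t = t"
  by (induction t) (auto simp: UN_subset_iff map_idI)

lemma lift_closed: "fv p \<subseteq> {..<k} \<Longrightarrow> lift k p = p"
proof (induction p arbitrary: k)
  case (Rel r ts)
  then have "lift_trm k t = t" if "t \<in> set ts" for t using that by (intro lift_trm_closed) auto
  then show ?case by (simp add: map_idI)
next
  case (All p)
  then have "fv p \<subseteq> {..<Suc k}" by (auto simp: subset_iff) (metis not0_implies_Suc not_less_eq zero_less_Suc)
  then show ?case using All.IH by simp
next
  case (Ex p)
  then have "fv p \<subseteq> {..<Suc k}" by (auto simp: subset_iff) (metis not0_implies_Suc not_less_eq zero_less_Suc)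
  then show ?case using Ex.IH by simp
qed (auto simp: lift_trm_closed)

lemma lift_sentence: "p \<in> sentences L \<Longrightarrow> lift 0 p = p"
  by (rule lift_closed) (simp add: sentences_def)

lemma subst_trm_Var: "fv_trm t \<subseteq> {..k} \<Longrightarrow> subst_trm k (Var k) t = t"
  by (induction t) (auto simp: UN_subset_iff map_idI)

text \<open>Passes between an open formula and its instance at its own variable, as required when
  \<open>AllE\<close>, \<open>ExI\<close> or \<open>EqE\<close> are applied under a
  quantifier.\<close>

lemma subst_Var: "fv p \<subseteq> {..k} \<Longrightarrow> subst k (Var k) p = p"
proof (induction p arbitrary: k)
  case (Rel r ts)
  then have "subst_trm k (Var k) t = t" if "t \<in> set ts" for t using that by (intro subst_trm_Var) auto
  then show ?case by (simp add: map_idI)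
next
  case (All p)
  then have "fv p \<subseteq> {..Suc k}" by (auto simp: subset_iff) (metis not0_implies_Suc Suc_le_mono le0)
  then show ?case using All.IH by simp
next
  case (Ex p)
  then have "fv p \<subseteq> {..Suc k}" by (auto simp: subset_iff) (metis not0_implies_Suc Suc_le_mono le0)
  then show ?case using Ex.IH by simp
qed (auto simp: subst_trm_Var)

lemma subst_lift_trm [simp]: "subst_trm k s (lift_trm k t) = t"
  by (induction t) (auto simp: map_idI)

lemma subst_lift_comm [simp]: "subst_trm (Suc k) (lift_trm 0 s) (lift_trm 0 t) = lift_trm 0 (subst_trm k s t)"
  by (induction t) auto

lemma derives_sym: "derives L S (Eq s t) \<Longrightarrow> derives L S (Eq t s)"
proof -
  assume *: "derives L S (Eq s t)"
  then have wf: "wf_trm L s" "wf_trm L t" using derives_wf by fastforce+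
  \<comment> \<open>Leibniz's rule for the formula \<open>x = s\<close> in the variable
    \<open>x\<close>; the lift protects \<open>s\<close> from the substitution.\<close>
  have "derives L S (subst 0 t (Eq (Var 0) (lift_trm 0 s)))"
    by (rule derives.EqE[OF _ *]) (use wf in \<open>simp_all add: derives.EqI\<close>)
  then show ?thesis by simp
qed

lemma derives_trans:
  assumes "derives L S (Eq s t)" "derives L S (Eq t u)"
  shows "derives L S (Eq s u)"
proof -
  have wf: "wf_trm L s" using derives_wf assms(1) by fastforce
  have "derives L S (subst 0 u (Eq (lift_trm 0 s) (Var 0)))"
    by (rule derives.EqE[OF _ assms(2)]) (use wf assms in simp_all)
  then show ?thesis by simp
qed

section \<open>Numerals and order in Robinson arithmetic\<close>

abbreviation provable :: "arith_fm set \<Rightarrow> arith_fm \<Rightarrow> bool" where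
  "provable \<equiv> derives Arith"

lemma provable_Succ: "provable S (Eq s t) \<Longrightarrow> provable S (Eq (Succ s) (Succ t))"
proof -
  assume *: "provable S (Eq s t)"
  then have wf: "wf_trm Arith s" using derives_wf by fastforce
  have "provable S (subst 0 t (Eq (Succ (lift_trm 0 s)) (Succ (Var 0))))"
    by (rule derives.EqE[OF _ *]) (use wf in \<open>simp_all add: derives.EqI del: wf_trm.simps(2)\<close>)
  then show ?thesis by simp
qed

lemma provable_op:
  assumes f: "f = FAdd \<or> f = FMul" and "provable S (Eq s s')" "provable S (Eq t t')"
  shows "provable S (Eq (Fn f [s, t]) (Fn f [s', t']))"
proof -
  have wf: "wf_trm Arith s" "wf_trm Arith s'" "wf_trm Arith t" using derives_wf assms(2,3) by fastforce+
  have wf2: "wf_trm Arith (Fn f [a, b]) \<longleftrightarrow> wf_trm Arith a \<and> wf_trm Arith b" for a b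
    using f by (auto simp del: wf_trm.simps(2))
  have "provable S (subst 0 s' (Eq (Fn f [lift_trm 0 s, lift_trm 0 t]) (Fn f [Var 0, lift_trm 0 t])))"
    by (rule derives.EqE[OF _ assms(2)]) (use wf in \<open>simp_all add: derives.EqI wf2 del: wf_trm.simps(2)\<close>)
  moreover have "provable S (subst 0 t' (Eq (Fn f [lift_trm 0 s', lift_trm 0 t]) (Fn f [lift_trm 0 s', Var 0])))"
    by (rule derives.EqE[OF _ assms(3)]) (use wf in \<open>simp_all add: derives.EqI wf2 del: wf_trm.simps(2)\<close>)
  ultimately show ?thesis by (auto intro: derives_trans)
qed

lemma provable_Less:
  assumes "provable S (Less s t)" "provable S (Eq t u)"
  shows "provable S (Less s u)"
proof -
  have wf: "wf_trm Arith s" using derives_wf[OF assms(1)] by simp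
  have "provable S (subst 0 u (Less (lift_trm 0 s) (Var 0)))"
    by (rule derives.EqE[OF _ assms(2)]) (use wf assms in \<open>simp_all del: wf_fm.simps(2)\<close>)
  then show ?thesis by simp
qed

lemma Q_wf: "p \<in> Q \<Longrightarrow> wf_fm Arith p"
  unfolding Q_def by (auto simp del: wf_trm.simps(2) wf_fm.simps(2) simp: wf_trm.simps(1))

lemma Q_fv: "p \<in> Q \<Longrightarrow> fv p = {}"
  unfolding Q_def by auto

lemma Q_sentences: "Q \<subseteq> sentences Arith"
  using Q_wf Q_fv by (auto simp: sentences_def)

lemma lift_Q [simp]: "lift 0 ` Q = Q"
  using Q_sentences lift_sentence by (force simp: image_iff)

lemma Q_ax: "Q \<subseteq> S \<Longrightarrow> p \<in> Q \<Longrightarrow> provable S p"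
  by (rule derives.Assm) (auto simp: Q_wf)

lemma All2E:
  assumes "provable S (All (All p))" "wf_trm Arith s" "wf_trm Arith t"
  shows "provable S (subst 0 t (subst (Suc 0) (lift_trm 0 s) p))"
  using derives.AllE[OF derives.AllE[OF assms(1,2), unfolded subst.simps] assms(3)] .

lemma Q1: "Q \<subseteq> S \<Longrightarrow> wf_trm Arith t \<Longrightarrow> provable S (Neg (Eq (Succ t) Zero))"
proof -
  assume *: "Q \<subseteq> S" "wf_trm Arith t"
  have "provable S (All (Neg (Eq (Succ (Var 0)) Zero)))" by (rule Q_ax[OF *(1)]) (simp add: Q_def)
  from derives.AllE[OF this *(2)] show ?thesis by simp
qed

lemma Q2: "Q \<subseteq> S \<Longrightarrow> provable S (Eq (Succ s) (Succ t)) \<Longrightarrow> provable S (Eq s t)"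
proof -
  assume *: "Q \<subseteq> S" "provable S (Eq (Succ s) (Succ t))"
  then have wf: "wf_trm Arith s" "wf_trm Arith t" using derives_wf by fastforce+
  have "provable S (All (All (Imp (Eq (Succ (Var 1)) (Succ (Var 0))) (Eq (Var 1) (Var 0)))))"
    by (rule Q_ax[OF *(1)]) (simp add: Q_def)
  from All2E[OF this wf] *(2) show ?thesis by (auto intro: derives_mp)
qed

lemma Q3: "Q \<subseteq> S \<Longrightarrow> provable S (Neg (Eq t Zero)) \<Longrightarrow> provable S (Ex (Eq (lift_trm 0 t) (Succ (Var 0))))"
proof -
  assume *: "Q \<subseteq> S" "provable S (Neg (Eq t Zero))"
  then have wf: "wf_trm Arith t" using derives_wf by fastforce
  have "provable S (All (Imp (Neg (Eq (Var 0) Zero)) (Ex (Eq (Var 1) (Succ (Var 0))))))"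
    by (rule Q_ax[OF *(1)]) (simp add: Q_def)
  from derives.AllE[OF this wf] *(2) show ?thesis by (auto intro: derives_mp)
qed

lemma Q4: "Q \<subseteq> S \<Longrightarrow> wf_trm Arith t \<Longrightarrow> provable S (Eq (Add t Zero) t)"
proof -
  assume *: "Q \<subseteq> S" "wf_trm Arith t"
  have "provable S (All (Eq (Add (Var 0) Zero) (Var 0)))" by (rule Q_ax[OF *(1)]) (simp add: Q_def)
  from derives.AllE[OF this *(2)] show ?thesis by simp
qed

lemma Q5: "Q \<subseteq> S \<Longrightarrow> wf_trm Arith s \<Longrightarrow> wf_trm Arith t \<Longrightarrow>
  provable S (Eq (Add s (Succ t)) (Succ (Add s t)))"
proof -
  assume *: "Q \<subseteq> S" "wf_trm Arith s" "wf_trm Arith t"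
  have "provable S (All (All (Eq (Add (Var 1) (Succ (Var 0))) (Succ (Add (Var 1) (Var 0))))))"
    by (rule Q_ax[OF *(1)]) (simp add: Q_def)
  from All2E[OF this *(2,3)] show ?thesis by simp
qed

lemma Q6: "Q \<subseteq> S \<Longrightarrow> wf_trm Arith t \<Longrightarrow> provable S (Eq (Mul t Zero) Zero)"
proof -
  assume *: "Q \<subseteq> S" "wf_trm Arith t"
  have "provable S (All (Eq (Mul (Var 0) Zero) Zero))" by (rule Q_ax[OF *(1)]) (simp add: Q_def)
  from derives.AllE[OF this *(2)] show ?thesis by simp
qed

lemma Q7: "Q \<subseteq> S \<Longrightarrow> wf_trm Arith s \<Longrightarrow> wf_trm Arith t \<Longrightarrow>
  provable S (Eq (Mul s (Succ t)) (Add (Mul s t) s))"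
proof -
  assume *: "Q \<subseteq> S" "wf_trm Arith s" "wf_trm Arith t"
  have "provable S (All (All (Eq (Mul (Var 1) (Succ (Var 0))) (Add (Mul (Var 1) (Var 0)) (Var 1)))))"
    by (rule Q_ax[OF *(1)]) (simp add: Q_def)
  from All2E[OF this *(2,3)] show ?thesis by simp
qed

lemma Q8:
  assumes "Q \<subseteq> S" "wf_trm Arith s" "wf_trm Arith t"
  shows "provable S (Iff (Less s t) (Ex (Eq (Add (Succ (Var 0)) (lift_trm 0 s)) (lift_trm 0 t))))"
proof -
  have "provable S (All (All (Iff (Less (Var 1) (Var 0)) (Ex (Eq (Add (Succ (Var 0)) (Var 2)) (Var 1))))))"
    by (rule Q_ax[OF assms(1)]) (simp add: Q_def)
  from All2E[OF this assms(2,3)] show ?thesis by (simp add: numeral_2_eq_2)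
qed


lemma wf_numeral [simp]: "wf_trm Arith (numeral_trm n)"
  by (induction n) (simp_all del: wf_trm.simps(2))

lemma fv_numeral [simp]: "fv_trm (numeral_trm n) = {}"
  by (induction n) simp_all

lemma lift_numeral [simp]: "lift_trm k (numeral_trm n) = numeral_trm n"
  by (induction n) simp_all

lemma subst_numeral [simp]: "subst_trm k s (numeral_trm n) = numeral_trm n"
  by (induction n) simp_all

lemma evt_numeral [simp]: "evt e (numeral_trm n) = n"
  by (induction n) (simp_all add: apf_def)

lemma provable_add: "Q \<subseteq> S \<Longrightarrow> provable S (Eq (Add (numeral_trm m) (numeral_trm n)) (numeral_trm (m + n)))"
proof (induction n)
  case 0
  then show ?case using Q4[of S "numeral_trm m"] by simp
next
  case (Suc n)
  have "provable S (Eq (Succ (Add (numeral_trm m) (numeral_trm n))) (Succ (numeral_trm (m + n))))"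
    using Suc by (intro provable_Succ) simp
  with Q5[OF Suc.prems wf_numeral wf_numeral] show ?case by (auto intro: derives_trans)
qed

lemma provable_mul: "Q \<subseteq> S \<Longrightarrow> provable S (Eq (Mul (numeral_trm m) (numeral_trm n)) (numeral_trm (m * n)))"
proof (induction n)
  case 0
  then show ?case using Q6[of S "numeral_trm m"] by simp
next
  case (Suc n)
  have "provable S (Eq (Add (Mul (numeral_trm m) (numeral_trm n)) (numeral_trm m))
      (Add (numeral_trm (m * n)) (numeral_trm m)))"
    using Suc by (intro provable_op derives.EqI) simp_all
  also note provable_add[OF Suc.prems]
  finally (derives_trans) have "provable S (Eq (Add (Mul (numeral_trm m) (numeral_trm n)) (numeral_trm m))
      (numeral_trm (m * n + m)))" .
  with Q7[OF Suc.prems wf_numeral wf_numeral] have "provable S (Eq (Mul (numeral_trm m) (Succ (numeral_trm n)))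
      (numeral_trm (m * n + m)))"
    by (rule derives_trans)
  then show ?case by (simp add: add.commute)
qed

lemma provable_evt:
  "Q \<subseteq> S \<Longrightarrow> wf_trm Arith t \<Longrightarrow> fv_trm t = {} \<Longrightarrow> provable S (Eq t (numeral_trm (evt e t)))"
proof (induction t)
  case (Fn f ts)
  have cl: "fv_trm t = {}" if "t \<in> set ts" for t using Fn.prems(3) that by auto
  from Fn.prems(2) show ?case
  proof (cases rule: wf_Fn_cases)
    case 1
    then show ?thesis using derives.EqI[of Arith Zero S] by (simp add: apf_def del: wf_trm.simps(2))
  next
    case (2 a b)
    then have "provable S (Eq a (numeral_trm (evt e a)))" "provable S (Eq b (numeral_trm (evt e b)))"
      using Fn cl by simp_all
    then have "provable S (Eq (Add a b) (Add (numeral_trm (evt e a)) (numeral_trm (evt e b))))"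
      by (intro provable_op) simp_all
    from derives_trans[OF this provable_add[OF Fn.prems(1)]] show ?thesis using 2 by (simp add: apf_def)
  next
    case (3 a b)
    then have "provable S (Eq a (numeral_trm (evt e a)))" "provable S (Eq b (numeral_trm (evt e b)))"
      using Fn cl by simp_all
    then have "provable S (Eq (Mul a b) (Mul (numeral_trm (evt e a)) (numeral_trm (evt e b))))"
      by (intro provable_op) simp_all
    from derives_trans[OF this provable_mul[OF Fn.prems(1)]] show ?thesis using 3 by (simp add: apf_def)
  next
    case (4 a)
    then have "provable S (Eq a (numeral_trm (evt e a)))" using Fn cl by simp
    from provable_Succ[OF this] show ?thesis using 4 by (simp add: apf_def)
  qed
qed simp

text \<open>The language has no constant for absurdity, so a contradiction is expressed as the
  provability of every well-formed formula.\<close>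

lemma provable_Succ_neq_Zero:
  "Q \<subseteq> S \<Longrightarrow> provable S (Eq (Succ t) Zero) \<Longrightarrow> wf_fm Arith p \<Longrightarrow> provable S p"
proof -
  assume *: "Q \<subseteq> S" "provable S (Eq (Succ t) Zero)" "wf_fm Arith p"
  then have "wf_trm Arith t" using derives_wf by fastforce
  from derives_exfalso[OF *(2) Q1[OF *(1) this] *(3)] show "provable S p" .
qed

lemma provable_num_neq:
  "Q \<subseteq> S \<Longrightarrow> m \<noteq> n \<Longrightarrow> provable S (Eq (numeral_trm m) (numeral_trm n)) \<Longrightarrow> wf_fm Arith p \<Longrightarrow> provable S p"
proof (induction m arbitrary: n)
  case 0
  then obtain k where "n = Suc k" by (cases n) auto
  then show ?case using provable_Succ_neq_Zero[OF 0(1) derives_sym] 0 by simp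
next
  case (Suc m)
  show ?case
  proof (cases n)
    case 0
    then show ?thesis using provable_Succ_neq_Zero[OF Suc(2)] Suc by simp
  next
    case (Suc k)
    then have "provable S (Eq (numeral_trm m) (numeral_trm k))" using Q2[OF Suc.prems(1)] Suc.prems by simp
    then show ?thesis using Suc.IH[of k] Suc.prems Suc by simp
  qed
qed

lemma provable_num_less:
  assumes "Q \<subseteq> S" "m < n"
  shows "provable S (Less (numeral_trm m) (numeral_trm n))"
proof -
  have "provable S (Eq (Add (numeral_trm (Suc (n - Suc m))) (numeral_trm m)) (numeral_trm (Suc (n - Suc m) + m)))"
    by (rule provable_add[OF assms(1)])
  moreover have "Suc (n - Suc m) + m = n" using assms(2) by simp
  ultimately have "provable S (subst 0 (numeral_trm (n - Suc m)) (Eq (Add (Succ (Var 0)) (numeral_trm m)) (numeral_trm n)))"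
    by simp
  then have "provable S (Ex (Eq (Add (Succ (Var 0)) (numeral_trm m)) (numeral_trm n)))"
    by (intro derives.ExI[of Arith _ "numeral_trm (n - Suc m)"]) (simp_all del: wf_trm.simps(2))
  then show ?thesis
    using derives.AndE2[OF Q8[OF assms(1) wf_numeral wf_numeral]] by (auto intro: derives_mp)
qed

text \<open>The disjunction of \<open>t = k\<close> for all \<open>k < n\<close>; the refutable
  \<open>Neg (Eq t t)\<close> stands for the empty disjunction.\<close>

primrec below :: "nat \<Rightarrow> arith_trm \<Rightarrow> arith_fm" where
  "below 0 t = Neg (Eq t t)"
| "below (Suc n) t = Or (below n t) (Eq t (numeral_trm n))"

lemma wf_below [simp]: "wf_fm Arith (below n t) \<longleftrightarrow> wf_trm Arith t"
  by (induction n) auto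

lemma lift_below [simp]: "lift k (below n t) = below n (lift_trm k t)"
  by (induction n) auto

lemma belowE:
  "provable S (below n t) \<Longrightarrow> (\<And>k. k < n \<Longrightarrow> provable (insert (Eq t (numeral_trm k)) S) p) \<Longrightarrow>
    wf_fm Arith p \<Longrightarrow> provable S p"
proof (induction n arbitrary: S)
  case 0
  then have "wf_trm Arith t" using derives_wf by fastforce
  then show ?case using derives_exfalso[OF derives.EqI, of Arith t S p] 0 by simp
next
  case (Suc n)
  have "provable S (Or (below n t) (Eq t (numeral_trm n)))" using Suc.prems by simp
  then show ?case
  proof (rule derives.OrE)
    have wf: "wf_fm Arith (below n t)" using derives_wf[OF Suc.prems(1)] by simp
    show "provable (insert (below n t) S) p"
    proof (rule Suc.IH[OF derives_self[OF wf] _ Suc.prems(3)])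
      fix k
      assume "k < n"
      then have "provable (insert (Eq t (numeral_trm k)) S) p" using Suc.prems(2)[of k] by simp
      then show "provable (insert (Eq t (numeral_trm k)) (insert (below n t) S)) p"
        by (rule derives_mono) blast
    qed
    show "provable (insert (Eq t (numeral_trm n)) S) p" using Suc.prems(2)[of n] by simp
  qed
qed

lemma belowI: "provable S (Eq t (numeral_trm k)) \<Longrightarrow> k < n \<Longrightarrow> provable S (below n t)"
proof (induction n)
  case (Suc n)
  have wf: "wf_trm Arith t" using derives_wf[OF Suc.prems(1)] by simp
  show ?case
  proof (cases "k = n")
    case True
    then show ?thesis using Suc.prems(1) wf by (auto intro: derives.OrI2)
  next
    case False
    then have "provable S (below n t)" using Suc by simp
    then show ?thesis using wf by (auto intro: derives.OrI1)
  qed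
qed simp

text \<open>From \<open>t < n\<close> the last axiom gives \<open>z\<close> with
  \<open>s(z) + t = n\<close>. If \<open>t = 0\<close>, then \<open>n\<close> is a successor and
  \<open>t = 0\<close> is one of the alternatives. Otherwise \<open>t = s(u)\<close> by the third
  axiom, so \<open>s(z) + u = n - 1\<close> and \<open>u < n - 1\<close>, and the hypothesis applies
  to \<open>u\<close>. It is required for all \<open>S\<close> and \<open>t\<close> because
  \<open>u\<close> is a fresh variable in an extended context.\<close>

lemma Less_below_step:
  assumes S: "Q \<subseteq> S" and less: "provable S (Less t (numeral_trm n))"
    and IH: "\<And>S t m. n = Suc m \<Longrightarrow> Q \<subseteq> S \<Longrightarrow> provable S (Less t (numeral_trm m)) \<Longrightarrow> provable S (below m t)"
  shows "provable S (below n t)"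
proof -
  have wf: "wf_trm Arith t" using derives_wf[OF less] by simp
  have "provable S (Imp (Less t (numeral_trm n)) (Ex (Eq (Add (Succ (Var 0)) (lift_trm 0 t)) (numeral_trm n))))"
    using derives.AndE1[OF Q8[OF S wf wf_numeral]] by simp
  then have ex: "provable S (Ex (Eq (Add (Succ (Var 0)) (lift_trm 0 t)) (numeral_trm n)))"
    using less by (rule derives_mp)
  \<comment> \<open>\<open>t\<close> below one fresh variable, the witness \<open>z\<close>, and
    below two, \<open>z\<close> and the predecessor \<open>u\<close>. In the inner context
    \<open>z\<close> is \<open>Var 1\<close> and \<open>u\<close> is \<open>Var 0\<close>.\<close>
  define t1 where "t1 = lift_trm 0 t"
  define t2 where "t2 = lift_trm 0 t1"
  have wf1: "wf_trm Arith t1" "wf_trm Arith t2" by (simp_all add: t1_def t2_def wf)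
  define h :: arith_fm where "h = Eq (Add (Succ (Var 0)) t1) (numeral_trm n)"
  define S1 where "S1 = insert h (lift 0 ` S)"
  have wfh: "wf_fm Arith h" by (simp add: h_def wf1 del: wf_trm.simps(2))
  have S1: "Q \<subseteq> S1" using image_mono[OF S, of "lift 0"] by (auto simp: S1_def)
  have h1: "provable S1 h" unfolding S1_def by (rule derives_self[OF wfh])
  have "provable S1 (below n t1)"
  proof (rule derives_cases[of Arith "Eq t1 Zero"])
    show "wf_fm Arith (Eq t1 Zero)" by (simp add: wf1 del: wf_trm.simps(2))
    define S2 where "S2 = insert (Eq t1 Zero) S1"
    have S2: "Q \<subseteq> S2" using S1 by (auto simp: S2_def)
    have z: "provable S2 (Eq t1 Zero)"
      unfolding S2_def by (rule derives_self) (simp add: wf1 del: wf_trm.simps(2))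
    show "provable (insert (Eq t1 Zero) S1) (below n t1)" unfolding S2_def[symmetric]
    proof (cases n)
      case 0
      have "provable S2 (Eq (Add (Succ (Var 0)) Zero) (Add (Succ (Var 0)) t1))"
        by (intro provable_op derives.EqI derives_sym[OF z]) (simp_all del: wf_trm.simps(2))
      moreover have "provable S2 (Eq (Add (Succ (Var 0)) t1) Zero)"
        using derives_insert[OF h1, of "Eq t1 Zero"] 0 unfolding S2_def[symmetric] by (simp add: h_def)
      ultimately have "provable S2 (Eq (Add (Succ (Var 0)) Zero) Zero)" by (rule derives_trans)
      moreover have "provable S2 (Eq (Add (Succ (Var 0)) Zero) (Succ (Var 0)))"
        by (rule Q4[OF S2]) (simp del: wf_trm.simps(2))
      ultimately have "provable S2 (Eq (Succ (Var 0)) Zero)" by (blast intro: derives_trans derives_sym)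
      then show "provable S2 (below n t1)"
        by (rule provable_Succ_neq_Zero[OF S2]) (simp add: wf1)
    next
      case (Suc m)
      show "provable S2 (below n t1)" by (rule belowI[of _ _ 0]) (simp_all add: z Suc)
    qed
  next
    define S2 where "S2 = insert (Neg (Eq t1 Zero)) S1"
    have S2: "Q \<subseteq> S2" using S1 by (auto simp: S2_def)
    have "provable S2 (Neg (Eq t1 Zero))"
      unfolding S2_def by (rule derives_self) (simp add: wf1 del: wf_trm.simps(2))
    then have ex2: "provable S2 (Ex (Eq t2 (Succ (Var 0))))" unfolding t2_def by (rule Q3[OF S2])
    define S3 where "S3 = insert (Eq t2 (Succ (Var 0))) (lift 0 ` S2)"
    have S3: "Q \<subseteq> S3" using image_mono[OF S2, of "lift 0"] by (auto simp: S3_def)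
    have e: "provable S3 (Eq t2 (Succ (Var 0)))"
      unfolding S3_def by (rule derives_self) (simp add: wf1 del: wf_trm.simps(2))
    have "provable S3 (Eq (Add (Succ (Var 1)) t2) (numeral_trm n))"
    proof (rule derives.Assm)
      have "h \<in> S2" by (simp add: S1_def S2_def)
      then have "lift 0 h \<in> S3" unfolding S3_def by blast
      then show "Eq (Add (Succ (Var 1)) t2) (numeral_trm n) \<in> S3" by (simp add: h_def t2_def)
      show "wf_fm Arith (Eq (Add (Succ (Var 1)) t2) (numeral_trm n))"
        by (simp add: wf1 del: wf_trm.simps(2))
    qed
    moreover have "provable S3 (Eq (Add (Succ (Var 1)) (Succ (Var 0))) (Add (Succ (Var 1)) t2))"
      by (intro provable_op derives.EqI derives_sym[OF e]) (simp_all del: wf_trm.simps(2))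
    ultimately have "provable S3 (Eq (Add (Succ (Var 1)) (Succ (Var 0))) (numeral_trm n))"
      by (blast intro: derives_trans)
    moreover have "provable S3 (Eq (Add (Succ (Var 1)) (Succ (Var 0))) (Succ (Add (Succ (Var 1)) (Var 0))))"
      by (rule Q5[OF S3]) (simp_all del: wf_trm.simps(2))
    ultimately have s: "provable S3 (Eq (Succ (Add (Succ (Var 1)) (Var 0))) (numeral_trm n))"
      by (blast intro: derives_trans derives_sym)
    have "provable S3 (below n t2)"
    proof (cases n)
      case 0
      then have "provable S3 (Eq (Succ (Add (Succ (Var 1)) (Var 0))) Zero)" using s by simp
      then show ?thesis by (rule provable_Succ_neq_Zero[OF S3]) (simp add: wf1)
    next
      case (Suc m)
      have "provable S3 (Eq (Add (Succ (Var 1)) (Var 0)) (numeral_trm m))"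
        by (rule Q2[OF S3]) (use s Suc in simp)
      \<comment> \<open>With one successor cancelled, the old witness \<open>z\<close>, now
        \<open>Var 1\<close>, also witnesses \<open>u < m\<close>.\<close>
      then have "provable S3 (subst 0 (Var 1) (Eq (Add (Succ (Var 0)) (Var 1)) (numeral_trm m)))" by simp
      then have "provable S3 (Ex (Eq (Add (Succ (Var 0)) (Var 1)) (numeral_trm m)))"
        by (intro derives.ExI[of Arith _ "Var 1"]) (simp_all del: wf_trm.simps(2))
      moreover have "provable S3 (Imp (Ex (Eq (Add (Succ (Var 0)) (Var 1)) (numeral_trm m))) (Less (Var 0) (numeral_trm m)))"
        using derives.AndE2[OF Q8[OF S3, of "Var 0" "numeral_trm m"]] by simp
      ultimately have "provable S3 (Less (Var 0) (numeral_trm m))" by (blast intro: derives_mp)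
      then have "provable S3 (below m (Var 0))" by (rule IH[OF Suc S3])
      then show ?thesis
      proof (rule belowE)
        fix k
        assume k: "k < m"
        let ?S4 = "insert (Eq (Var 0) (numeral_trm k)) S3"
        have "provable ?S4 (Eq (Succ (Var 0)) (Succ (numeral_trm k)))"
          by (intro provable_Succ derives_self) simp
        with derives_insert[OF e] have "provable ?S4 (Eq t2 (Succ (numeral_trm k)))" by (rule derives_trans)
        then show "provable ?S4 (below n t2)" using k Suc by (intro belowI[of _ _ "Suc k"]) simp_all
      qed (simp add: wf1)
    qed
    then have "provable S3 (lift 0 (below n t1))" by (simp add: t2_def)
    then show "provable (insert (Neg (Eq t1 Zero)) S1) (below n t1)"
      using ex2 unfolding S3_def S2_def[symmetric] by (blast intro: derives.ExE)
  qed
  then have "provable S1 (lift 0 (below n t))" by (simp add: t1_def)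
  then show ?thesis using ex unfolding S1_def h_def t1_def by (blast intro: derives.ExE)
qed

lemma Less_below:
  "Q \<subseteq> S \<Longrightarrow> provable S (Less t (numeral_trm n)) \<Longrightarrow> provable S (below n t)"
proof (induction n arbitrary: S t)
  case 0
  then show ?case by (rule Less_below_step) simp
next
  case (Suc n)
  show ?case by (rule Less_below_step[OF Suc.prems]) (use Suc.IH in simp)
qed

section \<open>Robinson arithmetic decides bounded sentences\<close>

lemma fv_subst_trm: "fv_trm s = {} \<Longrightarrow> fv_trm t \<subseteq> {..<Suc k} \<Longrightarrow> fv_trm (subst_trm k s t) \<subseteq> {..<k}"
  by (induction t) (auto simp: less_Suc_eq)

lemma fv_under: "{n. Suc n \<in> A} \<subseteq> {..<k} \<Longrightarrow> A \<subseteq> {..<Suc k}"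
proof
  fix x
  assume "{n. Suc n \<in> A} \<subseteq> {..<k}" "x \<in> A"
  then show "x \<in> {..<Suc k}" by (cases x) auto
qed

lemma fv_subst:
  "fv_trm s = {} \<Longrightarrow> fv p \<subseteq> {..<Suc k} \<Longrightarrow> fv (subst k s p) \<subseteq> {..<k}"
proof (induction p arbitrary: k s)
  case (Rel r ts)
  have "fv_trm (subst_trm k s t) \<subseteq> {..<k}" if "t \<in> set ts" for t
    by (rule fv_subst_trm) (use Rel that in auto)
  then show ?case by auto
next
  case (All p)
  have "fv (subst (Suc k) (lift_trm 0 s) p) \<subseteq> {..<Suc k}"
    by (rule All.IH) (use All.prems fv_under[of "fv p" "Suc k"] in \<open>simp_all add: fv_lift_trm\<close>)
  then show ?case by auto
next
  case (Ex p)
  have "fv (subst (Suc k) (lift_trm 0 s) p) \<subseteq> {..<Suc k}"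
    by (rule Ex.IH) (use Ex.prems fv_under[of "fv p" "Suc k"] in \<open>simp_all add: fv_lift_trm\<close>)
  then show ?case by auto
next
  case (Eq a b)
  then show ?case using fv_subst_trm[of s a k] fv_subst_trm[of s b k] by simp
qed auto

lemma bounded_subst: "bounded_fm p \<Longrightarrow> wf_trm Arith s \<Longrightarrow> bounded_fm (subst k s p)"
proof (induction arbitrary: k s rule: bounded_fm.induct)
  case (6 t p)
  then have "bounded_fm (All (Imp (Less (Var 0) (lift_trm 0 (subst_trm k s t))) (subst (Suc k) (lift_trm 0 s) p)))"
    by (intro bounded_fm.intros wf_subst_trm) simp_all
  then show ?case by simp
next
  case (7 t p)
  then have "bounded_fm (Ex (And (Less (Var 0) (lift_trm 0 (subst_trm k s t))) (subst (Suc k) (lift_trm 0 s) p)))"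
    by (intro bounded_fm.intros wf_subst_trm) simp_all
  then show ?case by simp
qed (auto intro: bounded_fm.intros wf_subst_trm)

lemma bounded_wf: "bounded_fm p \<Longrightarrow> wf_fm Arith p"
  by (induction rule: bounded_fm.induct) (simp_all add: wf_Less del: wf_fm.simps(2))

text \<open>The environment with \<open>m\<close> inserted at place \<open>k\<close>: the semantic
  counterpart of substituting a numeral for variable \<open>k\<close> and closing the gap.\<close>

definition ins :: "nat \<Rightarrow> nat \<Rightarrow> (nat \<Rightarrow> nat) \<Rightarrow> nat \<Rightarrow> nat" where
  "ins k m e j = (if j < k then e j else if j = k then m else e (j - 1))"

lemma ins_0: "ins 0 m e = case_nat m e"
  by (rule ext) (simp add: ins_def split: nat.split)

lemma ins_Suc: "case_nat x (ins k m e) = ins (Suc k) m (case_nat x e)"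
proof
  fix j
  show "case_nat x (ins k m e) j = ins (Suc k) m (case_nat x e) j"
    by (cases j) (auto simp: ins_def split: nat.split)
qed

lemma ins_Suc_0: "ins (Suc k) m e 0 = e 0"
  by (simp add: ins_def)

lemma evt_subst: "evt e (subst_trm k (numeral_trm m) t) = evt (ins k m e) t"
proof (induction t)
  case (Fn f ts)
  then have "map (evt e) (map (subst_trm k (numeral_trm m)) ts) = map (evt (ins k m e)) ts" by simp
  then show ?case by (simp only: evt.simps subst_trm.simps)
qed (simp add: ins_def)

lemma sat_subst: "bounded_fm p \<Longrightarrow> sat e (subst k (numeral_trm m) p) \<longleftrightarrow> sat (ins k m e) p"
proof (induction p arbitrary: k e rule: bounded_fm.induct)
  case (2 s t)
  then show ?case by (simp add: evt_subst)
qed (simp_all add: evt_subst evt_lift ins_Suc ins_Suc_0)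

text \<open>A numeral instance of the body of a quantifier is not a subformula, but it has the size
  of the body; this size carries the induction of \<open>bounded_complete\<close>.\<close>

primrec fsize :: "('f, 'r) fm \<Rightarrow> nat" where
  "fsize (Eq s t) = 0"
| "fsize (Rel r ts) = 0"
| "fsize (Neg p) = Suc (fsize p)"
| "fsize (And p q) = Suc (fsize p + fsize q)"
| "fsize (Or p q) = Suc (fsize p + fsize q)"
| "fsize (All p) = Suc (fsize p)"
| "fsize (Ex p) = Suc (fsize p)"

lemma fsize_subst [simp]: "fsize (subst k s p) = fsize p"
  by (induction p arbitrary: k s) auto


lemma provable_Neg_Neg: "provable S p \<Longrightarrow> provable S (Neg (Neg p))"
proof -
  assume p: "provable S p"
  then have wf: "wf_fm Arith (Neg p)" using derives_wf by fastforce
  show ?thesis by (rule derives.NegI[OF wf derives_insert[OF p] derives_self[OF wf]])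
qed

text \<open>Since \<open>t\<close> provably equals a numeral, \<open>x < t\<close> turns into a
  finite disjunction, and the proof splits into one case per numeral.\<close>

lemma bounded_quant_below:
  assumes S: "Q \<subseteq> S" and t: "wf_trm Arith t" "fv_trm t = {}"
    and less: "provable S (Less (Var 0) (lift_trm 0 t))" and q: "fv q \<subseteq> {0}" "wf_fm Arith q" "wf_fm Arith r"
    and r: "\<And>k S'. k < evt e t \<Longrightarrow> S \<subseteq> S' \<Longrightarrow> provable S' (Eq (Var 0) (numeral_trm k)) \<Longrightarrow> provable S' r"
  shows "provable S r"
proof -
  have "lift_trm 0 t = t" using t(2) by (intro lift_trm_closed) simp
  then have "provable S (Less (Var 0) t)" using less by simp
  from provable_Less[OF this provable_evt[OF S t, of e]] have "provable S (below (evt e t) (Var 0))"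
    by (rule Less_below[OF S])
  then show ?thesis
  proof (rule belowE)
    fix k
    assume "k < evt e t"
    then show "provable (insert (Eq (Var 0) (numeral_trm k)) S) r"
      by (rule r) (auto intro: derives_self)
  qed (rule q)
qed

text \<open>Atoms are computed on numerals. One instance suffices to prove a bounded existential
  sentence or to refute a bounded universal one; the two remaining cases need all instances below
  the bound and rest on \<open>bounded_quant_below\<close>.\<close>

theorem bounded_complete:
  "bounded_fm p \<Longrightarrow> fv p = {} \<Longrightarrow> (sat e p \<longrightarrow> provable Q p) \<and> (\<not> sat e p \<longrightarrow> provable Q (Neg p))"
proof (induction "fsize p" arbitrary: p rule: less_induct)
  case less
  note IH = less.hyps
  have wf: "wf_fm Arith p" using less.prems by (simp add: bounded_wf)
  have sub: "(sat (case_nat k e) q \<longrightarrow> provable Q (subst 0 (numeral_trm k) q)) \<and>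
      (\<not> sat (case_nat k e) q \<longrightarrow> provable Q (Neg (subst 0 (numeral_trm k) q)))"
    if "bounded_fm q" "fv q \<subseteq> {0}" "fsize q < fsize p" for q k
  proof -
    have "fv (subst 0 (numeral_trm k) q) = {}"
      using fv_subst[of "numeral_trm k" q 0] that(2) by auto
    then show ?thesis
      using IH[of "subst 0 (numeral_trm k) q"] that bounded_subst[OF that(1) wf_numeral]
      by (simp add: sat_subst ins_0)
  qed
  from less.prems(1) show ?case
  proof (cases rule: bounded_fm.cases)
    case (1 s t)
    have st: "fv_trm s = {}" "fv_trm t = {}" using less.prems(2) 1 by auto
    note s = provable_evt[OF subset_refl 1(2) st(1), of e] and t = provable_evt[OF subset_refl 1(3) st(2), of e]
    show ?thesis
    proof (cases "evt e s = evt e t")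
      case True
      then have "provable Q p" unfolding 1(1) using s t by (auto intro: derives_trans derives_sym)
      then show ?thesis using True 1 by simp
    next
      case False
      have *: "provable (insert p Q) r" if r: "wf_fm Arith r" for r
      proof -
        have "provable (insert p Q) p" by (rule derives_self[OF wf])
        then have "provable (insert p Q) (Eq (numeral_trm (evt e s)) (numeral_trm (evt e t)))"
          unfolding 1(1) using derives_insert[OF s] derives_insert[OF t]
          by (meson derives_trans derives_sym)
        then show ?thesis by (rule provable_num_neq[OF subset_insertI False _ r])
      qed
      have "provable Q (Neg p)" by (rule derives.NegI[OF wf *[OF wf] *]) (simp add: wf)
      then show ?thesis using False 1 by simp
    qed
  next
    case (2 s t)
    have st: "fv_trm s = {}" "fv_trm t = {}" using less.prems(2) 2 by auto
    note s = provable_evt[OF subset_refl 2(2) st(1), of e] and t = provable_evt[OF subset_refl 2(3) st(2), of e]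
    have rw: "provable S (Less a' b)" if "provable S (Less a b)" "provable S (Eq a a')" for S a a' b
    proof -
      have wfs: "wf_trm Arith b" using derives_wf[OF that(1)] by simp
      have "provable S (subst 0 a' (Less (Var 0) (lift_trm 0 b)))"
        by (rule derives.EqE[OF _ that(2)]) (use wfs that in \<open>simp_all del: wf_fm.simps(2)\<close>)
      then show ?thesis by simp
    qed
    show ?thesis
    proof (cases "evt e s < evt e t")
      case True
      have "provable Q (Less (numeral_trm (evt e s)) (numeral_trm (evt e t)))"
        by (rule provable_num_less[OF subset_refl True])
      from rw[OF provable_Less[OF this derives_sym[OF t]] derives_sym[OF s]] have "provable Q p"
        unfolding 2(1) .
      then show ?thesis using True 2 by simp
    next
      case False
      have *: "provable (insert p Q) r" if r: "wf_fm Arith r" for r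
      proof -
        have self: "provable (insert p Q) (Less s t)" using derives_self[OF wf] 2(1) by simp
        have "provable (insert p Q) (Less (numeral_trm (evt e s)) (numeral_trm (evt e t)))"
          by (rule rw[OF provable_Less[OF self derives_insert[OF t]] derives_insert[OF s]])
        then have "provable (insert p Q) (below (evt e t) (numeral_trm (evt e s)))"
          by (rule Less_below[rotated]) blast
        then show ?thesis
        proof (rule belowE)
          fix k
          assume "k < evt e t"
          then show "provable (insert (Eq (numeral_trm (evt e s)) (numeral_trm k)) (insert p Q)) r"
            using False by (intro provable_num_neq[OF _ _ derives_self r, where m = "evt e s" and n = k]) auto
        qed (rule r)
      qed
      have "provable Q (Neg p)" by (rule derives.NegI[OF wf *[OF wf] *]) (simp add: wf)
      then show ?thesis using False 2 by simp
    qed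
  next
    case (3 q)
    then show ?thesis using IH[of q] less.prems by (auto intro: provable_Neg_Neg)
  next
    case (4 q r)
    then have q: "(sat e q \<longrightarrow> provable Q q) \<and> (\<not> sat e q \<longrightarrow> provable Q (Neg q))"
      and r: "(sat e r \<longrightarrow> provable Q r) \<and> (\<not> sat e r \<longrightarrow> provable Q (Neg r))"
      using IH[of q] IH[of r] less.prems by simp_all
    have self: "provable (insert p Q) (And q r)" unfolding 4(1)[symmetric] by (rule derives_self[OF wf])
    have "provable Q (Neg p)" if "provable Q (Neg q)"
      by (rule derives.NegI[OF wf derives.AndE1[OF self] derives_insert[OF that]])
    moreover have "provable Q (Neg p)" if "provable Q (Neg r)"
      by (rule derives.NegI[OF wf derives.AndE2[OF self] derives_insert[OF that]])
    moreover have "provable Q p" if "provable Q q" "provable Q r"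
      unfolding 4(1) using that by (rule derives.AndI)
    ultimately show ?thesis using q r 4 by auto
  next
    case (5 q r)
    then have q: "(sat e q \<longrightarrow> provable Q q) \<and> (\<not> sat e q \<longrightarrow> provable Q (Neg q))"
      and r: "(sat e r \<longrightarrow> provable Q r) \<and> (\<not> sat e r \<longrightarrow> provable Q (Neg r))"
      using IH[of q] IH[of r] less.prems by simp_all
    have wfs: "wf_fm Arith q" "wf_fm Arith r" using wf 5 by simp_all
    have "provable Q p" if "provable Q q" unfolding 5(1) using that wfs by (intro derives.OrI1)
    moreover have "provable Q p" if "provable Q r" unfolding 5(1) using that wfs by (intro derives.OrI2)
    moreover have "provable Q (Neg p)" if n: "provable Q (Neg q)" "provable Q (Neg r)"
    proof -
      have *: "provable (insert p Q) x" if x: "wf_fm Arith x" for x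
      proof (rule derives.OrE)
        show "provable (insert p Q) (Or q r)" unfolding 5(1)[symmetric] by (rule derives_self[OF wf])
        show "provable (insert q (insert p Q)) x"
          by (rule derives_exfalso[OF derives_self[OF wfs(1)] _ x]) (intro derives_insert n)
        show "provable (insert r (insert p Q)) x"
          by (rule derives_exfalso[OF derives_self[OF wfs(2)] _ x]) (intro derives_insert n)
      qed
      show ?thesis by (rule derives.NegI[OF wf *[OF wf] *]) (simp add: wf)
    qed
    ultimately show ?thesis using q r 5 by auto
  next
    case (6 t q)
    have f: "fv_trm t = {}" "fv q \<subseteq> {0}"
      using less.prems(2) unfolding 6(1) fv_bounded_all by (auto, metis not0_implies_Suc)
    have wfq: "wf_fm Arith q" using 6 bounded_wf by blast
    have sz: "fsize q < fsize p" unfolding 6(1) by simp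
    note sub = sub[OF 6(3) f(2) sz]
    show ?thesis
    proof (cases "sat e p")
      case True
      then have tr: "sat (case_nat k e) q" if "k < evt e t" for k
        using that unfolding 6(1) sat_bounded_all by blast
      let ?S = "insert (Less (Var 0) (lift_trm 0 t)) Q"
      have wfl: "wf_fm Arith (Less (Var 0) (lift_trm 0 t))" using 6 by (simp del: wf_fm.simps(2))
      have "provable ?S q"
      proof (rule bounded_quant_below[OF _ 6(2) f(1) derives_self[OF wfl] f(2) wfq wfq, where e = e])
        fix k S'
        assume k: "k < evt e t" and S': "?S \<subseteq> S'" and e: "provable S' (Eq (Var 0) (numeral_trm k))"
        have "provable Q (subst 0 (numeral_trm k) q)" using sub tr[OF k] by blast
        then have "provable S' (subst 0 (numeral_trm k) q)" by (rule derives_mono) (use S' in blast)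
        \<comment> \<open>The equation \<open>x = k\<close> carries the proved instance back to the
          open formula.\<close>
        from derives.EqE[OF wfq derives_sym[OF e] this] show "provable S' q"
          using subst_Var[of q 0] f(2) by simp
      qed blast
      then have "provable (lift 0 ` Q) (Imp (Less (Var 0) (lift_trm 0 t)) q)"
        unfolding lift_Q by (rule derives_ImpI[OF wfl])
      then have "provable Q p" unfolding 6(1) by (rule derives.AllI)
      then show ?thesis using True by simp
    next
      case False
      then obtain k where k: "k < evt e t" "\<not> sat (case_nat k e) q"
        unfolding 6(1) sat_bounded_all by blast
      have "provable (insert p Q) p" by (rule derives_self[OF wf])
      from derives.AllE[OF this[unfolded 6(1)] wf_numeral[of k]]
      have "provable (insert p Q) (Imp (Less (numeral_trm k) t) (subst 0 (numeral_trm k) q))"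
        unfolding 6(1) by simp
      moreover have "provable Q (Less (numeral_trm k) t)"
        by (rule provable_Less[OF provable_num_less[OF subset_refl k(1)]])
          (rule derives_sym[OF provable_evt[OF subset_refl 6(2) f(1)]])
      ultimately have "provable (insert p Q) (subst 0 (numeral_trm k) q)"
        by (blast intro: derives_mp derives_insert)
      moreover have "provable (insert p Q) (Neg (subst 0 (numeral_trm k) q))"
        using sub k(2) derives_insert by blast
      ultimately have "provable Q (Neg p)" by (rule derives.NegI[OF wf])
      then show ?thesis using False by simp
    qed
  next
    case (7 t q)
    have f: "fv_trm t = {}" "fv q \<subseteq> {0}"
      using less.prems(2) unfolding 7(1) fv_bounded_ex by (auto, metis not0_implies_Suc)
    have wfq: "wf_fm Arith q" using 7 bounded_wf by blast
    have sz: "fsize q < fsize p" unfolding 7(1) by simp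
    note sub = sub[OF 7(3) f(2) sz]
    let ?l = "And (Less (Var 0) (lift_trm 0 t)) q"
    have wfl: "wf_fm Arith ?l" using 7 wfq by (simp del: wf_fm.simps(2))
    show ?thesis
    proof (cases "sat e p")
      case True
      then obtain k where k: "k < evt e t" "sat (case_nat k e) q"
        unfolding 7(1) sat_bounded_ex by blast
      have "provable Q (Less (numeral_trm k) t)"
        by (rule provable_Less[OF provable_num_less[OF subset_refl k(1)]])
          (rule derives_sym[OF provable_evt[OF subset_refl 7(2) f(1)]])
      then have "provable Q (subst 0 (numeral_trm k) ?l)" using sub k(2) by (simp add: derives.AndI)
      then have "provable Q p" unfolding 7(1) by (rule derives.ExI[OF wfl wf_numeral])
      then show ?thesis using True by simp
    next
      case False
      then have fl: "\<not> sat (case_nat k e) q" if "k < evt e t" for k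
        using that unfolding 7(1) sat_bounded_ex by blast
      let ?S = "insert ?l (lift 0 ` insert p Q)"
      have S: "Q \<subseteq> ?S" using lift_Q by blast
      have self: "provable ?S ?l" by (rule derives_self[OF wfl])
      \<comment> \<open>\<open>r\<close> has to pass under the eliminated quantifier, hence the
        invariance under lifting.\<close>
      have *: "provable (insert p Q) r" if r: "wf_fm Arith r" "lift 0 r = r" for r
      proof (rule derives.ExE)
        show "provable (insert p Q) (Ex ?l)" unfolding 7(1)[symmetric] by (rule derives_self[OF wf])
        have "provable ?S r"
        proof (rule bounded_quant_below[OF S 7(2) f(1) derives.AndE1[OF self] f(2) wfq r(1), where e = e])
          fix k S'
          assume k: "k < evt e t" and S': "?S \<subseteq> S'" and e: "provable S' (Eq (Var 0) (numeral_trm k))"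
          have "provable S' q" by (rule derives_mono[OF derives.AndE2[OF self] S'])
          then have "provable S' (subst 0 (Var 0) q)" using subst_Var[of q 0] f(2) by simp
          from derives.EqE[OF wfq e this] have "provable S' (subst 0 (numeral_trm k) q)" .
          moreover have "provable Q (Neg (subst 0 (numeral_trm k) q))" using sub fl[OF k] by blast
          then have "provable S' (Neg (subst 0 (numeral_trm k) q))"
            by (rule derives_mono) (use S S' in blast)
          ultimately show "provable S' r" by (rule derives_exfalso[OF _ _ r(1)])
        qed
        then show "provable ?S (lift 0 r)" unfolding r(2) .
      qed
      \<comment> \<open>A contradictory pair of closed formulas, on which lifting has no
        effect.\<close>
      have "provable (insert p Q) (Eq Zero Zero)" "provable (insert p Q) (Neg (Eq Zero Zero))"
        by (rule *; simp del: wf_trm.simps(2))+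
      then have "provable Q (Neg p)" by (rule derives.NegI[OF wf])
      then show ?thesis using False by simp
    qed
  qed
qed

lemma provable_inst:
  assumes "bounded_fm p" "fv p \<subseteq> {0}"
  shows "(sat (case_nat m e) p \<longrightarrow> provable Q (inst p m)) \<and> (\<not> sat (case_nat m e) p \<longrightarrow> provable Q (Neg (inst p m)))"
proof -
  have "fv (inst p m) = {}" unfolding inst_def using fv_subst[of "numeral_trm m" p 0] assms(2) by auto
  moreover have "bounded_fm (inst p m)" unfolding inst_def by (rule bounded_subst[OF assms(1) wf_numeral])
  ultimately show ?thesis using bounded_complete[of "inst p m" e] assms(1)
    by (simp add: inst_def sat_subst ins_0)
qed

text \<open>By contradiction: if there is no counterexample, assuming \<open>Neg p\<close> at a
  generic variable would produce one, so \<open>p\<close> holds there, and generalisation gives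
  \<open>All p\<close>.\<close>

lemma provable_ex_counterexample:
  assumes "wf_fm Arith p" "fv p \<subseteq> {0}"
  shows "provable {Neg (All p)} (Ex (Neg p))"
proof (rule derives.Classical[where q = "All p"])
  let ?S = "insert (Neg (Ex (Neg p))) {Neg (All p)}"
  have cl: "lift 0 (All p) = All p" "lift 0 (Ex (Neg p)) = Ex (Neg p)"
    using assms(2) by (auto intro!: lift_closed)
  show "wf_fm Arith (Ex (Neg p))" using assms by simp
  show "provable ?S (Neg (All p))" by (rule derives.Assm) (use assms in simp_all)
  have "provable (lift 0 ` ?S) p"
  proof (rule derives.Classical[OF assms(1), where q = "Ex (Neg p)"])
    let ?S' = "insert (Neg p) (lift 0 ` ?S)"
    have "provable ?S' (Neg p)" by (rule derives_self) (use assms in simp)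
    then have "provable ?S' (subst 0 (Var 0) (Neg p))" using subst_Var[of p 0] assms(2) by simp
    then show "provable ?S' (Ex (Neg p))"
      by (intro derives.ExI[of Arith _ "Var 0"]) (use assms in simp_all)
    show "provable ?S' (Neg (Ex (Neg p)))"
      by (rule derives.Assm) (use assms cl in \<open>simp_all del: lift.simps(6,7)\<close>)
  qed
  then show "provable ?S (All p)" by (rule derives.AllI)
qed

lemma provable_All_imp:
  assumes "fv p \<subseteq> {0}" "provable {p} q" "wf_fm Arith p"
  shows "provable {All p} (All q)"
proof (rule derives.AllI)
  have "lift 0 (All p) = All p" using assms(1) by (auto intro!: lift_closed)
  then have "provable (lift 0 ` {All p}) (All p)" by (intro derives.Assm) (use assms in simp_all)
  from derives.AllE[OF this, of "Var 0"] have "provable (lift 0 ` {All p}) p"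
    using subst_Var[of p 0] assms(1) by simp
  moreover have "provable (insert p (lift 0 ` {All p})) q" by (rule derives_mono[OF assms(2)]) blast
  ultimately show "provable (lift 0 ` {All p}) q" by (rule derives_cut)
qed

section \<open>The speculative map\<close>

definition true_pi :: "arith_fm \<Rightarrow> bool" where
  "true_pi p \<longleftrightarrow> bounded_fm p \<and> fv p \<subseteq> {0} \<and> (\<forall>m. sat (case_nat m (\<lambda>_. 0)) p)"

text \<open>The conjunct \<open>x = x\<close> makes 0 a free variable, as \<open>F0\<close> requires.\<close>

lemma true_pi_common:
  assumes "finite Y" "\<And>p. p \<in> Y \<Longrightarrow> true_pi p"
  shows "\<exists>q. true_pi q \<and> fv q = {0} \<and> (\<forall>p\<in>Y. provable {q} p)"
  using assms
proof (induction Y)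
  case empty
  have "true_pi (Eq (Var 0) (Var 0))" by (simp add: true_pi_def bounded_fm.intros)
  then show ?case by (intro exI[of _ "Eq (Var 0) (Var 0)"]) simp
next
  case (insert p Y)
  have "\<exists>q. true_pi q \<and> fv q = {0} \<and> (\<forall>p\<in>Y. provable {q} p)"
    by (rule insert.IH) (simp add: insert.prems)
  then obtain q where q: "true_pi q" "fv q = {0}" "\<forall>r\<in>Y. provable {q} r" by (elim exE conjE)
  have p: "true_pi p" using insert.prems by simp
  let ?c = "And p q"
  have "true_pi ?c" using p q(1) by (auto simp: true_pi_def intro: bounded_fm.intros)
  then have c: "provable {?c} ?c" by (intro derives.Assm) (auto simp: true_pi_def bounded_wf simp del: wf_fm.simps)
  have all: "provable {?c} r" if "r \<in> insert p Y" for r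
  proof (cases "r = p")
    case True
    then show ?thesis using derives.AndE1[OF c] by simp
  next
    case False
    then have "provable {q} r" using that q(3) by simp
    then have "provable (insert q {?c}) r" by (rule derives_mono) blast
    then show ?thesis using derives_cut[OF derives.AndE2[OF c]] by blast
  qed
  have "fv ?c = {0}" using p q(2) by (auto simp: true_pi_def)
  show ?case
  proof (intro exI[of _ ?c] conjI ballI)
    show "true_pi ?c" "fv ?c = {0}" by fact+
    show "provable {?c} r" if "r \<in> insert p Y" for r using that by (rule all)
  qed
qed

lemma translation_derives:
  assumes "translation L' L i" "S \<subseteq> sentences L'" "p \<in> sentences L'" "derives L' S p"
  shows "derives L (i ` S) (i p)"
proof -
  have "\<forall>S p. S \<subseteq> sentences L' \<and> p \<in> sentences L' \<and> derives L' S p \<longrightarrow> derives L (i ` S) (i p)"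
    using assms(1) unfolding translation_def by (elim conjE)
  then show ?thesis using assms(2-4) by simp
qed

lemma translation_Neg:
  assumes "translation L' L i" "p \<in> sentences L'"
  shows "i (Neg p) = Neg (i p)"
proof -
  have "\<forall>p\<in>sentences L'. i (Neg p) = Neg (i p)"
    using assms(1) unfolding translation_def by (elim conjE)
  then show ?thesis using assms(2) by (rule bspec)
qed

lemma translation_sentence:
  assumes "translation L' L i" "p \<in> sentences L'"
  shows "i p \<in> sentences L"
proof -
  have "i ` sentences L' \<subseteq> sentences L"
    using assms(1) unfolding translation_def by (elim conjE)
  then show ?thesis using assms(2) by blast
qed

lemma derives_viaI:
  assumes "translation Arith L i" "p \<in> sentences Arith" "derives L F (i p)"
  shows "derives_via L i F p"
proof -
  have "i p \<in> closure L F" using assms translation_sentence by (auto simp: closure_def)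
  then show ?thesis unfolding derives_via_def arith_part_def
    using assms(2) by (intro derives.Assm) (auto simp: sentences_def)
qed

lemma derives_via_Q:
  "\<forall>p\<in>Q. derives_via L i F p \<Longrightarrow> provable Q p \<Longrightarrow> derives_via L i F p"
  unfolding derives_via_def by (rule derives_cut_set) auto

lemma All_sentence: "bounded_fm p \<Longrightarrow> fv p \<subseteq> {0} \<Longrightarrow> All p \<in> sentences Arith"
  by (auto simp: sentences_def bounded_wf)

text \<open>A translation need not commute with quantifiers. The passages from \<open>All r\<close>,
  with the common formula \<open>r\<close>, to the single sentences and from
  \<open>Neg (All r)\<close> to \<open>Ex (Neg r)\<close> are therefore derived in arithmetic and
  then translated; of \<open>i\<close> only negation and derivability are used.\<close>

lemma consistent_extension:
  assumes i: "translation Arith L i" and F: "F \<subseteq> sentences L" and con: "one_consistent L i F"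
    and G: "\<And>q. q \<in> G \<Longrightarrow> q \<in> F \<or> (\<exists>p. true_pi p \<and> q = i (All p))"
  shows "consistent L G"
  unfolding consistent_def
proof
  assume "\<exists>p\<in>sentences L. derives L G p \<and> derives L G (Neg p)"
  then obtain p where p: "derives L G p" "derives L G (Neg p)" by blast
  obtain R1 R2 where R: "finite R1" "R1 \<subseteq> G" "derives L R1 p" "finite R2" "R2 \<subseteq> G" "derives L R2 (Neg p)"
    using derives_compact[OF p(1)] derives_compact[OF p(2)] by blast
  define R where "R = (R1 \<union> R2) - F"
  have "finite R" using R by (simp add: R_def)
  have "\<forall>q\<in>R. \<exists>p. true_pi p \<and> q = i (All p)" using G R by (auto simp: R_def)
  then have "\<exists>f. \<forall>q\<in>R. true_pi (f q) \<and> q = i (All (f q))" by (rule bchoice)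
  then obtain f where f0: "\<forall>q\<in>R. true_pi (f q) \<and> q = i (All (f q))" by (rule exE)
  have f: "true_pi (f q)" "i (All (f q)) = q" if "q \<in> R" for q
    by (rule conjunct1[OF bspec[OF f0 that]]) (rule conjunct2[OF bspec[OF f0 that], symmetric])
  have "\<exists>r. true_pi r \<and> fv r = {0} \<and> (\<forall>p\<in>f ` R. provable {r} p)"
    by (rule true_pi_common) (use \<open>finite R\<close> f(1) in auto)
  then obtain r where r: "true_pi r" "fv r = {0}" and r': "\<forall>p\<in>f ` R. provable {r} p" by (elim exE conjE)
  have rb: "bounded_fm r" "wf_fm Arith r" using r(1) by (simp_all add: true_pi_def bounded_wf)
  have rs: "All r \<in> sentences Arith" "Neg (All r) \<in> sentences Arith" "Ex (Neg r) \<in> sentences Arith"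
    using rb r(2) by (auto simp: sentences_def)
  let ?a = "i (All r)"
  have wfa: "wf_fm L ?a" using translation_sentence[OF i rs(1)] by (simp add: sentences_def)
  have "derives L (insert ?a F) q" if "q \<in> R1 \<union> R2" for q
  proof (cases "q \<in> F")
    case True
    then show ?thesis using F by (intro derives.Assm) (auto simp: sentences_def)
  next
    case False
    then have q: "q \<in> R" using that by (simp add: R_def)
    have "provable {All r} (All (f q))" by (rule provable_All_imp) (use r r' q rb in auto)
    moreover have "All (f q) \<in> sentences Arith" using f(1)[OF q] All_sentence by (simp add: true_pi_def)
    ultimately have "derives L (i ` {All r}) (i (All (f q)))"
      using rs by (intro translation_derives[OF i]) auto
    then have "derives L {?a} q" using f(2)[OF q] by simp
    then show ?thesis by (rule derives_mono) blast
  qed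
  then have "derives L (insert ?a F) p" "derives L (insert ?a F) (Neg p)"
    using derives_cut_set[of "R1 \<union> R2" L "insert ?a F"] derives_mono[OF R(3)] derives_mono[OF R(6)]
    by blast+
  then have "derives L F (Neg ?a)" by (rule derives.NegI[OF wfa])
  then have na: "derives L F (i (Neg (All r)))" using translation_Neg[OF i rs(1)] by simp
  have "derives L (i ` {Neg (All r)}) (i (Ex (Neg r)))"
    by (rule translation_derives[OF i _ rs(3) provable_ex_counterexample]) (use rs rb r in auto)
  then have "derives L F (i (Ex (Neg r)))" using na by (auto intro: derives_cut_set)
  then have "derives_via L i F (Ex (Neg r))" by (rule derives_viaI[OF i rs(3)])
  moreover have "Neg r \<in> F0" using rb r(2) by (auto simp: F0_def intro: sigma_fm_pi_fm.intros bounded_fm.intros)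
  ultimately obtain m where m: "\<not> derives_via L i F (Neg (inst (Neg r) m))"
    using con unfolding one_consistent_def by blast
  \<comment> \<open>1-consistency was applied to \<open>Neg r\<close>, so the sentence said to be
    underivable is a double negation of an instance of \<open>r\<close>.\<close>
  have "provable Q (inst r m)" using provable_inst[OF rb(1), of m "\<lambda>_. 0"] r by (simp add: true_pi_def)
  then have "provable Q (Neg (inst (Neg r) m))" using provable_Neg_Neg by (simp add: inst_def)
  then have "derives_via L i F (Neg (inst (Neg r) m))"
    using con derives_via_Q unfolding one_consistent_def by blast
  with m show False by blast
qed

section \<open>The schedule of outputs and its stable sentences\<close>

lemma pr_less: "pr m n < pr m' n' \<longleftrightarrow> m + n < m' + n' \<or> m + n = m' + n' \<and> m < m'"
proof -
  have lt: "pr m n < pr m' n'" if "m + n < m' + n'" for m n m' n'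
  proof -
    have mono: "triangle a \<le> triangle (a + b)" for a b by (induction b) auto
    have "pr m n < triangle (Suc (m + n))" by (simp add: pr_def prod_encode_def)
    also have "\<dots> \<le> triangle (m' + n')" 
    proof -
      have "Suc (m + n) + (m' + n' - Suc (m + n)) = m' + n'" using that by simp
      with mono[of "Suc (m + n)" "m' + n' - Suc (m + n)"] show ?thesis by (simp only:)
    qed
    also have "\<dots> \<le> pr m' n'" by (simp add: pr_def prod_encode_def)
    finally show ?thesis .
  qed
  consider "m + n < m' + n'" | "m' + n' < m + n" | "m + n = m' + n'" by linarith
  then show ?thesis
  proof cases
    case 3
    then show ?thesis by (simp add: pr_def prod_encode_def)
  qed (use lt[of m n m' n'] lt[of m' n' m n] in auto)
qed

definition retr :: "(nat \<Rightarrow> nat \<Rightarrow> bool) \<Rightarrow> nat \<Rightarrow> nat \<Rightarrow> bool" where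
  "retr F j w \<longleftrightarrow> F j w \<and> (\<forall>v<w. \<not> F j v)"

definition hold :: "(nat \<Rightarrow> nat \<Rightarrow> bool) \<Rightarrow> (nat \<Rightarrow> nat \<Rightarrow> bool) \<Rightarrow> nat \<Rightarrow> nat \<Rightarrow> bool" where
  "hold B F j w \<longleftrightarrow> B j w \<and> (\<forall>v\<le>w. \<not> F j v)"

text \<open>\<open>pr j w\<close> is the stage that tests \<open>w\<close> for \<open>j\<close>.
  Spelling out \<open>w \<le> s\<close> keeps the quantifier bounded and the predicate
  decidable.\<close>

definition seen :: "(nat \<Rightarrow> nat \<Rightarrow> bool) \<Rightarrow> nat \<Rightarrow> nat \<Rightarrow> bool" where
  "seen B s j \<longleftrightarrow> (\<exists>w\<le>s. pr j w \<le> s \<and> B j w)"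

definition active :: "(nat \<Rightarrow> nat \<Rightarrow> bool) \<Rightarrow> (nat \<Rightarrow> nat \<Rightarrow> bool) \<Rightarrow> (nat \<Rightarrow> 'a) \<Rightarrow> 'a \<Rightarrow> nat \<Rightarrow> bool" where
  "active B F p q s \<longleftrightarrow> (\<exists>j\<le>s. seen B s j \<and> \<not> seen F s j \<and> p j = q)"

text \<open>The outputs \<open>pr m n\<close> with \<open>m + n = s\<close> make up stage
  \<open>s\<close> and follow each other in the order of \<open>m\<close>. Place 0 gives the verdict
  on the test of the stage. Place \<open>s\<close>, if positive, passes on the output
  \<open>s - 1\<close> of \<open>M\<close>. A place \<open>m\<close> between them repeats the output
  \<open>m - 1\<close> if the stage retracts a sentence and the output concerns it. Idle places
  assert the filler \<open>d\<close>, so that the map is total whenever \<open>M\<close> is.\<close>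

definition spec_map :: "(nat \<Rightarrow> nat \<Rightarrow> bool) \<Rightarrow> (nat \<Rightarrow> nat \<Rightarrow> bool) \<Rightarrow> (nat \<Rightarrow> ('f, 'r) fm) \<Rightarrow> ('f, 'r) fm
    \<Rightarrow> ('f, 'r) signed_map \<Rightarrow> ('f, 'r) signed_map" where
  "spec_map B F p d M k = (let m = pf k; n = ps k; s = m + n; j = pf s; w = ps s in
     if m = 0 then Some (if retr F j w then (p j, Minus) else if hold B F j w then (p j, Plus) else (d, Plus))
     else if n = 0 then
       map_option (\<lambda>(q, g). (q, if active B F p q s then Plus else g)) (M (m - 1))
     else if retr F j w then
       map_option (\<lambda>(q, g). if q = p j then (q, g) else (d, Plus)) (M (m - 1))
     else Some (d, Plus))"

lemma spec_head:
  "spec_map B F p d M (pr 0 (pr j w)) =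
     Some (if retr F j w then (p j, Minus) else if hold B F j w then (p j, Plus) else (d, Plus))"
  by (simp add: spec_map_def)

lemma spec_last:
  "spec_map B F p d M (pr (Suc m) 0) =
     map_option (\<lambda>(q, g). (q, if active B F p q (Suc m) then Plus else g)) (M m)"
  by (simp add: spec_map_def Let_def)

lemma spec_mid:
  "Suc m + Suc n = pr j w \<Longrightarrow> spec_map B F p d M (pr (Suc m) (Suc n)) =
     (if retr F j w then map_option (\<lambda>(q, g). if q = p j then (q, g) else (d, Plus)) (M m)
      else Some (d, Plus))"
  by (simp add: spec_map_def)

lemma spec_cases:
  obtains (head) j w where "k = pr 0 (pr j w)"
  | (last) m where "k = pr (Suc m) 0"
  | (mid) m n j w where "k = pr (Suc m) (Suc n)" "Suc m + Suc n = pr j w"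
proof -
  obtain m n where k: "k = pr m n" by (metis pr_pf_ps)
  obtain j w where jw: "m + n = pr j w" by (metis pr_pf_ps)
  show thesis
  proof (cases m)
    case 0
    then show thesis using head[of j w] k jw by simp
  next
    case (Suc m')
    then show thesis using last[of m'] mid[of m' "n - 1" j w] k jw by (cases n) simp_all
  qed
qed

lemma spec_total:
  assumes "\<And>n. M n \<noteq> None"
  shows "spec_map B F p d M k \<noteq> None"
proof -
  have "M (pf k - 1) \<noteq> None" by (rule assms)
  then obtain q g where "M (pf k - 1) = Some (q, g)" by auto
  then show ?thesis by (simp add: spec_map_def Let_def)
qed

text \<open>Injectivity guarantees that a sentence is retracted at one stage only.\<close>

locale certificates =
  fixes B F :: "nat \<Rightarrow> nat \<Rightarrow> bool" and p :: "nat \<Rightarrow> ('f, 'r) fm" and d :: "('f, 'r) fm"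
  assumes F_B: "F j w \<Longrightarrow> \<exists>v. B j v"
    and p_inj: "B j v \<Longrightarrow> B j' v' \<Longrightarrow> p j = p j' \<Longrightarrow> j = j'"
begin

abbreviation spec :: "('f, 'r) signed_map \<Rightarrow> ('f, 'r) signed_map" where "spec \<equiv> spec_map B F p d"
abbreviation act :: "('f, 'r) fm \<Rightarrow> nat \<Rightarrow> bool" where "act \<equiv> active B F p"

lemma p_inj_F: "F j v \<Longrightarrow> B j' v' \<Longrightarrow> p j = p j' \<Longrightarrow> j = j'"
  using F_B p_inj by blast

lemma retr_unique:
  assumes "retr F j w" "retr F j' w'" "p j = p j'"
  shows "j = j' \<and> w = w'"
proof -
  have j: "j = j'" using assms F_B p_inj unfolding retr_def by metis
  have "w = w'" using assms(1,2) unfolding j retr_def by (meson linorder_neqE_nat)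
  with j show ?thesis by simp
qed

lemma retr_ex: "F j v \<Longrightarrow> \<exists>w. retr F j w"
  unfolding retr_def by (rule exI[of _ "LEAST w. F j w"]) (auto intro: LeastI dest: not_less_Least)

lemma spec_Minus:
  assumes "spec M k = Some (q, Minus)"
  obtains (head) j w where "k = pr 0 (pr j w)" "retr F j w" "q = p j"
  | (last) m where "k = pr (Suc m) 0" "M m = Some (q, Minus)" "\<not> act q (Suc m)"
  | (mid) m n j w where "k = pr (Suc m) (Suc n)" "Suc m + Suc n = pr j w" "retr F j w" "q = p j"
      "M m = Some (q, Minus)"
  using assms
proof (cases k rule: spec_cases)
  case (head j w)
  then show thesis using assms that(1) by (auto simp: spec_head split: if_splits)
next
  case (last m)
  then show thesis using assms that(2) by (auto simp: spec_last split: if_splits)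
next
  case (mid m n j w)
  then show thesis using assms that(3)
    by (auto simp del: add_Suc add_Suc_right simp: spec_mid[OF mid(2)] split: if_splits)
qed

text \<open>If \<open>q\<close> is retracted in a stage after \<open>Suc m\<close>, the assertion
  that lasts is the one repeated in that stage, behind the retraction; otherwise it is the copy at
  the end of stage \<open>Suc m\<close>. Any later retraction would stem from \<open>M\<close>,
  which makes none after \<open>m\<close>.\<close>

lemma stab_spec: "stabilization M \<subseteq> stabilization (spec M)"
proof
  fix q
  assume "q \<in> stabilization M"
  then obtain m where m: "M m = Some (q, Plus)" and st: "\<And>n. m < n \<Longrightarrow> M n \<noteq> Some (q, Minus)"
    unfolding stabilization_def by blast
  have "\<exists>K. spec M K = Some (q, Plus) \<and> (\<forall>k>K. spec M k \<noteq> Some (q, Minus))"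
  \<comment> \<open>The output at \<open>m\<close> is passed on at the end of stage
    \<open>Suc m\<close>. A retraction in the same stage precedes it and is harmless, hence the
    strict inequality.\<close>
  proof (cases "\<exists>j w. retr F j w \<and> q = p j \<and> Suc m < pr j w")
    case True
    then obtain j w where jw: "retr F j w" "q = p j" "Suc m < pr j w" by blast
    \<comment> \<open>Chosen such that place \<open>Suc m\<close> belongs to stage
      \<open>pr j w\<close>.\<close>
    define n where "n = pr j w - Suc (Suc m)"
    have n: "Suc m + Suc n = pr j w" using jw(3) by (simp add: n_def)
    have "spec M (pr (Suc m) (Suc n)) = Some (q, Plus)"
      using m jw by (simp add: spec_mid[OF n])
    moreover have "spec M k \<noteq> Some (q, Minus)" if "pr (Suc m) (Suc n) < k" for k
    proof
      assume "spec M k = Some (q, Minus)"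
      then show False
      proof (cases rule: spec_Minus)
        case (head j' w')
        then have "j' = j \<and> w' = w" using retr_unique jw by metis
        then show False using that[unfolded head(1)] n unfolding pr_less by simp
      next
        case (last m')
        then have "m < m'" using that n jw(3) unfolding last(1) pr_less by auto
        then show False using st last by blast
      next
        case (mid m' n' j' w')
        then have "j' = j \<and> w' = w" using retr_unique jw by metis
        then have "Suc m' + Suc n' = Suc m + Suc n" using mid n by simp
        then have "m < m'" using that unfolding mid(1) pr_less by auto
        then show False using st mid by blast
      qed
    qed
    ultimately show ?thesis by blast
  next
    case False
    have "spec M (pr (Suc m) 0) = Some (q, Plus)" using m by (simp add: spec_last)
    moreover have "spec M k \<noteq> Some (q, Minus)" if k: "pr (Suc m) 0 < k" for k
    proof
      assume "spec M k = Some (q, Minus)"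
      then show False
      proof (cases rule: spec_Minus)
        case (head j w)
        then have "\<not> Suc m < pr j w" using False by blast
        then show False using k unfolding head(1) pr_less by simp
      next
        case (last m')
        then have "m < m'" using k unfolding last(1) pr_less by auto
        then show False using st last by blast
      next
        case (mid m' n' j w)
        then have "\<not> Suc m < pr j w" using False by blast
        then have "Suc m' + Suc n' \<le> Suc m" using mid(2) by simp
        then show False using k unfolding mid(1) pr_less by simp
      qed
    qed
    ultimately show ?thesis by blast
  qed
  then show "q \<in> stabilization (spec M)" unfolding stabilization_def by blast
qed

text \<open>By injectivity no refutation of another formula retracts this sentence, and retractions
  by \<open>M\<close> are overridden because the sentence is active from stage \<open>pr j w\<close>
  on.\<close>

lemma stab_spec_true:
  assumes B: "B j w" and F: "\<And>v. \<not> F j v"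
  shows "p j \<in> stabilization (spec M)"
proof -
  have "spec M (pr 0 (pr j w)) = Some (p j, Plus)" using B F by (simp add: spec_head retr_def hold_def)
  moreover have "spec M k \<noteq> Some (p j, Minus)" if k: "pr 0 (pr j w) < k" for k
  proof
    assume "spec M k = Some (p j, Minus)"
    then show False
    proof (cases rule: spec_Minus)
      case (head j' w')
      then show False using p_inj_F[of j' w' j w] B F by (auto simp: retr_def)
    next
      case (last m)
      have s: "pr j w \<le> Suc m" using k unfolding last(1) pr_less by auto
      then have "j \<le> Suc m" "w \<le> Suc m" using le_pr_1[of j w] le_pr_2[of w j] by simp_all
      then have "act (p j) (Suc m)" unfolding active_def seen_def using B F s by blast
      then show False using last by blast
    next
      case (mid m n j' w')
      then show False using p_inj_F[of j' w' j w] B F by (auto simp: retr_def)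
    qed
  qed
  ultimately show ?thesis unfolding stabilization_def by blast
qed

text \<open>If \<open>j\<close> has a refutation, the first one belongs to a stage after
  \<open>s\<close>, since it would have been seen otherwise; that stage retracts the
  sentence.\<close>

lemma active_retracted:
  assumes "act q s"
  shows "(\<exists>j. (\<exists>w. B j w) \<and> (\<forall>w. \<not> F j w) \<and> q = p j) \<or> (\<exists>t>s. spec M (pr 0 t) = Some (q, Minus))"
proof -
  obtain j where j: "seen B s j" "\<not> seen F s j" "q = p j" using assms unfolding active_def by blast
  show ?thesis
  proof (cases "\<exists>w. F j w")
    case True
    then obtain w where w: "retr F j w" using retr_ex by blast
    have "s < pr j w"
    proof (rule ccontr)
      assume "\<not> s < pr j w"
      then have "w \<le> s" "pr j w \<le> s" using le_pr_2[of w j] by simp_all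
      then have "seen F s j" using w unfolding seen_def retr_def by blast
      with j show False by blast
    qed
    then show ?thesis using w j(3) by (auto simp: spec_head)
  next
    case False
    then show ?thesis using j unfolding seen_def by blast
  qed
qed

text \<open>An assertion of \<open>q\<close> that is never retracted afterwards is traced to its
  origin. A verdict on a refutable formula would be retracted at the first refutation. A copied
  assertion comes from \<open>M\<close>; as \<open>q\<close> cannot be active any more, retractions
  by \<open>M\<close> would get through, so \<open>q\<close> is stable for \<open>M\<close>.\<close>

lemma stab_spec_cases:
  assumes q: "q \<in> stabilization (spec M)"
  shows "q \<in> stabilization M \<or> q = d \<or> (\<exists>j. (\<exists>w. B j w) \<and> (\<forall>w. \<not> F j w) \<and> q = p j)"
proof (rule ccontr)
  assume neg: "\<not> ?thesis"
  obtain K where K: "spec M K = Some (q, Plus)" and st: "\<And>k. K < k \<Longrightarrow> spec M k \<noteq> Some (q, Minus)"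
    using q unfolding stabilization_def by blast
  have inact: "\<not> act q s" if "pf K + ps K \<le> s" for s
  proof
    assume "act q s"
    then obtain t where t: "s < t" "spec M (pr 0 t) = Some (q, Minus)" using active_retracted neg by blast
    have "pr (pf K) (ps K) < pr 0 t" unfolding pr_less using t(1) that by simp
    then show False using st t(2) by simp
  qed
  have step: "spec M (pr (Suc n) 0) = Some (q, Minus)"
    if "M n = Some (q, Minus)" "pf K + ps K \<le> Suc n" for n
    using inact[OF that(2)] that(1) by (simp add: spec_last)
  show False
  proof (cases K rule: spec_cases)
    case (head j w)
    then have h: "hold B F j w" "q = p j" using K neg by (auto simp: spec_head split: if_splits)
    then obtain v where "F j v" using neg unfolding hold_def by blast
    then obtain w' where w': "retr F j w'" using retr_ex by blast
    have "w < w'" using h(1) w' unfolding hold_def retr_def by (meson not_le)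
    then have "K < pr 0 (pr j w')" unfolding head by (simp add: pr_less)
    then have "spec M (pr 0 (pr j w')) \<noteq> Some (q, Minus)" by (rule st)
    then show False using w' h(2) by (simp add: spec_head)
  next
    case (last m)
    then have M: "M m = Some (q, Plus)"
      using K inact[of "Suc m"] by (auto simp: spec_last)
    have "M n \<noteq> Some (q, Minus)" if "m < n" for n
    proof
      assume "M n = Some (q, Minus)"
      then have "spec M (pr (Suc n) 0) = Some (q, Minus)" using step that last by simp
      moreover have "K < pr (Suc n) 0" unfolding last pr_less using that by simp
      ultimately show False using st by blast
    qed
    then show False using neg M unfolding stabilization_def by blast
  next
    case (mid m n j w)
    then have r: "retr F j w" and qj: "q = p j" and M: "M m = Some (q, Plus)"
      using K neg by (auto simp del: add_Suc add_Suc_right simp: spec_mid[OF mid(2)] split: if_splits)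
    have "M n' \<noteq> Some (q, Minus)" if "m < n'" for n'
    proof
      assume n': "M n' = Some (q, Minus)"
      show False
      \<comment> \<open>A retraction that \<open>M\<close> made early enough is repeated in the same
        stage, behind the repeated assertion. A later one appears at the end of stage
        \<open>Suc n'\<close>, which is this stage or one after it.\<close>
      proof (cases "Suc n' < pr j w")
        case True
        define l where "l = pr j w - Suc (Suc n')"
        have l: "Suc n' + Suc l = pr j w" using True by (simp add: l_def)
        have "spec M (pr (Suc n') (Suc l)) = Some (q, Minus)"
          using n' r qj by (simp add: spec_mid[OF l])
        moreover have "K < pr (Suc n') (Suc l)" unfolding mid(1) pr_less using that l mid(2) by simp
        ultimately show False using st by blast
      next
        case False
        then have "spec M (pr (Suc n') 0) = Some (q, Minus)" using step[OF n'] mid by simp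
        moreover have "K < pr (Suc n') 0" unfolding mid(1) pr_less using that False mid(2) by auto
        ultimately show False using st by blast
      qed
    qed
    then show False using neg M unfolding stabilization_def by blast
  qed
qed

end


section \<open>Enumerability of the speculative map and computability of machine codes\<close>

lemma decp_retr:
  assumes "decp (\<lambda>z. F (pf z) (ps z))" "prc f" "prc g"
  shows "decp (\<lambda>x. retr F (f x) (g x))"
proof -
  have "decp (\<lambda>z. retr F (pf z) (ps z))"
    unfolding retr_def by (intro decp_intros decp_comp2[OF assms(1)] prc_intros)
  from decp_comp2[OF this assms(2,3)] show ?thesis .
qed

lemma decp_hold:
  assumes "decp (\<lambda>z. B (pf z) (ps z))" "decp (\<lambda>z. F (pf z) (ps z))" "prc f" "prc g"
  shows "decp (\<lambda>x. hold B F (f x) (g x))"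
proof -
  have "decp (\<lambda>z. hold B F (pf z) (ps z))"
    unfolding hold_def by (intro decp_intros decp_comp2[OF assms(1)] decp_comp2[OF assms(2)] prc_intros)
  from decp_comp2[OF this assms(3,4)] show ?thesis .
qed

lemma decp_seen:
  assumes "decp (\<lambda>z. B (pf z) (ps z))" "prc f" "prc g"
  shows "decp (\<lambda>x. seen B (f x) (g x))"
proof -
  have "decp (\<lambda>z. seen B (pf z) (ps z))"
    unfolding seen_def by (intro decp_intros decp_comp2[OF assms(1)] prc_intros)
  from decp_comp2[OF this assms(2,3)] show ?thesis .
qed

lemma code_machine_Cons: "code_turing (((q, a), (b, dr, q')) # T) = cns (pr (pr q a) (pr b (pr (code_dir dr) q'))) (code_turing T)"
  by (simp add: code_turing_alt list_encode_Cons code_act_def)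

lemma code_prefix_Suc:
  "code_turing (prefix K P (Suc n)) =
    cns (pr (pr (3 + width P + Suc n) 0) (pr 2 (pr 1 (3 + width P + n))))
      (cns (pr (pr (3 + width P + Suc n) 1) (pr 3 (pr 1 (3 + width P + n)))) (code_turing (prefix K P n)))"
  unfolding prefix.simps(2) code_machine_Cons code_dir.simps ..

text \<open>The s-m-n property: \<open>c\<close> enters the table through the target of the entry
  for state 1 and through the length of \<open>prefix\<close>, which grows by two entries at the
  front per unit of \<open>c\<close>.\<close>

lemma prc_code_machine: "prc (\<lambda>c. code_turing (machine K P c))"
proof -
  define u where "u = 3 + width P"
  define b where "b = code_turing (prefix K P 0)"
  define h where "h = (\<lambda>n x. cns (pr (pr (u + Suc n) 0) (pr 2 (pr 1 (u + n))))
    (cns (pr (pr (u + Suc n) 1) (pr 3 (pr 1 (u + n)))) x))"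
  have *: "code_turing (prefix K P n) = rec_nat b h n" for n
  proof (induction n)
    case 0
    show ?case by (simp only: b_def old.nat.simps(6))
  next
    case (Suc n)
    show ?case unfolding code_prefix_Suc Suc u_def[symmetric] by (simp only: h_def old.nat.simps(7))
  qed
  have h: "prc (\<lambda>z. h (pf (ps z)) (ps (ps z)))"
    unfolding h_def by (intro prc_intros)
  have "prc (\<lambda>c. rec_nat b h c)"
    by (rule prc_rec[where h = "\<lambda>_. h"]) (intro h prc_intros)+
  then have "prc (\<lambda>c. cns (pr (pr 1 0) (pr (2 ^ K) (pr 1 (u + c)))) (rec_nat b h c))"
    by (intro prc_cns prc_pr prc_const prc_add prc_id)
  moreover have "(\<lambda>c. code_turing (machine K P c)) =
      (\<lambda>c. cns (pr (pr 1 0) (pr (2 ^ K) (pr 1 (u + c)))) (rec_nat b h c))"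
    unfolding machine_def code_machine_Cons * u_def[symmetric] code_dir.simps ..
  ultimately show ?thesis by (simp only:)
qed

text \<open>Here \<open>ce0\<close> codes a machine that decides the image of \<open>e\<close>, and
  \<open>ad\<close> is the code of the filler. An output \<open>x\<close> that codes no signed
  sentence either is not of the form \<open>2 ^ a * 3 ^ b\<close> with \<open>b \<le> 1\<close>,
  which is a bounded check, or has an exponent that the machine rejects; so the replacement by the
  filler is enumerable too.\<close>

definition signed_out :: "nat \<Rightarrow> nat \<Rightarrow> nat \<Rightarrow> nat \<Rightarrow> nat \<Rightarrow> nat \<Rightarrow> bool" where
  "signed_out ce0 ad c n a b \<longleftrightarrow> (\<exists>x. run c n x \<and>
     (b \<le> 1 \<and> x = 2 ^ a * 3 ^ b \<and> run ce0 a 1 \<or>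
      a = ad \<and> b = 1 \<and>
        ((\<forall>a'\<le>x. x \<noteq> 2 ^ a' \<and> x \<noteq> 2 ^ a' * 3) \<or> (\<exists>a' b'. b' \<le> 1 \<and> x = 2 ^ a' * 3 ^ b' \<and> run ce0 a' 0))))"

lemma ce_signed_out:
  assumes "prc c" "prc n" "prc a" "prc b"
  shows "ce (\<lambda>x. signed_out ce0 ad (c x) (n x) (a x) (b x))"
proof -
  have "ce (\<lambda>z. signed_out ce0 ad (pf (pf z)) (ps (pf z)) (pf (ps z)) (ps (ps z)))"
    unfolding signed_out_def by (intro ce_intros decp_intros prc_intros)
  from ce_comp[OF this, of "\<lambda>x. pr (pr (c x) (n x)) (pr (a x) (b x))"] show ?thesis
    by (simp add: prc_pr assms)
qed

text \<open>The graph of \<open>spec_map\<close> on codes. All occurrences of \<open>run\<close> are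
  positive, and negations concern decidable predicates only. That a sentence is not active is stated
  as follows: each seen \<open>j\<close> either is refuted or has a computed translation with a code
  other than \<open>a\<close>.\<close>

definition spec_graph :: "(nat \<Rightarrow> nat \<Rightarrow> bool) \<Rightarrow> (nat \<Rightarrow> nat \<Rightarrow> bool) \<Rightarrow> nat \<Rightarrow> nat \<Rightarrow> nat
    \<Rightarrow> nat \<Rightarrow> nat \<Rightarrow> nat \<Rightarrow> nat \<Rightarrow> bool" where
  "spec_graph B F ci ce0 ad c k a b \<longleftrightarrow>
     pf k = 0 \<and> retr F (pf (ps k)) (ps (ps k)) \<and> run ci (pr 5 (pf (ps k))) a \<and> b = 0 \<or>
     pf k = 0 \<and> \<not> retr F (pf (ps k)) (ps (ps k)) \<and> hold B F (pf (ps k)) (ps (ps k)) \<and>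
       run ci (pr 5 (pf (ps k))) a \<and> b = 1 \<or>
     pf k = 0 \<and> \<not> retr F (pf (ps k)) (ps (ps k)) \<and> \<not> hold B F (pf (ps k)) (ps (ps k)) \<and> a = ad \<and> b = 1 \<or>
     pf k \<noteq> 0 \<and> ps k = 0 \<and> (\<exists>b'. signed_out ce0 ad c (pf k - 1) a b' \<and>
       (b' = 1 \<and> b = 1 \<or>
        b' = 0 \<and> b = 1 \<and> (\<exists>j. j \<le> pf k \<and> seen B (pf k) j \<and> \<not> seen F (pf k) j \<and> run ci (pr 5 j) a) \<or>
        b' = 0 \<and> b = 0 \<and> (\<forall>j\<le>pf k. \<not> seen B (pf k) j \<or> seen F (pf k) j \<or> (\<exists>y. run ci (pr 5 j) y \<and> y \<noteq> a)))) \<or>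
     pf k \<noteq> 0 \<and> ps k \<noteq> 0 \<and> retr F (pf (pf k + ps k)) (ps (pf k + ps k)) \<and>
       (\<exists>a' b'. signed_out ce0 ad c (pf k - 1) a' b' \<and>
         (run ci (pr 5 (pf (pf k + ps k))) a' \<and> a = a' \<and> b = b' \<or>
          (\<exists>y. run ci (pr 5 (pf (pf k + ps k))) y \<and> y \<noteq> a') \<and> a = ad \<and> b = 1)) \<or>
     pf k \<noteq> 0 \<and> ps k \<noteq> 0 \<and> \<not> retr F (pf (pf k + ps k)) (ps (pf k + ps k)) \<and> a = ad \<and> b = 1"

lemma ce_spec_graph:
  assumes B: "decp (\<lambda>z. B (pf z) (ps z))" and F: "decp (\<lambda>z. F (pf z) (ps z))"
  shows "ce (\<lambda>z. \<exists>a b. ps z = 2 ^ a * 3 ^ b \<and> spec_graph B F ci ce0 ad (ps (pf z)) (pf (pf z)) a b)"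
  unfolding spec_graph_def
  by (intro ce_intros ce_signed_out ce_dec[OF decp_retr[OF F]] ce_dec[OF decp_hold[OF B F]]
      ce_dec[OF decp_seen[OF B]] ce_dec[OF decp_seen[OF F]]
      decp_retr[OF F] decp_hold[OF B F] decp_seen[OF B] decp_seen[OF F] decp_intros prc_intros)

section \<open>The speculative map as a transformation of machines\<close>

lemma sigma_0_bounded: "sigma_fm 0 p \<Longrightarrow> bounded_fm p"
  by (cases rule: sigma_fm.cases) auto

text \<open>The sentences that are asserted are of the form \<open>All p\<close> with
  \<open>p\<close> bounded, hence \<open>\<Pi>\<^sub>1\<close>; as such they lie in the level on
  which a 2-translation is computable.\<close>

lemma sigma_2_All: "bounded_fm p \<Longrightarrow> sigma_fm 2 (All p)"
  unfolding numeral_2_eq_2 by (intro sigma_fm_pi_fm.intros)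

lemma arith_part_mono: "F \<subseteq> G \<Longrightarrow> arith_part L i F \<subseteq> arith_part L i G"
  unfolding arith_part_def closure_def by (auto intro: derives_mono)

lemma option_eq_SomeI:
  assumes "\<And>y. a = Some y \<longleftrightarrow> b = Some y"
  shows "a = b"
  using assms[of "the a"] assms[of "the b"] by (cases a; cases b) simp_all

lemma spec_graph_head:
  "spec_graph B F ci ce0 ad c (pr 0 (pr j w)) a b \<longleftrightarrow>
     (if retr F j w then run ci (pr 5 j) a \<and> b = 0
      else if hold B F j w then run ci (pr 5 j) a \<and> b = 1 else a = ad \<and> b = 1)"
  unfolding spec_graph_def pf_pr ps_pr by simp

lemma spec_graph_last:
  "spec_graph B F ci ce0 ad c (pr (Suc m) 0) a b \<longleftrightarrow>
     (\<exists>b'. signed_out ce0 ad c m a b' \<and>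
       (b' = 1 \<and> b = 1 \<or>
        b' = 0 \<and> b = 1 \<and> (\<exists>j. j \<le> Suc m \<and> seen B (Suc m) j \<and> \<not> seen F (Suc m) j \<and> run ci (pr 5 j) a) \<or>
        b' = 0 \<and> b = 0 \<and> (\<forall>j\<le>Suc m. \<not> seen B (Suc m) j \<or> seen F (Suc m) j \<or> (\<exists>y. run ci (pr 5 j) y \<and> y \<noteq> a))))"
  unfolding spec_graph_def pf_pr ps_pr diff_Suc_1 by (simp only: nat.distinct simp_thms)

lemma spec_graph_mid:
  assumes "Suc m + Suc n = pr j w"
  shows "spec_graph B F ci ce0 ad c (pr (Suc m) (Suc n)) a b \<longleftrightarrow>
     (if retr F j w then
       (\<exists>a' b'. signed_out ce0 ad c m a' b' \<and>
         (run ci (pr 5 j) a' \<and> a = a' \<and> b = b' \<or>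
          (\<exists>y. run ci (pr 5 j) y \<and> y \<noteq> a') \<and> a = ad \<and> b = 1))
      else a = ad \<and> b = 1)"
  unfolding spec_graph_def pf_pr ps_pr diff_Suc_1 assms
  by (cases "retr F j w") (simp_all only: nat.distinct simp_thms if_True if_False)

text \<open>\<open>TE\<close> decides which numbers code sentences, \<open>TI\<close> computes
  \<open>i\<close>, and \<open>B\<close> and \<open>F\<close> are decidable matrices of
  \<open>phiB\<close> and \<open>phiF\<close>. The value of \<open>inv code_fm\<close> is meaningful
  on codes of formulas only, so statements about it are made for \<open>j\<close> with
  \<open>phiB j\<close>.\<close>

locale speculation = certificates B F "\<lambda>j. i (All (inv code_fm j))" "i (All (Eq (Var 0) (Var 0)))"
  for B F :: "nat \<Rightarrow> nat \<Rightarrow> bool" and i :: "arith_fm \<Rightarrow> ('f, 'r) fm" +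
  fixes L :: "('f, 'r) lang" and e :: "('f, 'r) fm \<Rightarrow> nat" and TE TI :: turing
  assumes e_inj: "inj_on e (sentences L)"
    and TE: "\<And>n. tm_fun TE n = Some (if n \<in> e ` sentences L then 1 else 0)"
    and translation: "translation Arith L i"
    and TI: "\<And>p. p \<in> sentences Arith \<Longrightarrow> sigma_fm 2 p \<Longrightarrow> tm_fun TI (code_fm p) = Some (e (i p))"
    and B: "decp (\<lambda>z. B (pf z) (ps z))" "\<And>j. (\<exists>w. B j w) \<longleftrightarrow> phiB j"
    and F: "decp (\<lambda>z. F (pf z) (ps z))" "\<And>j. (\<exists>w. F j w) \<longleftrightarrow> phiF j"
begin

definition pj :: "nat \<Rightarrow> ('f, 'r) fm" where "pj j = i (All (inv code_fm j))"
definition dummy :: "('f, 'r) fm" where "dummy = i (All (Eq (Var 0) (Var 0)))"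

lemma inv_code [simp]: "inv code_fm (code_fm p) = p"
  by (rule inv_f_f[OF inj_code_fm])

lemma phiB_inv:
  assumes "phiB j"
  shows "code_fm (inv code_fm j) = j" "bounded_fm (inv code_fm j)" "fv (inv code_fm j) \<subseteq> {0}"
proof -
  obtain p where p: "j = code_fm p" using phiB_ex[OF assms] by (rule exE)
  then show "code_fm (inv code_fm j) = j" by simp
  show "bounded_fm (inv code_fm j)" "fv (inv code_fm j) \<subseteq> {0}"
    using assms unfolding p phiB_code by simp_all
qed

lemma pj_sentence: "phiB j \<Longrightarrow> pj j \<in> sentences L"
  unfolding pj_def by (intro translation_sentence[OF translation] All_sentence phiB_inv)

lemma dummy_sentence: "dummy \<in> sentences L"
  unfolding dummy_def by (intro translation_sentence[OF translation] All_sentence bounded_fm.intros) simp_all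

text \<open>5 is the tag of \<open>All\<close>, so \<open>pr 5 j\<close> is the code of the
  universal sentence whose matrix has the code \<open>j\<close>.\<close>

lemma run_pj: "phiB j \<Longrightarrow> run (code_turing TI) (pr 5 j) y \<longleftrightarrow> y = e (pj j)"
proof -
  assume j: "phiB j"
  have "code_fm (All (inv code_fm j)) = pr 5 j" unfolding code_pr phiB_inv(1)[OF j] ..
  moreover have "tm_fun TI (code_fm (All (inv code_fm j))) = Some (e (pj j))"
    unfolding pj_def by (intro TI All_sentence sigma_2_All phiB_inv[OF j])
  ultimately show ?thesis unfolding run_code by auto
qed

lemma run_TE: "run (code_turing TE) a b \<longleftrightarrow> b = (if a \<in> e ` sentences L then 1 else 0)"
  unfolding run_code TE by auto

lemma retr_phiB: "retr F j w \<Longrightarrow> phiB j"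
  using F(2)[of j] phiF_phiB[of j] unfolding retr_def by blast

lemma hold_phiB: "hold B F j w \<Longrightarrow> phiB j"
  using B(2)[of j] unfolding hold_def by blast

lemma seen_phiB: "seen B s j \<Longrightarrow> phiB j"
  using B(2)[of j] unfolding seen_def by blast

lemma e_eq: "p \<in> sentences L \<Longrightarrow> q \<in> sentences L \<Longrightarrow> e p = e q \<longleftrightarrow> p = q"
  using e_inj by (rule inj_on_eq_iff)

abbreviation code_signed :: "('f, 'r) fm \<times> sign \<Rightarrow> nat" where
  "code_signed \<equiv> code_prod e code_sign"

lemma code_signed_Pair: "code_signed (q, g) = 2 ^ e q * 3 ^ code_sign g"
  by (simp add: code_prod_def)

lemma code_sign_eq: "code_sign g = code_sign h \<longleftrightarrow> g = h"
  by (cases g; cases h) simp_all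

lemma code_sign_le: "code_sign g \<le> 1"
  by (cases g) simp_all

lemma code_sign_ex: "b \<le> 1 \<Longrightarrow> \<exists>g. b = code_sign g"
proof -
  assume "b \<le> 1"
  then consider "b = code_sign Minus" | "b = code_sign Plus" by fastforce
  then show ?thesis by cases blast+
qed

definition valid :: "nat \<Rightarrow> ('f, 'r) fm \<times> sign \<Rightarrow> bool" where
  "valid x y \<longleftrightarrow> fst y \<in> sentences L \<and> x = code_signed y"

lemma valid_unique: "valid x y \<Longrightarrow> valid x z \<Longrightarrow> y = z"
proof -
  assume y: "valid x y" and z: "valid x z"
  obtain q g r h where yz: "y = (q, g)" "z = (r, h)" by (metis surj_pair)
  have "2 ^ e q * 3 ^ code_sign g = (2 ^ e r * 3 ^ code_sign h :: nat)"
    using y z by (simp add: valid_def yz code_signed_Pair)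
  then have "e q = e r \<and> code_sign g = code_sign h" by (rule pow23_eq)
  then show "y = z" using y z e_eq[of q r] by (simp add: valid_def yz code_sign_eq)
qed

text \<open>An output that codes no signed sentence is read as the assertion of a logical truth; hence
  \<open>Spec T\<close> is in \<open>machines L e\<close> for every \<open>T\<close>.\<close>

definition dec :: "turing \<Rightarrow> ('f, 'r) signed_map" where
  "dec T n = map_option (\<lambda>x. if \<exists>y. valid x y then (THE y. valid x y) else (dummy, Plus)) (tm_fun T n)"

lemma dec_valid: "tm_fun T n = Some x \<Longrightarrow> valid x y \<Longrightarrow> dec T n = Some y"
proof -
  assume T: "tm_fun T n = Some x" and y: "valid x y"
  have "(THE y. valid x y) = y" by (rule the_equality[where P = "valid x", OF y]) (rule valid_unique[OF _ y])
  moreover have "\<exists>y. valid x y" using y by (rule exI)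
  ultimately show ?thesis unfolding dec_def T by (simp del: split_paired_Ex)
qed

lemma dec_invalid: "tm_fun T n = Some x \<Longrightarrow> \<not> (\<exists>y. valid x y) \<Longrightarrow> dec T n = Some (dummy, Plus)"
  by (simp add: dec_def)

lemma dec_None: "dec T n = None \<longleftrightarrow> tm_fun T n = None"
  by (simp add: dec_def)

lemma dec_sentence: "dec T n = Some (q, g) \<Longrightarrow> q \<in> sentences L"
proof -
  assume d: "dec T n = Some (q, g)"
  then obtain x where x: "tm_fun T n = Some x" by (auto simp: dec_def)
  show ?thesis
  proof (cases "\<exists>y. valid x y")
    case True
    then obtain y where y: "valid x y" by (rule exE)
    then have "y = (q, g)" using dec_valid[OF x y] d by simp
    then show ?thesis using y by (simp add: valid_def)
  next
    case False
    then show ?thesis using dec_invalid[OF x] d dummy_sentence by simp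
  qed
qed

text \<open>The exponents in \<open>2 ^ a * 3 ^ b\<close> are unique. Hence an output that codes a
  signed sentence cannot fall under the replacement by the filler as well.\<close>

lemma signed_out_dec:
  "signed_out (code_turing TE) (e dummy) (code_turing T) n a b \<longleftrightarrow>
     (\<exists>q g. dec T n = Some (q, g) \<and> a = e q \<and> b = code_sign g)"
proof (cases "tm_fun T n")
  case None
  then show ?thesis unfolding signed_out_def run_code[of T] by (simp add: dec_def)
next
  case (Some x)
  have so: "signed_out (code_turing TE) (e dummy) (code_turing T) n a b \<longleftrightarrow>
      (b \<le> 1 \<and> x = 2 ^ a * 3 ^ b \<and> a \<in> e ` sentences L) \<or> (a = e dummy \<and> b = 1 \<and>
        ((\<forall>a'\<le>x. x \<noteq> 2 ^ a' \<and> x \<noteq> 2 ^ a' * 3) \<or> (\<exists>a' b'. b' \<le> 1 \<and> x = 2 ^ a' * 3 ^ b' \<and> a' \<notin> e ` sentences L)))"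
    unfolding signed_out_def run_code[of T] Some run_TE by auto
  have val: "\<exists>y. valid x y" if v: "b' \<le> 1" "x = 2 ^ a' * 3 ^ b'" "a' \<in> e ` sentences L" for a' b'
  proof -
    obtain g where g: "b' = code_sign g" using code_sign_ex[OF v(1)] by (rule exE)
    obtain q where q: "a' = e q" "q \<in> sentences L" using v(3) by (rule imageE)
    have "valid x (q, g)" using v(2) q g by (simp add: valid_def code_signed_Pair)
    then show ?thesis by (rule exI)
  qed
  show ?thesis
  proof (cases "\<exists>y. valid x y")
    case True
    then obtain q g where v: "valid x (q, g)" by auto
    then have x: "x = 2 ^ e q * 3 ^ code_sign g" "q \<in> sentences L"
      by (simp_all add: valid_def code_signed_Pair)
    have a: "a' = e q \<and> b' = code_sign g" if "x = 2 ^ a' * 3 ^ b'" for a' b'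
      by (rule pow23_eq) (use that x in simp)
    \<comment> \<open>The check in \<open>signed_out\<close> runs through exponents up to
      \<open>x\<close>; an exponent is smaller than its power of 2, so the bound is large
      enough.\<close>
    have le: "e q \<le> x"
    proof -
      have "e q < 2 ^ e q" by (rule less_exp)
      also have "\<dots> \<le> x" unfolding x(1) by simp
      finally show ?thesis by simp
    qed
    have "\<not> (\<forall>a'\<le>x. x \<noteq> 2 ^ a' \<and> x \<noteq> 2 ^ a' * 3)"
    proof
      assume "\<forall>a'\<le>x. x \<noteq> 2 ^ a' \<and> x \<noteq> 2 ^ a' * 3"
      then have "x \<noteq> 2 ^ e q \<and> x \<noteq> 2 ^ e q * 3" using le by blast
      then show False using x(1) by (cases g) simp_all
    qed
    moreover have "\<not> (\<exists>a' b'. b' \<le> 1 \<and> x = 2 ^ a' * 3 ^ b' \<and> a' \<notin> e ` sentences L)"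
      using a x(2) by blast
    ultimately have "signed_out (code_turing TE) (e dummy) (code_turing T) n a b \<longleftrightarrow>
        b \<le> 1 \<and> x = 2 ^ a * 3 ^ b \<and> a \<in> e ` sentences L" unfolding so by blast
    also have "\<dots> \<longleftrightarrow> a = e q \<and> b = code_sign g"
      using a[of a b] x code_sign_le by auto
    finally show ?thesis using dec_valid[OF Some v] by simp
  next
    case False
    have "(\<forall>a'\<le>x. x \<noteq> 2 ^ a' \<and> x \<noteq> 2 ^ a' * 3) \<or> (\<exists>a' b'. b' \<le> 1 \<and> x = 2 ^ a' * 3 ^ b' \<and> a' \<notin> e ` sentences L)"
    proof (rule disjCI)
      assume n: "\<not> (\<exists>a' b'. b' \<le> 1 \<and> x = 2 ^ a' * 3 ^ b' \<and> a' \<notin> e ` sentences L)"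
      have no: "x \<noteq> 2 ^ a' * 3 ^ b'" if "b' \<le> 1" for a' b' using n val False that by blast
      show "\<forall>a'\<le>x. x \<noteq> 2 ^ a' \<and> x \<noteq> 2 ^ a' * 3"
        using no[of 0] no[of 1] by simp
    qed
    moreover have "\<not> (b \<le> 1 \<and> x = 2 ^ a * 3 ^ b \<and> a \<in> e ` sentences L)" using val False by blast
    ultimately have "signed_out (code_turing TE) (e dummy) (code_turing T) n a b \<longleftrightarrow> a = e dummy \<and> b = 1"
      unfolding so by blast
    then show ?thesis using dec_invalid[OF Some False] by simp
  qed
qed

text \<open>For a seen \<open>j\<close> the machine \<open>TI\<close> halts on \<open>pr 5 j\<close>
  with a unique result, so the positive statement that the result differs from \<open>e q\<close> is
  the negation of equality.\<close>

lemma active_run: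
  assumes q: "q \<in> sentences L"
  shows "(\<exists>j. j \<le> s \<and> seen B s j \<and> \<not> seen F s j \<and> run (code_turing TI) (pr 5 j) (e q)) \<longleftrightarrow> active B F pj q s"
    and "(\<forall>j\<le>s. \<not> seen B s j \<or> seen F s j \<or> (\<exists>y. run (code_turing TI) (pr 5 j) y \<and> y \<noteq> e q))
      \<longleftrightarrow> \<not> active B F pj q s"
proof -
  have *: "e q = e (pj j) \<longleftrightarrow> pj j = q" if "seen B s j" for j
    using e_eq[OF q pj_sentence[OF seen_phiB[OF that]]] by auto
  have **: "run (code_turing TI) (pr 5 j) y \<longleftrightarrow> y = e (pj j)" if "seen B s j" for j y
    by (rule run_pj[OF seen_phiB[OF that]])
  show "(\<exists>j. j \<le> s \<and> seen B s j \<and> \<not> seen F s j \<and> run (code_turing TI) (pr 5 j) (e q)) \<longleftrightarrow> active B F pj q s"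
    unfolding active_def using * ** by blast
  show "(\<forall>j\<le>s. \<not> seen B s j \<or> seen F s j \<or> (\<exists>y. run (code_turing TI) (pr 5 j) y \<and> y \<noteq> e q))
      \<longleftrightarrow> \<not> active B F pj q s"
    unfolding active_def using * ** by metis
qed

definition out :: "turing \<Rightarrow> ('f, 'r) signed_map" where
  "out T = spec_map B F pj dummy (dec T)"

lemma spec_graph_out_head:
  "spec_graph B F (code_turing TI) (code_turing TE) (e dummy) (code_turing T) (pr 0 (pr j w)) a b \<longleftrightarrow>
     (\<exists>q g. out T (pr 0 (pr j w)) = Some (q, g) \<and> a = e q \<and> b = code_sign g)"
proof -
  consider "retr F j w" | "\<not> retr F j w" "hold B F j w" | "\<not> retr F j w" "\<not> hold B F j w" by blast
  then show ?thesis
  proof cases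
    case 1
    then show ?thesis
      using run_pj[OF retr_phiB[OF 1], of a] unfolding spec_graph_head out_def spec_head by simp
  next
    case 2
    then show ?thesis
      using run_pj[OF hold_phiB[OF 2(2)], of a] unfolding spec_graph_head out_def spec_head by simp
  next
    case 3
    then show ?thesis unfolding spec_graph_head out_def spec_head by simp
  qed
qed

lemma spec_graph_out_last:
  "spec_graph B F (code_turing TI) (code_turing TE) (e dummy) (code_turing T) (pr (Suc m) 0) a b \<longleftrightarrow>
     (\<exists>q g. out T (pr (Suc m) 0) = Some (q, g) \<and> a = e q \<and> b = code_sign g)"
proof (cases "dec T m")
  case None
  then show ?thesis unfolding spec_graph_last out_def spec_last signed_out_dec by simp
next
  case (Some y)
  obtain q g where y: "y = (q, g)" by (metis surj_pair)
  have q: "q \<in> sentences L" using Some dec_sentence unfolding y by blast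
  have so: "signed_out (code_turing TE) (e dummy) (code_turing T) m a b' \<longleftrightarrow> a = e q \<and> b' = code_sign g" for b'
    unfolding signed_out_dec Some y by auto
  show ?thesis
  proof (cases "a = e q")
    case False
    then show ?thesis unfolding spec_graph_last so out_def spec_last Some y by simp
  next
    case True
    show ?thesis unfolding True spec_graph_last so[unfolded True] active_run[OF q] out_def spec_last Some y
      by (cases g) auto
  qed
qed

lemma spec_graph_out_mid:
  assumes "Suc m + Suc n = pr j w"
  shows "spec_graph B F (code_turing TI) (code_turing TE) (e dummy) (code_turing T) (pr (Suc m) (Suc n)) a b \<longleftrightarrow>
     (\<exists>q g. out T (pr (Suc m) (Suc n)) = Some (q, g) \<and> a = e q \<and> b = code_sign g)"
proof (cases "retr F j w")
  case False
  then show ?thesis unfolding spec_graph_mid[OF assms] out_def spec_mid[OF assms] by simp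
next
  case True
  note pB = retr_phiB[OF True]
  show ?thesis
  proof (cases "dec T m")
    case None
    then show ?thesis unfolding spec_graph_mid[OF assms] out_def spec_mid[OF assms] signed_out_dec
      using True by simp
  next
    case (Some y)
    obtain q g where y: "y = (q, g)" by (metis surj_pair)
    have "q \<in> sentences L" using Some dec_sentence unfolding y by blast
    then have q: "e q = e (pj j) \<longleftrightarrow> q = pj j" using pj_sentence[OF pB] by (rule e_eq)
    have so: "signed_out (code_turing TE) (e dummy) (code_turing T) m a' b' \<longleftrightarrow> a' = e q \<and> b' = code_sign g" for a' b'
      unfolding signed_out_dec Some y by auto
    show ?thesis
    proof (cases "q = pj j")
      case True
      then show ?thesis unfolding spec_graph_mid[OF assms] out_def spec_mid[OF assms] Some y so run_pj[OF pB]
        using \<open>retr F j w\<close> by simp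
    next
      case False
      then show ?thesis unfolding spec_graph_mid[OF assms] out_def spec_mid[OF assms] Some y so run_pj[OF pB]
        using \<open>retr F j w\<close> q by simp
    qed
  qed
qed

lemma spec_graph_out:
  "spec_graph B F (code_turing TI) (code_turing TE) (e dummy) (code_turing T) k a b \<longleftrightarrow>
     (\<exists>q g. out T k = Some (q, g) \<and> a = e q \<and> b = code_sign g)"
proof (cases k rule: spec_cases)
  case (head j w)
  show ?thesis unfolding head by (rule spec_graph_out_head)
next
  case (last m)
  show ?thesis unfolding last by (rule spec_graph_out_last)
next
  case (mid m n j w)
  show ?thesis unfolding mid(1) by (rule spec_graph_out_mid[OF mid(2)])
qed

lemma out_sentence:
  assumes "out T k = Some (q, g)"
  shows "q \<in> sentences L"
proof (cases k rule: spec_cases)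
  case (head j w)
  then show ?thesis using assms unfolding out_def head spec_head
    by (auto simp: dummy_sentence pj_sentence retr_phiB hold_phiB split: if_splits)
next
  case (last m)
  then show ?thesis using assms unfolding out_def last spec_last by (auto dest: dec_sentence)
next
  case (mid m n j w)
  then show ?thesis using assms unfolding out_def mid(1) spec_mid[OF mid(2)]
    by (auto simp: dummy_sentence dest: dec_sentence split: if_splits)
qed

lemma certificates_pj: "certificates B F pj"
  unfolding pj_def by (rule certificates_axioms)

text \<open>The program is found before \<open>T\<close> is given: in the argument of the graph
  \<open>G\<close>, the second component is the parameter, later the code of \<open>T\<close>, and
  the first one is the input.\<close>

lemma spec_exists:
  "\<exists>K P. \<forall>T. decodes L e (machine K P (code_turing T)) (out T)"
proof -
  define G :: "nat \<Rightarrow> nat \<Rightarrow> bool" where "G = (\<lambda>x y. \<exists>a b. y = 2 ^ a * 3 ^ b \<and>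
    spec_graph B F (code_turing TI) (code_turing TE) (e dummy) (ps x) (pf x) a b)"
  have "ce (\<lambda>z. G (pf z) (ps z))" unfolding G_def by (rule ce_spec_graph[OF B(1) F(1)])
  from ce_function_tm[OF this] obtain K P where
    KP: "\<forall>c n. (\<forall>y y'. G (pr n c) y \<longrightarrow> G (pr n c) y' \<longrightarrow> y = y') \<longrightarrow>
      (\<forall>y. tm_fun (machine K P c) n = Some y \<longleftrightarrow> G (pr n c) y)" by (elim exE)
  have "decodes L e (machine K P (code_turing T)) (out T)" for T
  proof -
    have G: "G (pr n (code_turing T)) y \<longleftrightarrow> map_option code_signed (out T n) = Some y" for n y
    proof -
      have "G (pr n (code_turing T)) y \<longleftrightarrow> (\<exists>q g. out T n = Some (q, g) \<and> y = 2 ^ e q * 3 ^ code_sign g)"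
        unfolding G_def pf_pr ps_pr spec_graph_out by blast
      also have "\<dots> \<longleftrightarrow> map_option code_signed (out T n) = Some y"
        by (cases "out T n") (auto simp: code_signed_Pair)
      finally show ?thesis .
    qed
    have fn: "\<forall>y y'. G (pr n (code_turing T)) y \<longrightarrow> G (pr n (code_turing T)) y' \<longrightarrow> y = y'" for n
      unfolding G by (metis option.inject)
    have "tm_fun (machine K P (code_turing T)) n = Some y \<longleftrightarrow> map_option code_signed (out T n) = Some y" for n y
      using KP[THEN spec, THEN spec, THEN mp, OF fn, THEN spec] unfolding G .
    then have "map_option code_signed (out T n) = tm_fun (machine K P (code_turing T)) n" for n
      by (intro option_eq_SomeI) (rule sym)
    then show ?thesis unfolding decodes_def using out_sentence by blast
  qed
  then show ?thesis by blast
qed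

lemma decoded_dec: "T \<in> machines L e \<Longrightarrow> decoded L e T = dec T"
proof -
  assume "T \<in> machines L e"
  then obtain M where M: "decodes L e T M" unfolding machines_def by blast
  have Mt: "map_option code_signed (M n) = tm_fun T n" and Ms: "M n = Some (q, g) \<Longrightarrow> q \<in> sentences L" for n q g
    using M unfolding decodes_def by blast+
  have "M n = dec T n" for n
  proof (cases "M n")
    case None
    then have "tm_fun T n = None" using Mt[of n] by simp
    then show ?thesis using None dec_None[of T n] by simp
  next
    case (Some y)
    obtain q g where y: "y = (q, g)" by (metis surj_pair)
    have "tm_fun T n = Some (code_signed (q, g))" using Mt[of n] Some y by simp
    moreover have "valid (code_signed (q, g)) (q, g)" using Ms[of n q g] Some y by (simp add: valid_def)
    ultimately show ?thesis unfolding Some y by (rule dec_valid[symmetric])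
  qed
  then have "M = dec T" by (rule ext)
  then show ?thesis using decoded_eq[OF e_inj M] by simp
qed

lemma stab_sentences: "stabilization (dec T) \<subseteq> sentences L"
  unfolding stabilization_def using dec_sentence by blast

lemma stab_out: "stabilization (dec T) \<subseteq> stabilization (out T)"
  unfolding out_def by (rule certificates.stab_spec[OF certificates_pj])

lemma out_speculative:
  assumes Q: "\<forall>p\<in>Q. derives_via L i (stabilization (dec T)) p"
  shows "speculative L i (out T)"
  unfolding speculative_def
proof (intro ballI impI)
  fix p
  assume p: "p \<in> F0" and pr: "\<forall>m. derives Arith Q (inst p m)"
  have b: "bounded_fm p" "fv p \<subseteq> {0}" using p sigma_0_bounded by (auto simp: F0_def)
  show "derives_via L i (stabilization (out T)) (All p)"
  proof (cases "\<exists>t. \<not> sat (case_nat t (\<lambda>_. 0)) p")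
    case True
    then obtain t where "\<not> sat (case_nat t (\<lambda>_. 0)) p" by (rule exE)
    then have "provable Q (Neg (inst p t))" using provable_inst[OF b, of t "\<lambda>_. 0"] by simp
    moreover have "wf_fm Arith (All p)" using b by (simp add: bounded_wf)
    ultimately have "provable Q (All p)" by (rule derives_exfalso[OF spec[OF pr]])
    then have "derives_via L i (stabilization (dec T)) (All p)" by (rule derives_via_Q[OF Q])
    then show ?thesis unfolding derives_via_def
      by (rule derives_mono) (rule arith_part_mono[OF stab_out])
  next
    case False
    have "phiB (code_fm p)" using b phiB_code by blast
    then obtain w where w: "B (code_fm p) w" using B(2) by blast
    have nF: "\<not> F (code_fm p) v" for v using F(2)[of "code_fm p"] False phiF_code[OF b] by blast
    have "pj (code_fm p) \<in> stabilization (out T)"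
      unfolding out_def by (rule certificates.stab_spec_true[OF certificates_pj w nF])
    then have "i (All p) \<in> stabilization (out T)" by (simp add: pj_def)
    moreover have "wf_fm L (i (All p))"
      using translation_sentence[OF translation All_sentence[OF b]] by (simp add: sentences_def)
    ultimately have "derives L (stabilization (out T)) (i (All p))" by (rule derives.Assm)
    then show ?thesis by (rule derives_viaI[OF translation All_sentence[OF b]])
  qed
qed

lemma out_consistent:
  assumes "one_consistent L i (stabilization (dec T))"
  shows "consistent L (stabilization (out T))"
proof (rule consistent_extension[OF translation stab_sentences assms])
  fix q
  assume "q \<in> stabilization (out T)"
  then have "q \<in> stabilization (dec T) \<or> q = dummy \<or> (\<exists>j. (\<exists>w. B j w) \<and> (\<forall>w. \<not> F j w) \<and> q = pj j)"
    unfolding out_def by (rule certificates.stab_spec_cases[OF certificates_pj])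
  then show "q \<in> stabilization (dec T) \<or> (\<exists>p. true_pi p \<and> q = i (All p))"
  proof (elim disjE exE conjE)
    \<comment> \<open>The filler is itself the translation of a true universal sentence.\<close>
    assume "q = dummy"
    moreover have "true_pi (Eq (Var 0) (Var 0))" by (simp add: true_pi_def bounded_fm.intros)
    ultimately show ?thesis unfolding dummy_def by blast
  next
    fix j w
    assume j: "B j w" "\<forall>w. \<not> F j w" "q = pj j"
    have pB: "phiB j" using j(1) B(2) by blast
    have "\<not> phiF j" using j(2) F(2) by blast
    then have "true_pi (inv code_fm j)"
      using phiB_inv[OF pB] phiF_code[OF phiB_inv(2,3)[OF pB]] unfolding true_pi_def by simp
    then show ?thesis using j(3) unfolding pj_def by blast
  qed simp
qed

end

theorem theorem3p20:
  fixes L :: "('f, 'r) lang"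
    and e :: "('f, 'r) fm \<Rightarrow> nat"
    and i :: "arith_fm \<Rightarrow> ('f, 'r) fm"
  assumes "language_encoding L e"
    and "n_translation 2 L e i"
  shows "\<exists>Spec :: turing \<Rightarrow> turing.
    computable_map UNIV code_turing UNIV code_turing (\<lambda>T. Some (Spec T)) \<and>
    range Spec \<subseteq> machines L e \<and>
    (\<forall>T\<in>machines L e. (\<forall>p\<in>Q. derives_via L i (stab L e T) p) \<longrightarrow>
       speculative L i (decoded L e (Spec T)) \<and>
       ((\<forall>n. decoded L e T n \<noteq> None) \<longrightarrow> (\<forall>n. decoded L e (Spec T) n \<noteq> None))) \<and>
    (\<forall>T\<in>machines L e. stab L e T \<subseteq> stab L e (Spec T)) \<and>
    (\<forall>T\<in>machines L e. one_consistent L i (stab L e T) \<longrightarrow> consistent L (stab L e (Spec T)))"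
proof -
  have enc: "inj_on e (sentences L)" "computable_set (e ` sentences L)"
    using assms(1) unfolding language_encoding_def is_encoding_def by blast+
  obtain TE where TE: "\<And>n. tm_fun TE n = Some (if n \<in> e ` sentences L then 1 else 0)"
    using enc(2) unfolding computable_set_def by blast
  have tr: "translation Arith L i" using assms(2) unfolding n_translation_def by (rule conjunct1)
  have "\<exists>T. \<forall>p\<in>{p \<in> sentences Arith. sigma_fm 2 p}. map_option e (Some (i p)) = tm_fun T (code_fm p)"
    using assms(2) unfolding n_translation_def computable_map_def by (elim conjE)
  then obtain TI where TI0: "\<forall>p\<in>{p \<in> sentences Arith. sigma_fm 2 p}. map_option e (Some (i p)) = tm_fun TI (code_fm p)"
    by (rule exE)
  have TI: "tm_fun TI (code_fm p) = Some (e (i p))" if "p \<in> sentences Arith" "sigma_fm 2 p" for p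
    using bspec[OF TI0, of p] that by simp
  obtain B where B: "decp (\<lambda>z. B (pf z) (ps z)) \<and> (\<forall>j. phiB j \<longleftrightarrow> (\<exists>w. B j w))"
    using ceD[OF ce_phiB] by (rule exE)
  obtain F where F: "decp (\<lambda>z. F (pf z) (ps z)) \<and> (\<forall>j. phiF j \<longleftrightarrow> (\<exists>w. F j w))"
    using ceD[OF ce_phiF] by (rule exE)
  have inj_i: "inj_on i (sentences Arith)" using tr unfolding translation_def by (elim conjE)
  interpret speculation B F i L e TE TI
  proof
    show "\<exists>v. B j v" if "F j w" for j w using that B F phiF_phiB by blast
    \<comment> \<open>Each sentence has one index, because \<open>i\<close> is injective on
      sentences and certified numbers are codes of formulas.\<close>
    show "j = j'" if "B j v" "B j' v'" and eq: "i (All (inv code_fm j)) = i (All (inv code_fm j'))" for j v j' v'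
    proof -
      have "phiB j" "phiB j'" using B that by blast+
      then obtain p p' where p: "j = code_fm p" "j' = code_fm p'" using phiB_ex by blast
      have inv: "inv code_fm (code_fm r) = r" for r by (rule inv_f_f[OF inj_code_fm])
      have "All p \<in> sentences Arith" "All p' \<in> sentences Arith"
        using \<open>phiB j\<close> \<open>phiB j'\<close> unfolding p phiB_code by (simp_all add: All_sentence)
      then have "All p = All p'" using inj_onD[OF inj_i] eq unfolding p inv by blast
      then show ?thesis unfolding p by simp
    qed
  qed (use enc TE tr TI B F in \<open>simp_all\<close>)
  from spec_exists obtain K P where KP0: "\<forall>T. decodes L e (machine K P (code_turing T)) (out T)"
    by (elim exE)
  note KP = spec[OF KP0]
  define Spec where "Spec T = machine K P (code_turing T)" for T
  have dS: "decoded L e (Spec T) = out T" for T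
    unfolding Spec_def by (rule decoded_eq[OF enc(1) KP])
  \<comment> \<open>On every number \<open>n\<close> this machine computes the code of the table
    with parameter \<open>n\<close>; on the code of \<open>T\<close> that is the code of
    \<open>Spec T\<close>.\<close>
  obtain C where C: "\<forall>n. tm_fun C n = Some (code_turing (machine K P n))"
    using prc_tm[OF prc_code_machine] by blast
  have "computable_map UNIV code_turing UNIV code_turing (\<lambda>T. Some (Spec T))"
    unfolding computable_map_def Spec_def using C by (auto intro!: exI[of _ C])
  moreover have "range Spec \<subseteq> machines L e"
    unfolding machines_def Spec_def using KP by blast
  moreover have "\<forall>T\<in>machines L e. (\<forall>p\<in>Q. derives_via L i (stab L e T) p) \<longrightarrow>
       speculative L i (decoded L e (Spec T)) \<and>
       ((\<forall>n. decoded L e T n \<noteq> None) \<longrightarrow> (\<forall>n. decoded L e (Spec T) n \<noteq> None))"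
  proof (intro ballI impI conjI allI)
    fix T
    assume T: "T \<in> machines L e" and "\<forall>p\<in>Q. derives_via L i (stab L e T) p"
    then show "speculative L i (decoded L e (Spec T))"
      unfolding dS stab_def decoded_dec[OF T] by (intro out_speculative)
  next
    fix T n
    assume T: "T \<in> machines L e" and "\<forall>n. decoded L e T n \<noteq> None"
    then show "decoded L e (Spec T) n \<noteq> None"
      unfolding dS decoded_dec[OF T] out_def by (intro spec_total) blast
  qed
  moreover have "\<forall>T\<in>machines L e. stab L e T \<subseteq> stab L e (Spec T)"
    by (intro ballI) (simp only: stab_def dS decoded_dec stab_out)
  moreover have "\<forall>T\<in>machines L e. one_consistent L i (stab L e T) \<longrightarrow> consistent L (stab L e (Spec T))"
    by (intro ballI impI) (simp only: stab_def dS decoded_dec out_consistent)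
  ultimately show ?thesis by (intro exI[of _ Spec] conjI)
qed

end
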